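(* Let $G$ be a finite directed acyclic graph with a unique source $s$ and a unique sink $t$ and no idle edges. Suppose $G$ is strongly planar and $\mathcal{F}_1(G)$ is Gorenstein. Then the equatorial triangulation of the order polytope $\mathcal{O}(P_G)$ corresponds to an equatorial flow triangulation of $\mathcal{F}_1(G)$ under the integral equivalence $\phi:\mathcal{O}(P_G)\to\mathcal{F}_1(G)$; that is, there is a route decomposition $\mathcal{R}$ of $G$ with a linear ordering $\leq$ such that $\phi$ maps the simplices of the equatorial triangulation of $\mathcal{O}(P_G)$ bijectively onto the simplices of the equatorial flow triangulation $T_{\mathrm{eq}}\ast\Delta_{\mathcal{R}}$ determined by $(\mathcal{R},\leq)$.
   Context: Graphs and flow polytopes. Directed graphs may have parallel edges. The vertices of $G$ are ordered $s<1<\cdots<n<t$ with every edge going from a smaller to a larger vertex; $1,\dots,n$ are the inner vertices. An edge is idle if it is the only incoming or the only outgoing edge of some inner vertex. A route is a directed path from $s$ to $t$ (a sequence of edges); $\chi_R\in\mathbb{R}^{E(G)}$ is the indicator vector of a route $R$. The flow polytope $\mathcal{F}_1(G)$ is the set of $x\in\mathbb{R}_{\ge 0}^{E(G)}$ with inflow equal to outflow at every inner vertex and total outflow $1$ at $s$; its vertices are the $\chi_R$. A lattice polytope $P\subseteq\mathbb{R}^d$ is Gorenstein if for $C=\{(x,t)\in\mathbb{R}^{d+1}:t\ge 0,\ x\in tP\}$ there is $c\in\mathbb{Z}^{d+1}$ with $c+(C\cap\mathbb{Z}^{d+1})=C^\circ\cap\mathbb{Z}^{d+1}$, $C^\circ$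 the relative interior. It is known (von Bell et al.) that, for $G$ without idle edges, $\mathcal{F}_1(G)$ is Gorenstein iff $\mathrm{indeg}_G(v)=\mathrm{outdeg}_G(v)$ for every inner $v$ (degree equality). Strong planarity and duality. $G$ is strongly planar if it has a planar realization in which for each directed edge $(i,j)$ the $x$-coordinate of $i$ is strictly less than that of $j$ and each edge is embedded as the graph of a piecewise differentiable function of $x$. Fix such a realization. $P_G$ is the poset whose Hasse diagram is the dual graph of $G$ with the vertex of the infinite region deleted: its elements are the bounded regions, and $p$ is covered by $q$ when $p$ and $q$ share an edge of $G$ with $p$ directly below and $q$ directly above it. Let $\widehat{P_G}=P_G\cup\{\hat 0,\hat 1\}$, where $\hat 0$ and $\hat 1$ represent the parts of the infinite region below and above $G$; the edges of $G$ are in bijection with the cover relations of $\widehat{P_G}$. Order polytopes. For a finite poset $P$, $\mathcal{O}(P)$ is the set of order-preserving maps $f:P\to[0,1]$; its vertices are the indicator functions $\chi_F$ of upper order ideals $F\subseteq P$. The integral equivalence $\phi:\mathcal{O}(P_G)\to\mathcal{F}_1(G)$ (Mészáros–Morales–Striker) sends $f$ to the flow with value $f(y)-f(x)$ on the edge dual to the cover relation $x\prec y$ of $\widehat{P_G}$, where $f(\hat 0)=0$ and $f(\hat 1)=1$. Equatorial triangulation of $\mathcal{O}(P)$ (Reiner–Welker). A graded poset is one in which all maximal chains have the same length; under the hypotheses of the claim $P_G$ is known to be graded. Let $P$ be graded with ranks $1,\dots,r$, and $P_i$ the set of elements of rank $i$. The rank-constant upper order ideals are $F^{rc}_j=\bigsqcup_{i>j}P_i$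 for $0\le j\le r$ (so $F^{rc}_r=\emptyset$, $F^{rc}_0=P$). An order-preserving map $f:P\to\mathbb{R}_{\ge 0}$ is equatorial if $\min_{p\in P}f(p)=0$ and for every $j\in\{2,\dots,r\}$ there is a cover relation $p_{j-1}\prec p_j$ with $p_{j-1}\in P_{j-1}$, $p_j\in P_j$ and $f(p_{j-1})=f(p_j)$. A chain $F_1\subset\cdots\subset F_m$ of upper order ideals is equatorial if $\chi_{F_1}+\cdots+\chi_{F_m}$ is equatorial. $\Delta_{eq}(P)$ is the simplicial complex of equatorial chains of nonempty upper order ideals. The equatorial triangulation of $\mathcal{O}(P)$ is $\sigma\ast\Delta_{eq}(P)$, where $\sigma$ is the simplex spanned by $\{F^{rc}_j\}_{j=0}^r$; its simplices are the convex hulls of the points $\chi_F$, with $F$ ranging over the union of a subset of $\{F^{rc}_j\}_{j=0}^r$ and an equatorial chain of nonempty ideals. Equatorial flow triangulations. A framing is a choice, for each inner vertex $v$, of linear orders on the set $\mathrm{in}(v)$ of incoming and the set $\mathrm{out}(v)$ of outgoing edges. For a route $P$ through $v$, $Pv$ is its part from $s$ to $v$ and $vP$ its part from $v$ to $t$. For distinct directed paths $P,Q$ from $v$ to $t$, let $w$ be the last vertex of their common initial segment; $P\prec_{\mathrm{Out}(v)}Q$ if the edge of $P$ leaving $w$ is smaller in $\mathrm{out}(w)$ than that of $Q$. For distinct directed paths $P,Q$ from $s$ to $v$, let $w$ be the first vertex of their common final segment; $P\prec_{\mathrm{In}(v)}Q$ if the edge of $P$ entering $w$ is smaller in $\mathrm{in}(w)$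 than that of $Q$. Routes $P,Q$ sharing an inner vertex $v$ are in conflict at $v$ if (up to exchanging them) $Pv\prec_{\mathrm{In}(v)}Qv$ and $vQ\prec_{\mathrm{Out}(v)}vP$; they are coherent if not in conflict at any common inner vertex; a clique is a set of pairwise coherent routes. The DKK triangulation induced by a framing is the triangulation of $\mathcal{F}_1(G)$ whose simplices are $\mathrm{conv}\{\chi_R:R\in C\}$ for cliques $C$. A route decomposition of $G$ is a set $\mathcal{R}$ of routes whose edge sets partition $E(G)$. Given a linear order $\mathcal{R}=\{R_1<\cdots<R_k\}$, the route decomposition framing orders the incoming edges, and likewise the outgoing edges, at each inner vertex by the order of the routes of $\mathcal{R}$ containing them; let $T$ be the induced DKK triangulation. $\Gamma$ is the polyhedral subcomplex of $\partial\mathcal{F}_1(G)$ generated by all faces $\bigcap_{R\in\mathcal{R}}F_R$ with each $F_R$ a facet of $\mathcal{F}_1(G)$ not containing $\chi_R$; $T_{\mathrm{eq}}=T|_\Gamma$ consists of the simplices of $T$ contained in a face of $\Gamma$; $\Delta_{\mathcal{R}}=\mathrm{conv}\{\chi_R:R\in\mathcal{R}\}$. The equatorial flow triangulation is the join $T_{\mathrm{eq}}\ast\Delta_{\mathcal{R}}$, generated by the simplices $\mathrm{conv}(F\cup\Delta_{\mathcal{R}})$ for $F$ a face of $T_{\mathrm{eq}}$. *)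

theory Defs
  imports
    "HOL-Analysis.Analysis"
    "HOL-Library.Function_Algebras"
    "HOL-Library.Disjoint_Sets"
    "Graph_Theory.Digraph"
    "Graph_Theory.Arc_Walk"
begin

section \<open>Real-valued functions as a vector space\<close>

text \<open>The elements of the poset are regions of the plane, which do not form a finite type.
  So \<open>\<real>\<^sup>P\<close> is the space of functions vanishing outside \<open>P\<close>, inside the space of all functions.\<close>

instantiation "fun" :: (type, real_vector) real_vector
begin

definition scaleR_fun :: "real \<Rightarrow> ('a \<Rightarrow> 'b) \<Rightarrow> 'a \<Rightarrow> 'b" where
  "scaleR_fun c f = (\<lambda>x. c *\<^sub>R f x)"

instance
  by standard (simp_all add: scaleR_fun_def plus_fun_def algebra_simps)

end


section \<open>Gorenstein polytopes\<close>

definition cone_over :: "(real ^ 'n) set \<Rightarrow> ((real ^ 'n) \<times> real) set" where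
  "cone_over P = {(x, t). t \<ge> 0 \<and> x \<in> (\<lambda>y. t *\<^sub>R y) ` P}"

definition int_lattice :: "((real ^ 'n) \<times> real) set" where
  "int_lattice = {(x, t). (\<forall>i. x $ i \<in> \<int>) \<and> t \<in> \<int>}"

text \<open>To be applied to lattice polytopes only; flow polytopes are lattice polytopes.\<close>

definition gorenstein :: "(real ^ 'n) set \<Rightarrow> bool" where
  "gorenstein P \<longleftrightarrow> (\<exists>c \<in> int_lattice.
     (\<lambda>z. c + z) ` (cone_over P \<inter> int_lattice) = rel_interior (cone_over P) \<inter> int_lattice)"


section \<open>Flow polytopes\<close>

definition inner_verts :: "('v, 'e) pre_digraph \<Rightarrow> 'v \<Rightarrow> 'v \<Rightarrow> 'v set" where
  "inner_verts G s t = verts G - {s, t}"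

definition idle :: "('v, 'e) pre_digraph \<Rightarrow> 'v \<Rightarrow> 'v \<Rightarrow> 'e \<Rightarrow> bool" where
  "idle G s t e \<longleftrightarrow> (\<exists>v \<in> inner_verts G s t. in_arcs G v = {e} \<or> out_arcs G v = {e})"

definition route :: "('v, 'e) pre_digraph \<Rightarrow> 'v \<Rightarrow> 'v \<Rightarrow> 'e list \<Rightarrow> bool" where
  "route G s t R \<longleftrightarrow> pre_digraph.awalk G s R t"

definition route_vec :: "'e list \<Rightarrow> real ^ 'e" where
  "route_vec R = (\<chi> e. if e \<in> set R then 1 else 0)"

text \<open>The space \<open>real ^ 'e\<close> has one coordinate for each element of the type of edges, so here and
  below \<open>arcs G = UNIV\<close> is understood.\<close>

definition flow_polytope :: "('v, 'e::finite) pre_digraph \<Rightarrow> 'v \<Rightarrow> 'v \<Rightarrow> (real ^ 'e) set" where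
  "flow_polytope G s t = {x. (\<forall>e. x $ e \<ge> 0) \<and>
     (\<forall>v \<in> inner_verts G s t. (\<Sum>e \<in> in_arcs G v. x $ e) = (\<Sum>e \<in> out_arcs G v. x $ e)) \<and>
     (\<Sum>e \<in> out_arcs G s. x $ e) = 1}"


section \<open>Strongly planar realizations and the dual poset\<close>

text \<open>In a realization, \<open>pos v\<close> is the point representing \<open>v\<close>, and the edge \<open>e\<close> is the graph of
  \<open>h e\<close> over the interval between the \<open>x\<close>-coordinates of its end points; values of \<open>h e\<close> outside
  that interval are irrelevant.\<close>

definition tail_x :: "('v, 'e) pre_digraph \<Rightarrow> ('v \<Rightarrow> real \<times> real) \<Rightarrow> 'e \<Rightarrow> real" where
  "tail_x G pos e = fst (pos (tail G e))"

definition head_x :: "('v, 'e) pre_digraph \<Rightarrow> ('v \<Rightarrow> real \<times> real) \<Rightarrow> 'e \<Rightarrow> real" where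
  "head_x G pos e = fst (pos (head G e))"

definition open_edge ::
  "('v, 'e) pre_digraph \<Rightarrow> ('v \<Rightarrow> real \<times> real) \<Rightarrow> ('e \<Rightarrow> real \<Rightarrow> real) \<Rightarrow> 'e \<Rightarrow> (real \<times> real) set" where
  "open_edge G pos h e = (\<lambda>x. (x, h e x)) ` {tail_x G pos e <..< head_x G pos e}"

definition strongly_planar_realization ::
  "('v, 'e) pre_digraph \<Rightarrow> ('v \<Rightarrow> real \<times> real) \<Rightarrow> ('e \<Rightarrow> real \<Rightarrow> real) \<Rightarrow> bool" where
  "strongly_planar_realization G pos h \<longleftrightarrow>
     inj_on pos (verts G) \<and>
     (\<forall>e \<in> arcs G.
        tail_x G pos e < head_x G pos e \<and>
        h e piecewise_differentiable_on {tail_x G pos e .. head_x G pos e} \<and>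
        pos (tail G e) = (tail_x G pos e, h e (tail_x G pos e)) \<and>
        pos (head G e) = (head_x G pos e, h e (head_x G pos e))) \<and>
     (\<forall>e \<in> arcs G. \<forall>v \<in> verts G. pos v \<notin> open_edge G pos h e) \<and>
     (\<forall>e \<in> arcs G. \<forall>e' \<in> arcs G. e \<noteq> e' \<longrightarrow> open_edge G pos h e \<inter> open_edge G pos h e' = {})"

definition drawing ::
  "('v, 'e) pre_digraph \<Rightarrow> ('v \<Rightarrow> real \<times> real) \<Rightarrow> ('e \<Rightarrow> real \<Rightarrow> real) \<Rightarrow> (real \<times> real) set" where
  "drawing G pos h = pos ` verts G \<union> (\<Union>e \<in> arcs G. open_edge G pos h e)"

definition bounded_regions ::
  "('v, 'e) pre_digraph \<Rightarrow> ('v \<Rightarrow> real \<times> real) \<Rightarrow> ('e \<Rightarrow> real \<Rightarrow> real) \<Rightarrow> (real \<times> real) set set" where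
  "bounded_regions G pos h = {p \<in> components (- drawing G pos h). bounded p}"

definition directly_below ::
  "('v, 'e) pre_digraph \<Rightarrow> ('v \<Rightarrow> real \<times> real) \<Rightarrow> ('e \<Rightarrow> real \<Rightarrow> real) \<Rightarrow>
    (real \<times> real) set \<Rightarrow> 'e \<Rightarrow> bool" where
  "directly_below G pos h p e \<longleftrightarrow>
     (\<forall>x \<in> {tail_x G pos e <..< head_x G pos e}. \<forall>\<^sub>F y in at_left (h e x). (x, y) \<in> p)"

definition directly_above ::
  "('v, 'e) pre_digraph \<Rightarrow> ('v \<Rightarrow> real \<times> real) \<Rightarrow> ('e \<Rightarrow> real \<Rightarrow> real) \<Rightarrow>
    (real \<times> real) set \<Rightarrow> 'e \<Rightarrow> bool" where
  "directly_above G pos h p e \<longleftrightarrow>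
     (\<forall>x \<in> {tail_x G pos e <..< head_x G pos e}. \<forall>\<^sub>F y in at_right (h e x). (x, y) \<in> p)"

definition region_cover ::
  "('v, 'e) pre_digraph \<Rightarrow> ('v \<Rightarrow> real \<times> real) \<Rightarrow> ('e \<Rightarrow> real \<Rightarrow> real) \<Rightarrow> (real \<times> real) set rel" where
  "region_cover G pos h = {(p, q). p \<in> bounded_regions G pos h \<and> q \<in> bounded_regions G pos h \<and>
     (\<exists>e \<in> arcs G. directly_below G pos h p e \<and> directly_above G pos h q e)}"

text \<open>The order relation of \<open>P\<^sub>G\<close>.\<close>

definition region_order ::
  "('v, 'e) pre_digraph \<Rightarrow> ('v \<Rightarrow> real \<times> real) \<Rightarrow> ('e \<Rightarrow> real \<Rightarrow> real) \<Rightarrow> (real \<times> real) set rel" where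
  "region_order G pos h =
     (region_cover G pos h)\<^sup>* \<inter> (bounded_regions G pos h \<times> bounded_regions G pos h)"

text \<open>The parts of the infinite region below and above \<open>G\<close>, representing the added bottom and top
  elements.\<close>

definition outer_below ::
  "('v, 'e) pre_digraph \<Rightarrow> 'v \<Rightarrow> 'v \<Rightarrow> ('v \<Rightarrow> real \<times> real) \<Rightarrow> ('e \<Rightarrow> real \<Rightarrow> real) \<Rightarrow>
    (real \<times> real) set" where
  "outer_below G s t pos h = {(x, y). fst (pos s) < x \<and> x < fst (pos t) \<and>
     (\<forall>y' \<le> y. (x, y') \<notin> drawing G pos h)}"

definition outer_above ::
  "('v, 'e) pre_digraph \<Rightarrow> 'v \<Rightarrow> 'v \<Rightarrow> ('v \<Rightarrow> real \<times> real) \<Rightarrow> ('e \<Rightarrow> real \<Rightarrow> real) \<Rightarrow>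
    (real \<times> real) set" where
  "outer_above G s t pos h = {(x, y). fst (pos s) < x \<and> x < fst (pos t) \<and>
     (\<forall>y' \<ge> y. (x, y') \<notin> drawing G pos h)}"

definition regions_hat ::
  "('v, 'e) pre_digraph \<Rightarrow> 'v \<Rightarrow> 'v \<Rightarrow> ('v \<Rightarrow> real \<times> real) \<Rightarrow> ('e \<Rightarrow> real \<Rightarrow> real) \<Rightarrow>
    (real \<times> real) set set" where
  "regions_hat G s t pos h =
     bounded_regions G pos h \<union> {outer_below G s t pos h, outer_above G s t pos h}"

definition lower_region ::
  "('v, 'e) pre_digraph \<Rightarrow> 'v \<Rightarrow> 'v \<Rightarrow> ('v \<Rightarrow> real \<times> real) \<Rightarrow> ('e \<Rightarrow> real \<Rightarrow> real) \<Rightarrow> 'e \<Rightarrow>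
    (real \<times> real) set" where
  "lower_region G s t pos h e = (THE p. p \<in> regions_hat G s t pos h \<and> directly_below G pos h p e)"

definition upper_region ::
  "('v, 'e) pre_digraph \<Rightarrow> 'v \<Rightarrow> 'v \<Rightarrow> ('v \<Rightarrow> real \<times> real) \<Rightarrow> ('e \<Rightarrow> real \<Rightarrow> real) \<Rightarrow> 'e \<Rightarrow>
    (real \<times> real) set" where
  "upper_region G s t pos h e = (THE p. p \<in> regions_hat G s t pos h \<and> directly_above G pos h p e)"

definition extend_hat ::
  "('v, 'e) pre_digraph \<Rightarrow> 'v \<Rightarrow> 'v \<Rightarrow> ('v \<Rightarrow> real \<times> real) \<Rightarrow> ('e \<Rightarrow> real \<Rightarrow> real) \<Rightarrow>
    ((real \<times> real) set \<Rightarrow> real) \<Rightarrow> (real \<times> real) set \<Rightarrow> real" where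
  "extend_hat G s t pos h f p =
     (if p = outer_below G s t pos h then 0 else if p = outer_above G s t pos h then 1 else f p)"

text \<open>The integral equivalence \<open>\<phi>\<close> from the order polytope of \<open>P\<^sub>G\<close> to the flow polytope of \<open>G\<close>.\<close>

definition order_to_flow ::
  "('v, 'e::finite) pre_digraph \<Rightarrow> 'v \<Rightarrow> 'v \<Rightarrow> ('v \<Rightarrow> real \<times> real) \<Rightarrow> ('e \<Rightarrow> real \<Rightarrow> real) \<Rightarrow>
    ((real \<times> real) set \<Rightarrow> real) \<Rightarrow> real ^ 'e" where
  "order_to_flow G s t pos h f =
     (\<chi> e. extend_hat G s t pos h f (upper_region G s t pos h e)
         - extend_hat G s t pos h f (lower_region G s t pos h e))"


section \<open>The equatorial triangulation of an order polytope\<close>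

text \<open>A finite poset is given by its carrier \<open>P\<close> and its (reflexive) order relation
  \<open>le \<subseteq> P \<times> P\<close>. Then all members of \<open>Chains le\<close> are subsets of \<open>P\<close>.\<close>

definition upper_ideal :: "'a set \<Rightarrow> 'a rel \<Rightarrow> 'a set \<Rightarrow> bool" where
  "upper_ideal P le F \<longleftrightarrow> F \<subseteq> P \<and> (\<forall>p \<in> F. \<forall>q \<in> P. (p, q) \<in> le \<longrightarrow> q \<in> F)"

definition covered_by :: "'a rel \<Rightarrow> 'a \<Rightarrow> 'a \<Rightarrow> bool" where
  "covered_by le p q \<longleftrightarrow> (p, q) \<in> le \<and> p \<noteq> q \<and>
     (\<forall>z. (p, z) \<in> le \<and> (z, q) \<in> le \<longrightarrow> z = p \<or> z = q)"

text \<open>In a graded poset the chains ending in \<open>p\<close> and maximal with this property all have the same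
  size, which is the rank of \<open>p\<close>; minimal elements have rank 1. The definitions below are meant
  for graded posets.\<close>

definition elem_rank :: "'a rel \<Rightarrow> 'a \<Rightarrow> nat" where
  "elem_rank le p = Max (card ` {C \<in> Chains le. \<forall>q \<in> C. (q, p) \<in> le})"

definition poset_rank :: "'a rel \<Rightarrow> nat" where
  "poset_rank le = Max (card ` Chains le)"

definition rank_const_ideal :: "'a set \<Rightarrow> 'a rel \<Rightarrow> nat \<Rightarrow> 'a set" where
  "rank_const_ideal P le j = {p \<in> P. elem_rank le p > j}"

text \<open>If \<open>P\<close> is empty, the condition on the minimum is void. Then the order polytope is a point, and
  the empty chain is equatorial, as it is for nonempty \<open>P\<close>.\<close>

definition equatorial_map :: "'a set \<Rightarrow> 'a rel \<Rightarrow> ('a \<Rightarrow> real) \<Rightarrow> bool" where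
  "equatorial_map P le f \<longleftrightarrow>
     (\<forall>p \<in> P. f p \<ge> 0) \<and> (\<forall>(p, q) \<in> le. f p \<le> f q) \<and>
     (P \<noteq> {} \<longrightarrow> Min (f ` P) = 0) \<and>
     (\<forall>j \<in> {2..poset_rank le}. \<exists>p \<in> P. \<exists>q \<in> P. covered_by le p q \<and>
        elem_rank le p = j - 1 \<and> elem_rank le q = j \<and> f p = f q)"

text \<open>The simplicial complex of equatorial chains of nonempty upper order ideals.\<close>

definition equatorial_complex :: "'a set \<Rightarrow> 'a rel \<Rightarrow> 'a set set set" where
  "equatorial_complex P le = {C. (\<forall>F \<in> C. upper_ideal P le F \<and> F \<noteq> {}) \<and> chain\<^sub>\<subseteq> C \<and>
     equatorial_map P le (\<lambda>p. \<Sum>F \<in> C. indicator F p)}"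

definition equatorial_triangulation :: "'a set \<Rightarrow> 'a rel \<Rightarrow> ('a \<Rightarrow> real) set set" where
  "equatorial_triangulation P le =
     {convex hull ((\<lambda>F. indicator F) ` (A \<union> C)) | A C.
        A \<subseteq> rank_const_ideal P le ` {0..poset_rank le} \<and> C \<in> equatorial_complex P le}"


section \<open>Framings and equatorial flow triangulations\<close>

text \<open>A framing is given by two families \<open>fi\<close>, \<open>fo\<close> of reflexive linear orders on the incoming and
  on the outgoing edges at each inner vertex. Paths are lists of edges.\<close>

definition less_Out :: "('v, 'e) pre_digraph \<Rightarrow> ('v \<Rightarrow> 'e rel) \<Rightarrow> 'e list \<Rightarrow> 'e list \<Rightarrow> bool" where
  "less_Out G fo p q \<longleftrightarrow> (\<exists>c e e' p' q'. p = c @ e # p' \<and> q = c @ e' # q' \<and>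
     e \<noteq> e' \<and> (e, e') \<in> fo (tail G e))"

definition less_In :: "('v, 'e) pre_digraph \<Rightarrow> ('v \<Rightarrow> 'e rel) \<Rightarrow> 'e list \<Rightarrow> 'e list \<Rightarrow> bool" where
  "less_In G fi p q \<longleftrightarrow> (\<exists>c e e' p' q'. p = p' @ e # c \<and> q = q' @ e' # c \<and>
     e \<noteq> e' \<and> (e, e') \<in> fi (head G e))"

definition conflict_at ::
  "('v, 'e) pre_digraph \<Rightarrow> 'v \<Rightarrow> 'v \<Rightarrow> ('v \<Rightarrow> 'e rel) \<Rightarrow> ('v \<Rightarrow> 'e rel) \<Rightarrow>
    'e list \<Rightarrow> 'e list \<Rightarrow> 'v \<Rightarrow> bool" where
  "conflict_at G s t fi fo P Q v \<longleftrightarrow> (\<exists>Pv vP Qv vQ. P = Pv @ vP \<and> Q = Qv @ vQ \<and>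
     pre_digraph.awalk G s Pv v \<and> pre_digraph.awalk G v vP t \<and>
     pre_digraph.awalk G s Qv v \<and> pre_digraph.awalk G v vQ t \<and>
     (less_In G fi Pv Qv \<and> less_Out G fo vQ vP \<or> less_In G fi Qv Pv \<and> less_Out G fo vP vQ))"

definition coherent ::
  "('v, 'e) pre_digraph \<Rightarrow> 'v \<Rightarrow> 'v \<Rightarrow> ('v \<Rightarrow> 'e rel) \<Rightarrow> ('v \<Rightarrow> 'e rel) \<Rightarrow>
    'e list \<Rightarrow> 'e list \<Rightarrow> bool" where
  "coherent G s t fi fo P Q \<longleftrightarrow> (\<forall>v \<in> inner_verts G s t. \<not> conflict_at G s t fi fo P Q v)"

definition clique ::
  "('v, 'e) pre_digraph \<Rightarrow> 'v \<Rightarrow> 'v \<Rightarrow> ('v \<Rightarrow> 'e rel) \<Rightarrow> ('v \<Rightarrow> 'e rel) \<Rightarrow> 'e list set \<Rightarrow> bool" where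
  "clique G s t fi fo C \<longleftrightarrow>
     (\<forall>R \<in> C. route G s t R) \<and> (\<forall>P \<in> C. \<forall>Q \<in> C. coherent G s t fi fo P Q)"

definition dkk_triangulation ::
  "('v, 'e::finite) pre_digraph \<Rightarrow> 'v \<Rightarrow> 'v \<Rightarrow> ('v \<Rightarrow> 'e rel) \<Rightarrow> ('v \<Rightarrow> 'e rel) \<Rightarrow>
    (real ^ 'e) set set" where
  "dkk_triangulation G s t fi fo = {convex hull (route_vec ` C) | C. clique G s t fi fo C}"

definition route_decomposition ::
  "('v, 'e) pre_digraph \<Rightarrow> 'v \<Rightarrow> 'v \<Rightarrow> 'e list set \<Rightarrow> bool" where
  "route_decomposition G s t \<R> \<longleftrightarrow> (\<forall>R \<in> \<R>. route G s t R) \<and> partition_on (arcs G) (set ` \<R>)"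

text \<open>The order that an ordered route decomposition induces on a set \<open>A\<close> of edges
  (to be used when each edge in \<open>A\<close> lies on a different route).\<close>

definition induced_order :: "'e list set \<Rightarrow> 'e list rel \<Rightarrow> 'e set \<Rightarrow> 'e rel" where
  "induced_order \<R> ord A = {(e, e'). e \<in> A \<and> e' \<in> A \<and>
     (\<exists>R \<in> \<R>. \<exists>R' \<in> \<R>. e \<in> set R \<and> e' \<in> set R' \<and> (R, R') \<in> ord)}"

definition decomposition_triangulation ::
  "('v, 'e::finite) pre_digraph \<Rightarrow> 'v \<Rightarrow> 'v \<Rightarrow> 'e list set \<Rightarrow> 'e list rel \<Rightarrow> (real ^ 'e) set set" where
  "decomposition_triangulation G s t \<R> ord = dkk_triangulation G s t
     (\<lambda>v. induced_order \<R> ord (in_arcs G v)) (\<lambda>v. induced_order \<R> ord (out_arcs G v))"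

text \<open>The polyhedral complex \<open>\<Gamma>\<close>. It contains the empty face even in the absence of generators,
  which happens when the flow polytope is a point.\<close>

definition equatorial_boundary ::
  "('v, 'e::finite) pre_digraph \<Rightarrow> 'v \<Rightarrow> 'v \<Rightarrow> 'e list set \<Rightarrow> (real ^ 'e) set set" where
  "equatorial_boundary G s t \<R> = insert {} {K. \<exists>F.
     (\<forall>R \<in> \<R>. F R facet_of flow_polytope G s t \<and> route_vec R \<notin> F R) \<and>
     K face_of (\<Inter>R \<in> \<R>. F R)}"

definition T_eq ::
  "('v, 'e::finite) pre_digraph \<Rightarrow> 'v \<Rightarrow> 'v \<Rightarrow> 'e list set \<Rightarrow> 'e list rel \<Rightarrow> (real ^ 'e) set set" where
  "T_eq G s t \<R> ord =
     {S \<in> decomposition_triangulation G s t \<R> ord. \<exists>K \<in> equatorial_boundary G s t \<R>. S \<subseteq> K}"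

definition route_simplex :: "'e::finite list set \<Rightarrow> (real ^ 'e) set" where
  "route_simplex \<R> = convex hull (route_vec ` \<R>)"

definition equatorial_flow_triangulation ::
  "('v, 'e::finite) pre_digraph \<Rightarrow> 'v \<Rightarrow> 'v \<Rightarrow> 'e list set \<Rightarrow> 'e list rel \<Rightarrow> (real ^ 'e) set set" where
  "equatorial_flow_triangulation G s t \<R> ord =
     {S. \<exists>F \<in> T_eq G s t \<R> ord. S face_of (convex hull (F \<union> route_simplex \<R>))}"

end

theory Submission
  imports Defs
begin

text \<open>
  Gorensteinness forces degree equality: for each edge \<open>e\<close> a sum of routes, only one of which uses
  \<open>e\<close>, is a positive integer flow with value \<open>1\<close> on \<open>e\<close>, so the translation vector of the cone can only
  be the all-ones flow. That flow is a sum of routes; counting the routes below a region gives a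
  level function on the regions which rises by \<open>1\<close> across every edge. It is the rank function of the
  dual poset. Upper ideals correspond to routes (the ideal of the regions above the route), because the jumps
  of a function on the regions form a flow. The ideals \<open>{level \<ge> j}\<close> thus give routes \<open>R\<^sub>j\<close> that consist of the
  edges leading up to level \<open>j\<close>; these are the route decomposition, ordered by \<open>j\<close>.
  The induced framing lists the edges at a vertex from bottom to top, so that two routes are
  coherent iff they do not cross, iff their ideals are nested. Finally, both equatoriality of a
  chain of ideals and membership in \<open>\<Gamma>\<close> of a clique of routes say that every \<open>R\<^sub>j\<close> contains an edge that
  all routes of the clique avoid. Such a clique together with the \<open>R\<^sub>j\<close> is linearly independent,
  so that the faces of the join are spanned by subsets.
\<close>

section \<open>Preliminaries\<close>

text \<open>A region is merely a component of the complement of a drawing whose edges are arbitrary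
  graphs of functions, so its position has to be extracted without any description of its boundary.
  The tool is the height function of a route: it is continuous and its graph lies in the drawing, so
  every region lies entirely above or entirely below it. The set between two routes then isolates
  bounded regions, and crossing an edge upwards changes the side of a route exactly if the route
  uses that edge. Only near a vertex is the local order of the edges needed: neighbouring edges
  share a region, so the jumps over all edges on one side of the vertex telescope. On the flow side,
  the facets that generate \<Gamma> are arbitrary; they are not classified but only compared with a
  route that they miss. That the vertices in a join are independent is not taken from general
  properties of DKK triangulations; it is read off from the chain of ideals.\<close>

lemma connected_strip:
  fixes a b :: "real \<Rightarrow> real"
  assumes "connected A" "continuous_on A a" "continuous_on A b"
  shows "connected ((\<lambda>(x, \<tau>). (x, a x + \<tau> * b x)) ` (A \<times> {0<..<d}))"
proof (rule connected_continuous_image)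
  show "continuous_on (A \<times> {0<..<d}) (\<lambda>(x, \<tau>). (x, a x + \<tau> * b x))"
    unfolding case_prod_beta
    by (intro continuous_intros continuous_on_compose2[OF assms(2)] continuous_on_compose2[OF assms(3)]) auto
  show "connected (A \<times> {0<..<d})" using assms(1) by (intro connected_Times) auto
qed

lemma connected_vertical:
  fixes x y r :: real
  assumes "connected T"
  shows "connected ((\<lambda>\<tau>. (x, y + r * \<tau>)) ` T)"
  by (intro connected_continuous_image continuous_intros assms)

lemma dist_pair_le: "dist (x, y) (x', y' :: real) \<le> \<bar>x - x'\<bar> + \<bar>y - y'\<bar>" for x :: real
  unfolding dist_Pair_Pair dist_real_def by (metis sqrt_sum_squares_le_sum_abs abs_idempotent)

text \<open>The elements are added in increasing order of \<open>\<kappa>\<close>: a new element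
  directly follows the previous maximum \<open>M\<close>, so \<open>u M\<close> cancels against
  \<open>l x\<close>. It is applied to the edges on one side of a vertex, with \<open>u\<close> and
  \<open>l\<close> the values of a function on the regions above and below an edge.\<close>

lemma telescoping_sum_consecutive:
  fixes u l :: "'a \<Rightarrow> 'b::ab_group_add" and \<kappa> :: "'a \<Rightarrow> 'c::linorder"
  assumes "finite A" "A \<noteq> {}" "inj_on \<kappa> A"
    and "\<And>e d. e \<in> A \<Longrightarrow> d \<in> A \<Longrightarrow> \<kappa> e < \<kappa> d \<Longrightarrow> (\<And>c. c \<in> A \<Longrightarrow> \<not> (\<kappa> e < \<kappa> c \<and> \<kappa> c < \<kappa> d)) \<Longrightarrow> u e = l d"
  shows "\<exists>m\<in>A. \<exists>M\<in>A. (\<forall>c\<in>A. \<kappa> m \<le> \<kappa> c \<and> \<kappa> c \<le> \<kappa> M) \<and> (\<Sum>e\<in>A. u e - l e) = u M - l m"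
  using assms
proof (induction A rule: finite_ranking_induct[where f = \<kappa>])
  case (insert x S)
  show ?case
  \<comment> \<open>The induction rule does not ensure that the inserted element is new.\<close>
  proof (cases "S = {} \<or> x \<in> S")
    case True
    then show ?thesis
    proof
      assume "x \<in> S"
      then have eq: "insert x S = S" by blast
      show ?thesis unfolding eq by (rule insert.IH[OF insert.prems[unfolded eq]])
    qed auto
  next
    case False
    have "u e = l d" if ed: "e \<in> S" "d \<in> S" "\<kappa> e < \<kappa> d" "\<And>c. c \<in> S \<Longrightarrow> \<not> (\<kappa> e < \<kappa> c \<and> \<kappa> c < \<kappa> d)" for e d
    proof (rule insert.prems(3))
      show "\<not> (\<kappa> e < \<kappa> c \<and> \<kappa> c < \<kappa> d)" if "c \<in> insert x S" for c
        using that ed insert.hyps(2)[OF ed(2)] by auto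
    qed (use ed in auto)
    moreover have "inj_on \<kappa> S" using insert.prems(2) by simp
    ultimately have "\<exists>m\<in>S. \<exists>M\<in>S. (\<forall>c\<in>S. \<kappa> m \<le> \<kappa> c \<and> \<kappa> c \<le> \<kappa> M) \<and> (\<Sum>e\<in>S. u e - l e) = u M - l m"
      using False by (intro insert.IH) auto
    then obtain m M where mM: "m \<in> S" "M \<in> S" "\<forall>c\<in>S. \<kappa> m \<le> \<kappa> c \<and> \<kappa> c \<le> \<kappa> M"
      "(\<Sum>e\<in>S. u e - l e) = u M - l m"
      by blast
    have x: "\<kappa> c < \<kappa> x" if "c \<in> S" for c
      using insert.hyps(2)[OF that] insert.prems(2) False that by (metis inj_on_eq_iff insertCI order_le_less)
    have "u M = l x"
    proof (rule insert.prems(3))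
      show "\<not> (\<kappa> M < \<kappa> c \<and> \<kappa> c < \<kappa> x)" if "c \<in> insert x S" for c
        using that mM by (metis insertE leD less_irrefl)
    qed (use mM x in auto)
    then have "(\<Sum>e\<in>insert x S. u e - l e) = u x - l m"
      using insert.hyps(1) False mM(4) by simp
    moreover have "\<forall>c\<in>insert x S. \<kappa> m \<le> \<kappa> c \<and> \<kappa> c \<le> \<kappa> x"
      using mM(1,3) x by (metis insertE less_imp_le order_refl)
    ultimately show ?thesis using mM(1) by blast
  qed
qed simp

text \<open>\<open>b\<close> is the infimum of the points with a negative value. Continuity excludes
  both signs at \<open>b\<close>, and the last conclusion records that negative values accumulate at
  \<open>b\<close> from the right.\<close>

lemma first_negative:
  fixes f :: "real \<Rightarrow> real"
  assumes cont: "continuous_on {p..q} f" and p: "0 \<le> f p" and x: "p \<le> x" "x \<le> q" "f x < 0"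
  obtains b where "p \<le> b" "b < q" "f b = 0" "\<And>y. p \<le> y \<Longrightarrow> y \<le> b \<Longrightarrow> 0 \<le> f y"
    "\<And>\<delta>. 0 < \<delta> \<Longrightarrow> \<exists>y. b < y \<and> y < b + \<delta> \<and> y \<le> q \<and> f y < 0"
proof -
  define N where "N = {y \<in> {p..q}. f y < 0}"
  define b where "b = Inf N"
  have N: "x \<in> N" "bdd_below N" using x by (auto simp: N_def)
  then have N': "N \<noteq> {}" by blast
  have b: "p \<le> b" "b \<le> q"
    using cInf_greatest[OF N', of p] cInf_lower[OF N] x by (auto simp: b_def N_def)
  have nonneg: "0 \<le> f y" if "p \<le> y" "y < b" for y
  proof (rule ccontr)
    assume "\<not> 0 \<le> f y"
    then have "y \<in> N" using that b by (auto simp: N_def)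
    then show False using cInf_lower[OF _ N(2), of y] that by (simp add: b_def)
  qed
  have close: "\<exists>y\<in>N. b \<le> y \<and> y < b + \<delta>" if "0 < \<delta>" for \<delta>
    using cInf_less_iff[OF N' N(2), of "b + \<delta>"] that cInf_lower[OF _ N(2)] by (auto simp: b_def)
  have "f b \<ge> 0"
  proof (rule ccontr)
    assume neg: "\<not> f b \<ge> 0"
    then obtain d where d: "d > 0" "\<And>y. y \<in> {p..q} \<Longrightarrow> \<bar>y - b\<bar> < d \<Longrightarrow> \<bar>f y - f b\<bar> < - f b"
      using cont[unfolded continuous_on_iff, rule_format, of b "- f b"] b by (auto simp: dist_real_def)
    have "b > p" using neg p b by (cases "b = p") auto
    define y where "y = max p (b - d / 2)"
    have y: "p \<le> y" "y < b" "\<bar>y - b\<bar> < d" using d(1) \<open>b > p\<close> by (auto simp: y_def)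
    then have "f y < 0" using d(2)[of y] b by (auto simp: abs_less_iff)
    then show False using nonneg[of y] y by simp
  qed
  moreover have "f b \<le> 0"
  proof (rule ccontr)
    assume "\<not> f b \<le> 0"
    then obtain d where d: "d > 0" "\<And>y. y \<in> {p..q} \<Longrightarrow> \<bar>y - b\<bar> < d \<Longrightarrow> \<bar>f y - f b\<bar> < f b"
      using cont[unfolded continuous_on_iff, rule_format, of b "f b"] b by (auto simp: dist_real_def)
    obtain y where y: "y \<in> N" "b \<le> y" "y < b + d" using close[OF d(1)] by blast
    then show False using d(2)[of y] by (auto simp: N_def)
  qed
  ultimately have fb: "f b = 0" by simp
  show thesis
  proof (rule that)
    show "f b = 0" "p \<le> b" by fact+
    show "0 \<le> f y" if "p \<le> y" "y \<le> b" for y using nonneg[of y] fb that by (cases "y = b") auto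
    show *: "\<exists>y. b < y \<and> y < b + \<delta> \<and> y \<le> q \<and> f y < 0" if \<delta>: "0 < \<delta>" for \<delta>
    proof -
      obtain y where y: "y \<in> N" "b \<le> y" "y < b + \<delta>" using close[OF \<delta>] by blast
      then have "y \<noteq> b" using fb by (auto simp: N_def)
      then show ?thesis using y by (intro exI[of _ y]) (auto simp: N_def)
    qed
    obtain y where "b < y" "y \<le> q" using *[of 1] by auto
    then show "b < q" by simp
  qed
qed

text \<open>Two crossing routes may share a path, so the change of sign is located as an interval of
  zeros rather than as a point.\<close>

lemma sign_change_interval:
  fixes f :: "real \<Rightarrow> real"
  assumes cont: "continuous_on {p..q} f" and "p \<le> q" "0 < f p" "f q < 0"
  obtains a b where "p < a" "a \<le> b" "b < q" "\<And>y. a \<le> y \<Longrightarrow> y \<le> b \<Longrightarrow> f y = 0"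
    "\<And>\<delta>. 0 < \<delta> \<Longrightarrow> \<exists>y. a - \<delta> < y \<and> y < a \<and> p \<le> y \<and> 0 < f y"
    "\<And>\<delta>. 0 < \<delta> \<Longrightarrow> \<exists>y. b < y \<and> y < b + \<delta> \<and> y \<le> q \<and> f y < 0"
proof -
  obtain b where b: "p \<le> b" "b < q" "f b = 0" "\<And>y. p \<le> y \<Longrightarrow> y \<le> b \<Longrightarrow> 0 \<le> f y"
    "\<And>\<delta>. 0 < \<delta> \<Longrightarrow> \<exists>y. b < y \<and> y < b + \<delta> \<and> y \<le> q \<and> f y < 0"
    by (rule first_negative[OF cont less_imp_le[OF assms(3)] assms(2) order_refl assms(4)], rule that)
  \<comment> \<open>\<open>b\<close> is the right end of the interval. Its left end comes from the
    same lemma after reversing the axis and the sign, starting at \<open>b\<close> and running back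
    to \<open>p\<close>.\<close>
  define g where "g y = - f (- y)" for y
  have "continuous_on {- b..- p} g"
    unfolding g_def
    by (intro continuous_on_minus continuous_on_compose2[OF cont]) (use b in \<open>auto intro: continuous_on_minus continuous_on_id\<close>)
  moreover have "0 \<le> g (- b)" "- b \<le> - p" "g (- p) < 0" using b assms by (auto simp: g_def)
  ultimately obtain a where a: "- b \<le> a" "a < - p" "g a = 0" "\<And>y. - b \<le> y \<Longrightarrow> y \<le> a \<Longrightarrow> 0 \<le> g y"
    "\<And>\<delta>. 0 < \<delta> \<Longrightarrow> \<exists>y. a < y \<and> y < a + \<delta> \<and> y \<le> - p \<and> g y < 0"
    using first_negative[of "- b" "- p" g "- p"] by (metis order_refl)
  show thesis
  proof (rule that)
    show "p < - a" "- a \<le> b" "b < q" using a b by auto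
    show "f y = 0" if "- a \<le> y" "y \<le> b" for y
      using a(4)[of "- y"] b(4)[of y] that a(2) by (simp add: g_def)
    show "\<exists>y. - a - \<delta> < y \<and> y < - a \<and> p \<le> y \<and> 0 < f y" if \<delta>: "0 < \<delta>" for \<delta>
    proof -
      obtain y where y: "a < y" "y < a + \<delta>" "y \<le> - p" "g y < 0" using a(5)[OF \<delta>] by blast
      then show ?thesis by (intro exI[of _ "- y"]) (simp add: g_def)
    qed
    show "\<exists>y. b < y \<and> y < b + \<delta> \<and> y \<le> q \<and> f y < 0" if "0 < \<delta>" for \<delta> by (rule b(5)[OF that])
  qed
qed

lemma chain_subset_mono: "chain\<^sub>\<subseteq> A \<Longrightarrow> B \<subseteq> A \<Longrightarrow> chain\<^sub>\<subseteq> B"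
  unfolding chain_subset_def by (meson subsetD)

lemma finite_chain_least:
  assumes "finite C" "C \<noteq> {}" "chain\<^sub>\<subseteq> C"
  obtains m where "m \<in> C" "\<And>b. b \<in> C \<Longrightarrow> m \<subseteq> b"
proof -
  obtain m where m: "m \<in> C" "\<forall>b\<in>C. b \<subseteq> m \<longrightarrow> m = b" using finite_has_minimal[OF assms(1,2)] by blast
  then have "m \<subseteq> b" if "b \<in> C" for b using assms(3) that unfolding chain_subset_def by blast
  then show thesis using that m(1) by blast
qed

lemma finite_chain_greatest:
  assumes "finite C" "C \<noteq> {}" "chain\<^sub>\<subseteq> C"
  obtains m where "m \<in> C" "\<And>b. b \<in> C \<Longrightarrow> b \<subseteq> m"
proof -
  obtain m where m: "m \<in> C" "\<forall>b\<in>C. m \<subseteq> b \<longrightarrow> m = b" using finite_has_maximal[OF assms(1,2)] by blast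
  then have "b \<subseteq> m" if "b \<in> C" for b using assms(3) that unfolding chain_subset_def by blast
  then show thesis using that m(1) by blast
qed


section \<open>Routes and the flow polytope\<close>

text \<open>\<open>xc\<close> is any coordinate of the vertices that increases along the edges;
  later it is the x-coordinate of the realization. It orders the vertices for induction and forbids
  repeated edges on a walk.\<close>

locale flow_graph = fin_digraph G
  for G :: "('v, 'e::finite) pre_digraph" +
  fixes s t :: 'v and xc :: "'v \<Rightarrow> real"
  assumes arcs_UNIV: "arcs G = UNIV"
    and sources: "{v \<in> verts G. in_arcs G v = {}} = {s}"
    and sinks: "{v \<in> verts G. out_arcs G v = {}} = {t}"
    and no_idle: "\<not> idle G s t e"
    and xc_less: "xc (tail G e) < xc (head G e)"
begin

lemma arc_in_arcs [simp]: "e \<in> arcs G"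
  by (simp add: arcs_UNIV)

lemma s_in_verts [simp]: "s \<in> verts G" and t_in_verts [simp]: "t \<in> verts G"
  using sources sinks by blast+

lemma in_arcs_s [simp]: "in_arcs G s = {}" and out_arcs_t [simp]: "out_arcs G t = {}"
  using sources sinks by blast+

lemma head_neq_s [simp]: "head G e \<noteq> s" and tail_neq_t [simp]: "tail G e \<noteq> t"
  using in_arcs_s out_arcs_t by (auto simp: in_arcs_def out_arcs_def)

lemma verts_induct_up [consumes 1, case_names less]:
  assumes "v \<in> verts G"
    and "\<And>v. v \<in> verts G \<Longrightarrow> (\<And>w. w \<in> verts G \<Longrightarrow> xc w < xc v \<Longrightarrow> P w) \<Longrightarrow> P v"
  shows "P v"
  using assms(1)
proof (induction "card {w \<in> verts G. xc w < xc v}" arbitrary: v rule: less_induct)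
  case less
  show ?case
  proof (rule assms(2)[OF less.prems])
    fix w assume w: "w \<in> verts G" "xc w < xc v"
    have "card {u \<in> verts G. xc u < xc w} < card {u \<in> verts G. xc u < xc v}"
      by (rule psubset_card_mono) (use w in auto)
    then show "P w" using less.hyps w by blast
  qed
qed

lemma verts_induct_down [consumes 1, case_names less]:
  assumes "v \<in> verts G"
    and "\<And>v. v \<in> verts G \<Longrightarrow> (\<And>w. w \<in> verts G \<Longrightarrow> xc w > xc v \<Longrightarrow> P w) \<Longrightarrow> P v"
  shows "P v"
  using assms(1)
proof (induction "card {w \<in> verts G. xc w > xc v}" arbitrary: v rule: less_induct)
  case less
  show ?case
  proof (rule assms(2)[OF less.prems])
    fix w assume w: "w \<in> verts G" "xc w > xc v"
    have "card {u \<in> verts G. xc u > xc w} < card {u \<in> verts G. xc u > xc v}"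
      by (rule psubset_card_mono) (use w in auto)
    then show "P w" using less.hyps w by blast
  qed
qed

lemma awalk_xc_le: "awalk u p w \<Longrightarrow> xc u \<le> xc w"
proof (induction p arbitrary: u)
  case (Cons e p)
  then have "xc (head G e) \<le> xc w" "u = tail G e" by (auto simp: awalk_Cons_iff)
  then show ?case using xc_less[of e] by simp
qed (simp add: awalk_Nil_iff)

lemma awalk_xc_less: "awalk u p w \<Longrightarrow> p \<noteq> [] \<Longrightarrow> xc u < xc w"
  using awalk_xc_le less_le_trans[OF xc_less] by (cases p) (auto simp: awalk_Cons_iff)

lemma awalk_xc_tail: "awalk u p w \<Longrightarrow> e \<in> set p \<Longrightarrow> xc u \<le> xc (tail G e)"
proof (induction p arbitrary: u)
  case (Cons d p)
  then have w: "awalk (head G d) p w" and u: "u = tail G d" by (auto simp: awalk_Cons_iff)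
  show ?case
  proof (cases "e = d")
    case False
    then have "xc (head G d) \<le> xc (tail G e)" using Cons.IH[OF w] Cons.prems(2) by simp
    then show ?thesis using xc_less[of d] u by simp
  qed (simp add: u)
qed simp

lemma awalk_xc_head: "awalk u p w \<Longrightarrow> e \<in> set p \<Longrightarrow> xc (head G e) \<le> xc w"
proof (induction p arbitrary: u)
  case (Cons d p)
  then have "awalk (head G d) p w" by (auto simp: awalk_Cons_iff)
  then show ?case using Cons awalk_xc_le by auto
qed simp

lemma awalk_appendE:
  assumes "awalk u (p @ q) w"
  obtains v where "awalk u p v" "awalk v q w"
  using assms by (auto simp: awalk_append_iff)

lemma awalk_splitE:
  assumes "awalk u p w" "e \<in> set p"
  obtains p1 p2 where "p = p1 @ e # p2" "awalk u p1 (tail G e)" "awalk (head G e) p2 w"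
  using assms by (metis awalk_Cons_iff awalk_appendE split_list)

lemma awalk_sole_out_arc: "awalk u (e # p) w \<Longrightarrow> d \<in> set p \<Longrightarrow> tail G d \<noteq> u"
  using awalk_xc_tail[of "head G e" p w d] xc_less[of e] by (auto simp: awalk_Cons_iff)

text \<open>Edges after the first have their tails strictly further along \<open>xc\<close>, so the
  first edge can be recognised as the only one in the set that leaves \<open>u\<close>. Routes may
  thus be identified with their supports.\<close>

lemma awalk_set_inj: "awalk u p w \<Longrightarrow> awalk u q w \<Longrightarrow> set p = set q \<Longrightarrow> p = q"
proof (induction p arbitrary: u q)
  case (Cons e p)
  then obtain d q' where q: "q = d # q'" by (cases q) auto
  have tl: "tail G e = u" "tail G d = u" using Cons.prems q by (auto simp: awalk_Cons_iff)
  have e: "e \<notin> set p" and d: "d \<notin> set q'"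
    using Cons.prems q awalk_sole_out_arc tl by blast+
  have "d = e"
    using awalk_sole_out_arc[OF Cons.prems(1), of d] Cons.prems(3) q tl by auto
  moreover have "set p = set q'" using Cons.prems(3) e d q \<open>d = e\<close> by auto
  ultimately show ?case using Cons.IH[of "head G e" q'] Cons.prems q by (auto simp: awalk_Cons_iff)
qed simp

lemma finite_routes: "finite {R. route G s t R}"
proof (rule inj_on_finite[of set _ UNIV])
  show "inj_on set {R. route G s t R}"
    by (auto simp: inj_on_def route_def intro: awalk_set_inj)
qed auto

lemma in_arcs_nonempty: "v \<in> verts G \<Longrightarrow> v \<noteq> s \<Longrightarrow> in_arcs G v \<noteq> {}"
  and out_arcs_nonempty: "v \<in> verts G \<Longrightarrow> v \<noteq> t \<Longrightarrow> out_arcs G v \<noteq> {}"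
  using sources sinks by blast+

section \<open>Routes that avoid a given edge\<close>

lemma another_in_arc:
  assumes "v \<in> verts G" "v \<noteq> s" "v \<noteq> t"
  obtains e where "head G e = v" "e \<noteq> a"
proof -
  have "in_arcs G v \<noteq> {a}" "in_arcs G v \<noteq> {}"
    using no_idle[of a] assms in_arcs_nonempty by (auto simp: idle_def inner_verts_def)
  then obtain e where "e \<in> in_arcs G v" "e \<noteq> a" by blast
  then show thesis using that by (auto simp: in_arcs_def)
qed

lemma another_out_arc:
  assumes "v \<in> verts G" "v \<noteq> s" "v \<noteq> t"
  obtains e where "tail G e = v" "e \<noteq> a"
proof -
  have "out_arcs G v \<noteq> {a}" "out_arcs G v \<noteq> {}"
    using no_idle[of a] assms out_arcs_nonempty by (auto simp: idle_def inner_verts_def)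
  then obtain e where "e \<in> out_arcs G v" "e \<noteq> a" by blast
  then show thesis using that by (auto simp: out_arcs_def)
qed

text \<open>At every inner vertex some incoming edge differs from \<open>a\<close>, because
  \<open>a\<close> is not idle, and the walk is extended backwards along it. The sink is excluded
  since \<open>a\<close> may be the only edge entering it.\<close>

lemma awalk_from_s_avoiding: "v \<in> verts G \<Longrightarrow> v \<noteq> t \<Longrightarrow> \<exists>p. awalk s p v \<and> a \<notin> set p"
proof (induction v rule: verts_induct_up)
  case (less v)
  show ?case
  proof (cases "v = s")
    case True
    then show ?thesis by (intro exI[of _ "[]"]) (simp add: awalk_Nil_iff)
  next
    case False
    then obtain e where e: "head G e = v" "e \<noteq> a" using another_in_arc less by metis
    obtain p where "awalk s p (tail G e)" "a \<notin> set p"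
      using less.IH[of "tail G e"] xc_less[of e] e by auto
    then show ?thesis
      using e by (intro exI[of _ "p @ [e]"]) (auto intro!: awalk_appendI simp: awalk_simps)
  qed
qed

lemma awalk_to_t_avoiding: "v \<in> verts G \<Longrightarrow> v \<noteq> s \<Longrightarrow> \<exists>p. awalk v p t \<and> a \<notin> set p"
proof (induction v rule: verts_induct_down)
  case (less v)
  show ?case
  proof (cases "v = t")
    case True
    then show ?thesis by (intro exI[of _ "[]"]) (simp add: awalk_Nil_iff)
  next
    case False
    then obtain e where e: "tail G e = v" "e \<noteq> a" using another_out_arc less by metis
    obtain p where "awalk (head G e) p t" "a \<notin> set p"
      using less.IH[of "head G e"] xc_less[of e] e by auto
    then show ?thesis
      using e by (intro exI[of _ "e # p"]) (auto simp: awalk_simps)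
  qed
qed

lemma route_through_avoiding:
  assumes "e \<noteq> a"
  obtains R where "route G s t R" "e \<in> set R" "a \<notin> set R"
proof -
  obtain p where p: "awalk s p (tail G e)" "a \<notin> set p"
    using awalk_from_s_avoiding[of "tail G e" a] by auto
  obtain q where q: "awalk (head G e) q t" "a \<notin> set q"
    using awalk_to_t_avoiding[of "head G e" a] by auto
  have "awalk s (p @ e # q) t" using p q by (auto intro!: awalk_appendI simp: awalk_simps)
  then show thesis using that[of "p @ e # q"] p q assms by (auto simp: route_def)
qed

lemma route_through:
  obtains R where "route G s t R" "e \<in> set R"
proof -
  obtain p where p: "awalk s p (tail G e)"
    using awalk_from_s_avoiding[of "tail G e" e] by auto
  obtain q where q: "awalk (head G e) q t"
    using awalk_to_t_avoiding[of "head G e" e] by auto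
  have "awalk s (p @ e # q) t" using p q by (auto intro!: awalk_appendI simp: awalk_simps)
  then show thesis using that[of "p @ e # q"] by (auto simp: route_def)
qed

lemma s_neq_t: "s \<noteq> t"
proof
  assume st: "s = t"
  obtain R where R: "route G s t R" "(undefined :: 'e) \<in> set R" using route_through by blast
  then obtain e p where "R = e # p" by (cases R) auto
  then show False using R st tail_neq_t[of e] by (auto simp: route_def awalk_Cons_iff)
qed

lemma route_nonempty: "route G s t R \<Longrightarrow> R \<noteq> []"
  using s_neq_t by (auto simp: route_def awalk_Nil_iff)

text \<open>Written with sums on both sides so that it makes sense in \<open>nat\<close>, and for
  all vertices at once: the two extra indicators account for the end points. No edge is repeated on
  the walk, so each edge counts once at its tail and once at its head.\<close>

lemma awalk_degrees:
  fixes v :: 'v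
  assumes "awalk u p w"
  shows "(\<Sum>e\<in>out_arcs G v. of_bool (e \<in> set p)) + of_bool (v = w)
    = (\<Sum>e\<in>in_arcs G v. of_bool (e \<in> set p)) + (of_bool (v = u) :: nat)"
  using assms
proof (induction p arbitrary: u)
  case (Cons d p)
  have w: "awalk (head G d) p w" and u: "u = tail G d" using Cons.prems by (auto simp: awalk_Cons_iff)
  have d: "d \<notin> set p" using awalk_sole_out_arc[OF Cons.prems] u by blast
  have split: "(\<Sum>e\<in>A. of_bool (e \<in> set (d # p))) = of_bool (d \<in> A) + (\<Sum>e\<in>A. of_bool (e \<in> set p) :: nat)"
    for A :: "'e set"
  proof -
    have "(\<Sum>e\<in>A. of_bool (e \<in> set (d # p))) = (\<Sum>e\<in>A. (if e = d then 1 else 0) + of_bool (e \<in> set p) :: nat)"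
      using d by (intro sum.cong) auto
    then show ?thesis by (simp add: sum.distrib)
  qed
  show ?case unfolding split using Cons.IH[OF w] u by (auto simp: out_arcs_def in_arcs_def)
qed (auto simp: awalk_Nil_iff)

lemma route_conserved:
  assumes "route G s t R" "v \<in> inner_verts G s t"
  shows "(\<Sum>e\<in>in_arcs G v. of_bool (e \<in> set R)) = (\<Sum>e\<in>out_arcs G v. of_bool (e \<in> set R) :: nat)"
  using awalk_degrees[of s R t v] assms by (auto simp: route_def inner_verts_def)

lemma route_value:
  assumes "route G s t R"
  shows "(\<Sum>e\<in>out_arcs G s. of_bool (e \<in> set R)) = (1 :: nat)"
  using awalk_degrees[of s R t s] assms s_neq_t by (auto simp: route_def)

section \<open>Decomposition of integral flows into routes\<close>

definition conserving :: "('e \<Rightarrow> 'a::comm_monoid_add) \<Rightarrow> bool" where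
  "conserving w \<longleftrightarrow> (\<forall>v\<in>inner_verts G s t. sum w (in_arcs G v) = sum w (out_arcs G v))"

text \<open>Nothing leaves the source, and by induction along \<open>xc\<close> nothing enters,
  hence nothing leaves, any later vertex.\<close>

lemma conserving_zero:
  fixes w :: "'e \<Rightarrow> 'a::ordered_comm_monoid_add"
  assumes "conserving w" "sum w (out_arcs G s) = 0" and nonneg: "\<And>e. 0 \<le> w e"
  shows "w e = 0"
proof -
  have zero: "w d = 0" if "sum w (out_arcs G (tail G d)) = 0" for d
    using that nonneg by (subst (asm) sum_nonneg_eq_0_iff) (auto simp: out_arcs_def)
  have "sum w (out_arcs G v) = 0" if "v \<in> verts G" for v
    using that
  proof (induction v rule: verts_induct_up)
    case (less v)
    show ?case
    proof (cases "v = s \<or> v = t")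
      case False
      have "w d = 0" if "d \<in> in_arcs G v" for d
        using that zero[OF less.IH, of d] xc_less[of d] by (auto simp: in_arcs_def)
      then have "sum w (in_arcs G v) = 0" by simp
      then show ?thesis using assms(1) less.hyps False by (metis DiffI conserving_def empty_iff insert_iff inner_verts_def)
    qed (use assms in auto)
  qed
  then show ?thesis using zero[of e] by simp
qed

text \<open>An inner vertex entered by a positive edge has positive inflow, hence positive outflow,
  so a walk in the support never gets stuck before \<open>t\<close>.\<close>

lemma support_walk_to_t:
  fixes w :: "'e \<Rightarrow> nat"
  assumes "conserving w" "0 < sum w (out_arcs G s)"
    and "v \<in> verts G" "v = s \<or> (\<exists>e. head G e = v \<and> 0 < w e)"
  shows "\<exists>p. awalk v p t \<and> (\<forall>e\<in>set p. 0 < w e)"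
  using assms(3,4)
proof (induction v rule: verts_induct_down)
  case (less v)
  show ?case
  proof (cases "v = t")
    case True
    then show ?thesis by (intro exI[of _ "[]"]) (simp add: awalk_Nil_iff)
  next
    case False
    have "0 < sum w (out_arcs G v)"
    proof (cases "v = s")
      case v: False
      then obtain e where "head G e = v" "0 < w e" using less.prems by auto
      then have "0 < sum w (in_arcs G v)" by (auto simp: in_arcs_def sum_pos2)
      then show ?thesis using assms(1) less.hyps False v by (auto simp: conserving_def inner_verts_def)
    qed (use assms in auto)
    then obtain e where "e \<in> out_arcs G v" "0 < w e"
      by (metis gr0I less_numeral_extra(3) sum.neutral)
    then have e: "tail G e = v" "0 < w e" by auto
    obtain p where "awalk (head G e) p t" "\<forall>d\<in>set p. 0 < w d"
      using less.IH[of "head G e"] xc_less[of e] e by auto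
    then show ?thesis
      using e by (intro exI[of _ "e # p"]) (auto simp: awalk_simps)
  qed
qed

text \<open>Flow decomposition: a route in the support is subtracted, which lowers the value by one.
  Once the value is zero, the flow itself is zero by \<open>conserving_zero\<close>, so no
  circulation is left over.\<close>

lemma conserving_route_sum:
  fixes w :: "'e \<Rightarrow> nat"
  assumes "conserving w" "sum w (out_arcs G s) = k"
  shows "\<exists>Rs. length Rs = k \<and> (\<forall>R\<in>set Rs. route G s t R) \<and>
    (\<forall>e. w e = length (filter (\<lambda>R. e \<in> set R) Rs))"
  using assms
proof (induction k arbitrary: w)
  case 0
  then have "w e = 0" for e by (rule conserving_zero) simp
  then show ?case by (intro exI[of _ "[]"]) simp
next
  case (Suc k)
  obtain R where R: "awalk s R t" "\<forall>e\<in>set R. 0 < w e"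
    using support_walk_to_t[OF Suc.prems(1) _ s_in_verts] Suc.prems(2) by auto
  then have route: "route G s t R" by (simp add: route_def)
  define w' where "w' e = w e - of_bool (e \<in> set R)" for e
  \<comment> \<open>\<open>R\<close> runs in the support of \<open>w\<close>, so the truncated
    subtraction in \<open>w'\<close> is exact.\<close>
  have w: "w = (\<lambda>e. w' e + of_bool (e \<in> set R))" using R(2) by (fastforce simp: w'_def)
  have sum_w: "sum w A = sum w' A + (\<Sum>e\<in>A. of_bool (e \<in> set R))" for A
    by (subst w) (simp only: sum.distrib)
  have "conserving w'"
    using Suc.prems(1) route_conserved[OF route] by (simp add: conserving_def sum_w)
  moreover have "sum w' (out_arcs G s) = k"
    using Suc.prems(2) route_value[OF route] by (simp add: sum_w)
  ultimately obtain Rs where Rs: "length Rs = k" "\<forall>R\<in>set Rs. route G s t R"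
    "\<forall>e. w' e = length (filter (\<lambda>R. e \<in> set R) Rs)" using Suc.IH by blast
  have "w e = length (filter (\<lambda>R. e \<in> set R) (R # Rs))" for e
    using Rs(3) by (subst w) simp
  then show ?case using Rs route by (intro exI[of _ "R # Rs"]) simp
qed

lemma unit_flow_is_route:
  fixes w :: "'e \<Rightarrow> nat"
  assumes "conserving w" "sum w (out_arcs G s) = 1"
  obtains R where "route G s t R" "\<And>e. w e = of_bool (e \<in> set R)"
proof -
  obtain Rs where Rs: "length Rs = 1" "\<forall>R\<in>set Rs. route G s t R"
    "\<forall>e. w e = length (filter (\<lambda>R. e \<in> set R) Rs)"
    using conserving_route_sum[OF assms] by auto
  then obtain R where "Rs = [R]" by (auto simp: length_Suc_conv)
  then show thesis using that[of R] Rs by auto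
qed

subsection \<open>The flow polytope\<close>

abbreviation "F1 \<equiv> flow_polytope G s t"

lemma route_vec_nth [simp]: "route_vec R $ e = of_bool (e \<in> set R)"
  by (simp add: route_vec_def)

lemma route_vec_inj: "inj_on route_vec {R. route G s t R}"
proof (rule inj_onI)
  fix P Q assume PQ: "P \<in> {R. route G s t R}" "Q \<in> {R. route G s t R}" "route_vec P = route_vec Q"
  have "e \<in> set P \<longleftrightarrow> e \<in> set Q" for e
    using arg_cong[OF PQ(3), of "\<lambda>x. x $ e"] by (simp add: of_bool_def split: if_splits)
  then show "P = Q" using PQ awalk_set_inj[of s P t Q] by (auto simp: route_def)
qed

lemma route_conserved_real:
  assumes "route G s t R" "v \<in> inner_verts G s t"
  shows "(\<Sum>e\<in>in_arcs G v. route_vec R $ e) = (\<Sum>e\<in>out_arcs G v. route_vec R $ e)"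
  using arg_cong[OF route_conserved[OF assms], of real] by simp

lemma route_value_real:
  assumes "route G s t R"
  shows "(\<Sum>e\<in>out_arcs G s. route_vec R $ e) = 1"
  using arg_cong[OF route_value[OF assms], of real] by simp

lemma route_vec_in_F1: "route G s t R \<Longrightarrow> route_vec R \<in> F1"
  using route_conserved_real[of R] route_value_real[of R] by (auto simp: flow_polytope_def)

lemma convex_F1: "convex F1"
proof (rule convexI)
  fix x y and u v :: real
  assume *: "x \<in> F1" "y \<in> F1" "0 \<le> u" "0 \<le> v" "u + v = 1"
  then show "u *\<^sub>R x + v *\<^sub>R y \<in> F1"
    by (auto simp: flow_polytope_def sum.distrib simp flip: sum_distrib_left)
qed

definition lin_flow :: "real ^ 'e \<Rightarrow> bool" where
  "lin_flow x \<longleftrightarrow> (\<forall>v\<in>inner_verts G s t. (\<Sum>e\<in>in_arcs G v. x $ e) = (\<Sum>e\<in>out_arcs G v. x $ e))"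

definition flow_value :: "real ^ 'e \<Rightarrow> real" where
  "flow_value x = (\<Sum>e\<in>out_arcs G s. x $ e)"

lemma F1_iff: "x \<in> F1 \<longleftrightarrow> (\<forall>e. 0 \<le> x $ e) \<and> lin_flow x \<and> flow_value x = 1"
  by (simp add: flow_polytope_def lin_flow_def flow_value_def)

lemma lin_flow_add: "lin_flow x \<Longrightarrow> lin_flow y \<Longrightarrow> lin_flow (x + y)"
  and lin_flow_diff: "lin_flow x \<Longrightarrow> lin_flow y \<Longrightarrow> lin_flow (x - y)"
  and lin_flow_scale: "lin_flow x \<Longrightarrow> lin_flow (c *\<^sub>R x)"
  by (simp_all add: lin_flow_def sum.distrib sum_subtractf flip: sum_distrib_left)

lemma flow_value_add: "flow_value (x + y) = flow_value x + flow_value y"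
  and flow_value_diff: "flow_value (x - y) = flow_value x - flow_value y"
  and flow_value_scale: "flow_value (c *\<^sub>R x) = c * flow_value x"
  by (simp_all add: flow_value_def sum.distrib sum_subtractf flip: sum_distrib_left)

lemma lin_flow_sum: "finite A \<Longrightarrow> (\<And>a. a \<in> A \<Longrightarrow> lin_flow (f a)) \<Longrightarrow> lin_flow (\<Sum>a\<in>A. f a)"
  by (induction A rule: finite_induct) (auto simp: lin_flow_add, simp add: lin_flow_def)

lemma flow_value_sum: "flow_value (\<Sum>a\<in>A. f a) = (\<Sum>a\<in>A. flow_value (f a))"
  unfolding flow_value_def by (simp add: sum.swap[of _ A])

lemma route_lin_flow: "route G s t R \<Longrightarrow> lin_flow (route_vec R)"
  and route_flow_value: "route G s t R \<Longrightarrow> flow_value (route_vec R) = 1"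
  using route_vec_in_F1 F1_iff by auto

text \<open>The scaling factor is the value of the flow, so \<open>r\<close> is determined by
  \<open>x\<close>. Only \<open>r = 0\<close> cannot be rescaled; there
  \<open>conserving_zero\<close> leaves just the apex.\<close>

lemma cone_over_F1: "(x, r) \<in> cone_over F1 \<longleftrightarrow> (\<forall>e. 0 \<le> x $ e) \<and> lin_flow x \<and> flow_value x = r"
proof
  assume "(x, r) \<in> cone_over F1"
  then obtain y where "r \<ge> 0" "x = r *\<^sub>R y" "y \<in> F1" by (auto simp: cone_over_def)
  then show "(\<forall>e. 0 \<le> x $ e) \<and> lin_flow x \<and> flow_value x = r"
    by (auto simp: F1_iff lin_flow_scale flow_value_scale)
next
  assume x: "(\<forall>e. 0 \<le> x $ e) \<and> lin_flow x \<and> flow_value x = r"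
  then have r: "r \<ge> 0" by (auto simp: flow_value_def intro!: sum_nonneg)
  show "(x, r) \<in> cone_over F1"
  proof (cases "r = 0")
    case False
    have "(1 / r) *\<^sub>R x \<in> F1" using x r False by (auto simp: F1_iff lin_flow_scale flow_value_scale)
    moreover have "x = r *\<^sub>R ((1 / r) *\<^sub>R x)" using False by simp
    ultimately show ?thesis using r unfolding cone_over_def by blast
  next
    case True
    have "x $ e = 0" for e
      using conserving_zero[of "\<lambda>e. x $ e" e] x True by (simp add: lin_flow_def flow_value_def conserving_def)
    then have "x = 0" by (simp add: vec_eq_iff)
    moreover obtain R where "route G s t R" using route_through by blast
    ultimately show ?thesis
      using True route_vec_in_F1[of R] unfolding cone_over_def by force
  qed
qed

lemma convex_cone_over_F1: "convex (cone_over F1)"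
  unfolding convex_alt
  by (auto simp: cone_over_F1 lin_flow_add lin_flow_scale flow_value_add flow_value_scale)

text \<open>A point of the cone is in the relative interior iff every segment from a point of the
  cone can be prolonged beyond it. Prolonging the segment from a route through \<open>e\<close>
  forces a positive coordinate at \<open>e\<close>; conversely a positive flow leaves room in every
  direction.\<close>

lemma rel_interior_cone_over_F1:
  "(x, r) \<in> rel_interior (cone_over F1) \<longleftrightarrow> (\<forall>e. 0 < x $ e) \<and> lin_flow x \<and> flow_value x = r"
proof -
  have ne: "cone_over F1 \<noteq> {}"
    using cone_over_F1[of 0 0] by (auto simp: lin_flow_def flow_value_def)
  note iff = convex_rel_interior_iff[OF convex_cone_over_F1 ne]
  show ?thesis
  proof
    assume int: "(x, r) \<in> rel_interior (cone_over F1)"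
    then have x: "(\<forall>e. 0 \<le> x $ e) \<and> lin_flow x \<and> flow_value x = r"
      using rel_interior_subset cone_over_F1 by blast
    have "0 < x $ e" for e
    proof -
      obtain R where R: "route G s t R" "e \<in> set R" using route_through by blast
      have "(route_vec R, 1) \<in> cone_over F1"
        using R route_lin_flow route_flow_value by (auto simp: cone_over_F1)
      then obtain c where c: "c > 1" "(1 - c) *\<^sub>R (route_vec R, 1) + c *\<^sub>R (x, r) \<in> cone_over F1"
        using int iff by blast
      then have "((1 - c) *\<^sub>R route_vec R + c *\<^sub>R x) $ e \<ge> 0" using cone_over_F1 by auto
      then have "c * x $ e \<ge> c - 1" using R by simp
      then have "c * x $ e > 0" using c by linarith
      then show ?thesis using c by (simp add: zero_less_mult_iff)
    qed
    then show "(\<forall>e. 0 < x $ e) \<and> lin_flow x \<and> flow_value x = r" using x by blast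
  next
    assume x: "(\<forall>e. 0 < x $ e) \<and> lin_flow x \<and> flow_value x = r"
    show "(x, r) \<in> rel_interior (cone_over F1)"
      unfolding iff
    proof
      fix z assume z: "z \<in> cone_over F1"
      obtain y q where [simp]: "z = (y, q)" by (cases z)
      have y: "(\<forall>e. 0 \<le> y $ e) \<and> lin_flow y \<and> flow_value y = q" using z cone_over_F1 by auto
      define m where "m = Min (range (\<lambda>e. x $ e))"
      have m: "m > 0" "\<And>e. m \<le> x $ e" using x by (auto simp: m_def)
      define M where "M = Max (range (\<lambda>e. y $ e))"
      have M: "\<And>e. y $ e \<le> M" by (auto simp: M_def)
      have M0: "M \<ge> 0" using M y by (meson order_trans)
      \<comment> \<open>\<open>m\<close> bounds the coordinates of \<open>x\<close> from below and
        \<open>M\<close> those of \<open>y\<close> from above. This choice gives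
        \<open>(c - 1) * M \<le> m\<close>, so that no coordinate turns negative; the added 1 keeps
        the denominator positive.\<close>
      define c where "c = 1 + m / (M + 1)"
      have c1: "c > 1" using m M0 by (simp add: c_def)
      have "0 \<le> (1 - c) * y $ e + c * x $ e" for e
      proof -
        have "(c - 1) * y $ e \<le> (c - 1) * M" using c1 M by (intro mult_left_mono) auto
        also have "\<dots> \<le> m" using m M0 by (simp add: c_def field_simps)
        also have "\<dots> \<le> x $ e" using m by simp
        also have "\<dots> \<le> c * x $ e" using c1 x by (simp add: less_imp_le)
        finally show ?thesis by (simp add: algebra_simps)
      qed
      then have "(1 - c) *\<^sub>R z + c *\<^sub>R (x, r) \<in> cone_over F1"
        using x y by (auto simp: cone_over_F1 lin_flow_add lin_flow_scale flow_value_add flow_value_scale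
            simp del: scaleR_left.diff)
      then show "\<exists>c>1. (1 - c) *\<^sub>R z + c *\<^sub>R (x, r) \<in> cone_over F1" using c1 by blast
    qed
  qed
qed

lemma gorenstein_imp_all_ones:
  assumes "gorenstein F1"
  shows "lin_flow (\<chi> e. 1)"
proof -
  obtain c where c: "c \<in> int_lattice"
    "(\<lambda>z. c + z) ` (cone_over F1 \<inter> int_lattice) = rel_interior (cone_over F1) \<inter> int_lattice"
    using assms unfolding gorenstein_def by blast
  obtain x r where [simp]: "c = (x, r)" by (cases c)
  \<comment> \<open>The apex of the cone is a lattice point, so its translate, which is
    \<open>c\<close> itself, must be an interior lattice point.\<close>
  have "(0, 0) \<in> cone_over F1 \<inter> int_lattice"
    using cone_over_F1[of 0 0] by (auto simp: lin_flow_def flow_value_def int_lattice_def)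
  then have "c + (0, 0) \<in> rel_interior (cone_over F1) \<inter> int_lattice"
    using c(2) by blast
  then have x: "(\<forall>e. 0 < x $ e) \<and> lin_flow x" using rel_interior_cone_over_F1 by auto
  have "x $ e = 1" for e
  proof -
    have "\<exists>R. route G s t R \<and> d \<in> set R \<and> (d \<noteq> e \<longrightarrow> e \<notin> set R)" for d
      using route_through_avoiding[of d e] route_through[of e] by metis
    then obtain Rd where Rd: "\<And>d. route G s t (Rd d) \<and> d \<in> set (Rd d) \<and> (d \<noteq> e \<longrightarrow> e \<notin> set (Rd d))"
      by metis
    define y where "y = (\<Sum>d\<in>UNIV. route_vec (Rd d))"
    have y: "y $ d = (\<Sum>d'\<in>UNIV. of_bool (d \<in> set (Rd d')))" for d by (simp add: y_def)
    have "0 < y $ d" for d unfolding y by (rule sum_pos2[of _ d]) (use Rd in auto)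
    moreover have "lin_flow y" unfolding y_def using Rd route_lin_flow by (intro lin_flow_sum) auto
    moreover have "flow_value y \<in> \<int>" "\<forall>d. y $ d \<in> \<int>"
      by (auto simp: flow_value_def y intro!: Ints_sum)
    ultimately have "(y, flow_value y) \<in> rel_interior (cone_over F1) \<inter> int_lattice"
      using rel_interior_cone_over_F1 by (auto simp: int_lattice_def)
    \<comment> \<open>As \<open>y\<close> is the translate by \<open>c\<close> of a point of the
      cone, \<open>y $ e \<ge> x $ e\<close>. The positive integer \<open>x $ e\<close> is thus
      squeezed between 1 and \<open>y $ e = 1\<close>.\<close>
    then obtain z where z: "z \<in> cone_over F1" "(y, flow_value y) = c + z" using c(2) by blast
    then have "y $ e \<ge> x $ e" using cone_over_F1 by (cases z) auto
    moreover have "y $ e = (\<Sum>d'\<in>UNIV. if d' = e then 1 else 0)"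
      unfolding y using Rd by (intro sum.cong) (auto simp: of_bool_def)
    then have "y $ e = 1" by simp
    ultimately have "x $ e \<le> 1" by simp
    moreover have "x $ e \<in> \<int>" using c(1) by (auto simp: int_lattice_def)
    ultimately show ?thesis using x by (metis Ints_cases of_int_0_less_iff of_int_le_1_iff
          int_one_le_iff_zero_less of_int_1 order_antisym)
  qed
  then have "x = (\<chi> e. 1)" by (simp add: vec_eq_iff)
  then show ?thesis using x by simp
qed

lemma F1_lin: "x \<in> F1 \<Longrightarrow> lin_flow x" and F1_value: "x \<in> F1 \<Longrightarrow> flow_value x = 1"
  and F1_nonneg: "x \<in> F1 \<Longrightarrow> 0 \<le> x $ e"
  by (auto simp: F1_iff)

section \<open>Faces given by the vanishing of an edge\<close>

lemma zero_arc_face: "{x \<in> F1. x $ e = 0} face_of F1"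
proof -
  have "F1 \<inter> {x. axis e 1 \<bullet> x = 0} face_of F1"
    by (rule face_of_Int_supporting_hyperplane_ge[OF convex_F1]) (simp add: inner_axis' F1_nonneg)
  moreover have "F1 \<inter> {x. axis e 1 \<bullet> x = 0} = {x \<in> F1. x $ e = 0}" by (auto simp: inner_axis')
  ultimately show ?thesis by simp
qed

text \<open>The average of routes avoiding \<open>e\<close>, one through each other edge. It serves
  as a relative interior point of the face \<open>x $ e = 0\<close>; the edge \<open>d0\<close>
  makes sure that the average is over a nonempty set.\<close>

lemma zero_arc_interior_point:
  assumes "d0 \<noteq> e"
  obtains z where "z \<in> F1" "z $ e = 0" "\<And>d. d \<noteq> e \<Longrightarrow> 0 < z $ d"
proof -
  define N where "N = real (card (- {e}))"
  have N: "N > 0" using assms by (auto simp: N_def card_gt_0_iff)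
  have "\<exists>R. d \<noteq> e \<longrightarrow> route G s t R \<and> d \<in> set R \<and> e \<notin> set R" for d
    using route_through_avoiding[of d e] by metis
  then obtain Rd where Rd: "\<And>d. d \<noteq> e \<Longrightarrow> route G s t (Rd d) \<and> d \<in> set (Rd d) \<and> e \<notin> set (Rd d)"
    by metis
  define z where "z = (1 / N) *\<^sub>R (\<Sum>d\<in>-{e}. route_vec (Rd d))"
  have z: "z $ d = (1 / N) * (\<Sum>d'\<in>-{e}. of_bool (d \<in> set (Rd d')))" for d by (simp add: z_def)
  show thesis
  proof
    have "lin_flow z" unfolding z_def using Rd route_lin_flow by (intro lin_flow_scale lin_flow_sum) auto
    moreover have "flow_value z = 1"
      using Rd N by (simp add: z_def flow_value_scale flow_value_sum route_flow_value flip: N_def)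
    moreover have "0 \<le> z $ d" for d using N by (auto simp: z intro!: mult_nonneg_nonneg sum_nonneg)
    ultimately show "z \<in> F1" by (simp add: F1_iff)
    show "z $ e = 0" unfolding z using Rd by simp
    show "0 < z $ d" if "d \<noteq> e" for d
    proof -
      have "(0::real) < (\<Sum>d'\<in>-{e}. of_bool (d \<in> set (Rd d')))"
        by (rule sum_pos2[of _ d]) (use Rd that in auto)
      then show ?thesis using N by (simp add: z)
    qed
  qed
qed

text \<open>A short step from \<open>z\<close> towards \<open>y\<close> stays in the face, as the
  coordinates of \<open>z\<close> other than \<open>e\<close> are bounded away from zero, and
  \<open>y\<close> is on the line through \<open>z\<close> and the point reached.\<close>

lemma zero_arc_affine_hull:
  assumes z: "z \<in> F1" "z $ e = 0" "\<And>d. d \<noteq> e \<Longrightarrow> 0 < z $ d"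
    and y: "lin_flow y" "flow_value y = 1" "y $ e = 0"
  shows "y \<in> affine hull {x \<in> F1. x $ e = 0}"
proof -
  define m where "m = Min (insert 1 ((\<lambda>d. z $ d) ` (- {e})))"
  have m: "0 < m" unfolding m_def using z(3) by (subst Min_gr_iff) auto
  have mz: "m \<le> z $ d" if "d \<noteq> e" for d unfolding m_def by (rule Min_le) (use that in auto)
  define M where "M = Max (range (\<lambda>d. \<bar>y $ d - z $ d\<bar>))"
  have M: "\<bar>y $ d - z $ d\<bar> \<le> M" for d unfolding M_def by (rule Max_ge) auto
  have M0: "0 \<le> M" using order_trans[OF abs_ge_zero M[of undefined]] .
  \<comment> \<open>A step of this length changes no coordinate of \<open>z\<close> by more than
    \<open>m\<close>, the lower bound for its positive coordinates.\<close>
  define \<eta> where "\<eta> = m / (M + 1)"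
  have \<eta>: "0 < \<eta>" "\<eta> * M \<le> m" using m M0 by (auto simp: \<eta>_def field_simps)
  define w where "w = z + \<eta> *\<^sub>R (y - z)"
  have "0 \<le> w $ d" for d
  proof (cases "d = e")
    case False
    have "\<bar>\<eta> * (y $ d - z $ d)\<bar> \<le> \<eta> * M" using M[of d] \<eta>(1) by (simp add: abs_mult)
    then show ?thesis using \<eta>(2) mz[OF False] by (simp add: w_def)
  qed (use z y in \<open>simp add: w_def\<close>)
  moreover have "lin_flow w" unfolding w_def using F1_lin[OF z(1)] y(1) by (intro lin_flow_add lin_flow_scale lin_flow_diff)
  moreover have "flow_value w = 1" unfolding w_def using F1_value[OF z(1)] y(2)
    by (simp add: flow_value_add flow_value_scale flow_value_diff)
  moreover have "w $ e = 0" using z(2) y(3) by (simp add: w_def)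
  ultimately have "w \<in> {x \<in> F1. x $ e = 0}" by (simp add: F1_iff)
  then have wh: "w \<in> affine hull {x \<in> F1. x $ e = 0}" by (rule hull_inc)
  have zh: "z \<in> affine hull {x \<in> F1. x $ e = 0}" by (rule hull_inc) (use z in simp)
  have "(1 / \<eta>) *\<^sub>R w + (1 - 1 / \<eta>) *\<^sub>R z \<in> affine hull {x \<in> F1. x $ e = 0}"
    by (rule mem_affine[OF affine_affine_hull wh zh]) simp
  moreover have "(1 / \<eta>) *\<^sub>R w + (1 - 1 / \<eta>) *\<^sub>R z = y"
    using \<eta>(1) by (simp add: w_def algebra_simps)
  ultimately show ?thesis by simp
qed

text \<open>Dimension count: the face together with one route through \<open>e\<close> already spans
  the polytope affinely, so the face has codimension one. The route \<open>Q\<close> guarantees that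
  the face is not empty.\<close>

lemma zero_arc_facet:
  assumes Q: "route G s t Q" "e \<notin> set Q"
  shows "{x \<in> F1. x $ e = 0} facet_of F1"
proof -
  let ?F = "{x \<in> F1. x $ e = 0}"
  obtain d0 where "d0 \<in> set Q" using route_nonempty[OF Q(1)] by (cases Q) auto
  then have "d0 \<noteq> e" using Q by auto
  then obtain z where z: "z \<in> F1" "z $ e = 0" "\<And>d. d \<noteq> e \<Longrightarrow> 0 < z $ d"
    using zero_arc_interior_point by metis
  obtain R where R: "route G s t R" "e \<in> set R" using route_through by blast
  let ?r = "route_vec R"
  let ?A = "affine hull (insert ?r ?F)"
  have r: "?r \<in> F1" "?r $ e = 1" using route_vec_in_F1 R by auto
  have "F1 \<subseteq> ?A"
  proof
    fix x assume x: "x \<in> F1"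
    \<comment> \<open>Subtracting \<open>x $ e\<close> times the route kills the coordinate
      \<open>e\<close>; adding the same multiple of \<open>z\<close> restores the value one.\<close>
    define y where "y = x - (x $ e) *\<^sub>R ?r + (x $ e) *\<^sub>R z"
    have "y \<in> affine hull ?F"
    proof (rule zero_arc_affine_hull[OF z])
      show "lin_flow y" unfolding y_def
        using x z(1) r(1) F1_lin by (intro lin_flow_add lin_flow_diff lin_flow_scale) auto
      show "flow_value y = 1" unfolding y_def
        using F1_value[OF x] F1_value[OF z(1)] F1_value[OF r(1)] by (simp add: flow_value_add flow_value_diff flow_value_scale)
      show "y $ e = 0" using z(2) R(2) by (simp add: y_def)
    qed
    then have yA: "y \<in> ?A" using hull_mono[of ?F "insert ?r ?F"] by blast
    have rA: "?r \<in> ?A" and zA: "z \<in> ?A" using z by (auto intro: hull_inc)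
    have "1 *\<^sub>R y + (x $ e) *\<^sub>R ?r + (- (x $ e)) *\<^sub>R z \<in> ?A"
      by (rule mem_affine_3[OF affine_affine_hull yA rA zA]) simp
    then show "x \<in> ?A" by (simp add: y_def)
  qed
  then have "aff_dim F1 \<le> aff_dim (insert ?r ?F)"
    using aff_dim_subset[of F1 ?A] by (simp add: aff_dim_affine_hull)
  then have "aff_dim F1 \<le> aff_dim ?F + 1" by (auto simp: aff_dim_insert split: if_splits)
  moreover have "?r \<notin> ?F" using r(2) by simp
  then have "aff_dim ?F < aff_dim F1"
    by (intro face_of_aff_dim_lt[OF convex_F1 zero_arc_face]) (use r(1) in blast)
  moreover have "?F \<noteq> {}" using z by auto
  ultimately show ?thesis using zero_arc_face by (simp add: facet_of_def)
qed

text \<open>If \<open>C\<close> covered \<open>R\<close>, then an average of routes in \<open>C\<close> would lie on a segment from \<open>\<chi>\<^sub>R\<close>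
  into the polytope, so that \<open>\<chi>\<^sub>R\<close> would lie on the face.\<close>

lemma face_avoids_arc:
  assumes F: "F face_of F1" and R: "route G s t R" "route_vec R \<notin> F"
    and C: "\<And>Q. Q \<in> C \<Longrightarrow> route_vec Q \<in> F"
  shows "\<exists>e\<in>set R. \<forall>Q\<in>C. e \<notin> set Q"
proof (rule ccontr)
  assume "\<not> ?thesis"
  then have "\<forall>e\<in>set R. \<exists>Q. Q \<in> C \<and> e \<in> set Q" by blast
  then obtain Q where Q: "\<And>e. e \<in> set R \<Longrightarrow> Q e \<in> C \<and> e \<in> set (Q e)" by metis
  define N where "N = real (card (set R))"
  have "set R \<noteq> {}" using route_nonempty[OF R(1)] by simp
  then have N: "1 \<le> N" by (simp add: N_def Suc_le_eq card_gt_0_iff)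
  define z where "z = (\<Sum>e\<in>set R. (1 / N) *\<^sub>R route_vec (Q e))"
  have sub: "F \<subseteq> F1" by (rule face_of_imp_subset[OF F])
  have zF: "z \<in> F" unfolding z_def
    using N Q C by (intro convex_sum face_of_imp_convex[OF F]) (auto simp: N_def)
  then have zF1: "z \<in> F1" using sub by blast
  have zR: "1 / N \<le> z $ e" if "e \<in> set R" for e
  proof -
    have "1 / N * of_bool (e \<in> set (Q e)) \<le> (\<Sum>d\<in>set R. 1 / N * of_bool (e \<in> set (Q d)))"
      using N by (intro member_le_sum that) auto
    then show ?thesis using Q[OF that] by (simp add: z_def)
  qed
  \<comment> \<open>Half of the bound \<open>1 / N\<close>, so that \<open>\<eta> < 1\<close> also
    when \<open>R\<close> has a single edge.\<close>
  define \<eta> where "\<eta> = 1 / (2 * N)"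
  have \<eta>: "0 < \<eta>" "\<eta> < 1" "\<eta> \<le> 1 / N" using N by (auto simp: \<eta>_def field_simps)
  define w where "w = (1 / (1 - \<eta>)) *\<^sub>R (z - \<eta> *\<^sub>R route_vec R)"
  have "0 \<le> (z - \<eta> *\<^sub>R route_vec R) $ e" for e
    using zR[of e] \<eta>(3) F1_nonneg[OF zF1, of e] by (cases "e \<in> set R") auto
  then have "0 \<le> w $ e" for e using \<eta>(2) by (simp add: w_def)
  moreover have "lin_flow w" unfolding w_def
    using F1_lin[OF zF1] route_lin_flow[OF R(1)] by (intro lin_flow_scale lin_flow_diff)
  moreover have "flow_value w = 1" unfolding w_def
    using F1_value[OF zF1] route_flow_value[OF R(1)] \<eta>(2) by (simp add: flow_value_scale flow_value_diff)
  ultimately have w: "w \<in> F1" by (simp add: F1_iff)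
  have zw: "z = (1 - \<eta>) *\<^sub>R w + \<eta> *\<^sub>R route_vec R" using \<eta>(2) by (simp add: w_def)
  have "w \<noteq> route_vec R"
  proof
    assume "w = route_vec R"
    then have "z = route_vec R" unfolding zw by (simp flip: scaleR_left.add)
    then show False using zF R(2) by simp
  qed
  then have seg: "z \<in> open_segment w (route_vec R)" using \<eta> zw by (auto simp: in_segment)
  then show False using face_ofD[OF F seg w route_vec_in_F1[OF R(1)] zF] R(2) by blast
qed

end


section \<open>Strongly planar realizations\<close>

locale planar_flow_graph = flow_graph G s t "\<lambda>v. fst (pos v)"
  for G :: "('v, 'e::finite) pre_digraph" and s t :: 'v and pos :: "'v \<Rightarrow> real \<times> real" +
  fixes h :: "'e \<Rightarrow> real \<Rightarrow> real"
  assumes planar: "strongly_planar_realization G pos h"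
begin

abbreviation X :: "'e \<Rightarrow> real" where "X e \<equiv> fst (pos (tail G e))"
abbreviation Y :: "'e \<Rightarrow> real" where "Y e \<equiv> fst (pos (head G e))"
abbreviation D :: "(real \<times> real) set" where "D \<equiv> drawing G pos h"
abbreviation xs :: real where "xs \<equiv> fst (pos s)"
abbreviation xt :: real where "xt \<equiv> fst (pos t)"

lemma h_continuous: "continuous_on {X e..Y e} (h e)"
  using planar piecewise_differentiable_on_imp_continuous_on[of "h e"]
  by (simp add: strongly_planar_realization_def tail_x_def head_x_def arcs_UNIV)

lemma h_tail: "h e (X e) = snd (pos (tail G e))" and h_head: "h e (Y e) = snd (pos (head G e))"
  using planar unfolding strongly_planar_realization_def tail_x_def head_x_def
  by (metis arc_in_arcs snd_conv)+

lemma pos_inj: "v \<in> verts G \<Longrightarrow> w \<in> verts G \<Longrightarrow> fst (pos v) = fst (pos w) \<Longrightarrow>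
    snd (pos v) = snd (pos w) \<Longrightarrow> v = w"
  using planar by (auto simp: strongly_planar_realization_def dest: inj_onD intro: prod_eqI)

lemma vertex_off_open_edge: "v \<in> verts G \<Longrightarrow> X e < fst (pos v) \<Longrightarrow> fst (pos v) < Y e \<Longrightarrow>
    h e (fst (pos v)) \<noteq> snd (pos v)"
  using planar unfolding strongly_planar_realization_def open_edge_def tail_x_def head_x_def
  by (metis (no_types, lifting) arc_in_arcs greaterThanLessThan_iff image_eqI prod.collapse)

lemma open_edges_disjoint:
  assumes "e \<noteq> d" "X e < x" "x < Y e" "X d < x" "x < Y d"
  shows "h e x \<noteq> h d x"
proof
  assume "h e x = h d x"
  then have "(x, h e x) \<in> open_edge G pos h e \<inter> open_edge G pos h d"
    using assms by (auto simp: open_edge_def tail_x_def head_x_def)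
  moreover have "open_edge G pos h e \<inter> open_edge G pos h d = {}"
    using planar assms(1) by (simp add: strongly_planar_realization_def arcs_UNIV)
  ultimately show False by blast
qed

lemma edges_meet_not_interior:
  assumes "e \<noteq> d" "X e \<le> x" "x \<le> Y e" "X d \<le> x" "x \<le> Y d" "h e x = h d x"
  shows "x = X e \<or> x = Y e"
proof (rule ccontr)
  assume x: "\<not> (x = X e \<or> x = Y e)"
  then have "x = X d \<or> x = Y d" using open_edges_disjoint[OF assms(1), of x] assms by force
  then show False
    using x assms vertex_off_open_edge[of "tail G d" e] vertex_off_open_edge[of "head G d" e]
      h_tail[of d] h_head[of d] by auto
qed

lemma edges_meet_at_vertex:
  assumes "e \<noteq> d" "X e \<le> x" "x \<le> Y e" "X d \<le> x" "x \<le> Y d" "h e x = h d x"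
  shows "x = X e \<and> (x = X d \<and> tail G e = tail G d \<or> x = Y d \<and> tail G e = head G d) \<or>
    x = Y e \<and> (x = X d \<and> head G e = tail G d \<or> x = Y d \<and> head G e = head G d)"
proof -
  have "x = X e \<or> x = Y e" "x = X d \<or> x = Y d"
    using edges_meet_not_interior[OF assms] edges_meet_not_interior[of d e x] assms by auto
  then show ?thesis
    using assms(6) h_tail[of e] h_tail[of d] h_head[of e] h_head[of d] pos_inj by auto
qed

lemma vertex_on_edge:
  assumes "v \<in> verts G"
  obtains e where "X e \<le> fst (pos v)" "fst (pos v) \<le> Y e" "h e (fst (pos v)) = snd (pos v)"
proof (cases "v = t")
  case False
  then obtain e where "e \<in> out_arcs G v" using out_arcs_nonempty[OF assms] by blast
  then have "tail G e = v" by simp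
  then show thesis using that[of e] xc_less[of e] h_tail[of e] by auto
next
  case True
  then obtain e where "e \<in> in_arcs G v" using in_arcs_nonempty[OF assms] s_neq_t by blast
  then have "head G e = v" by simp
  then show thesis using that[of e] xc_less[of e] h_head[of e] by auto
qed

text \<open>Every vertex is an end point of some edge, so the drawing is the union of the closed
  edges and vertices need no separate treatment.\<close>

lemma mem_drawing: "(x, y) \<in> D \<longleftrightarrow> (\<exists>e. X e \<le> x \<and> x \<le> Y e \<and> h e x = y)"
proof
  assume "(x, y) \<in> D"
  then consider v where "v \<in> verts G" "pos v = (x, y)"
    | e where "X e < x" "x < Y e" "h e x = y"
    by (force simp: drawing_def open_edge_def tail_x_def head_x_def)
  then show "\<exists>e. X e \<le> x \<and> x \<le> Y e \<and> h e x = y"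
  proof cases
    case 1
    then show ?thesis using vertex_on_edge[of v] by (metis fst_conv snd_conv)
  next
    case 2
    then show ?thesis by (auto intro: less_imp_le)
  qed
next
  assume "\<exists>e. X e \<le> x \<and> x \<le> Y e \<and> h e x = y"
  then obtain e where e: "X e \<le> x" "x \<le> Y e" "h e x = y" by blast
  consider "x = X e" | "x = Y e" | "X e < x" "x < Y e" using e by fastforce
  then show "(x, y) \<in> D"
  proof cases
    case 1
    then have "(x, y) = pos (tail G e)" using e h_tail[of e] by (simp add: prod_eq_iff)
    then show ?thesis by (auto simp: drawing_def)
  next
    case 2
    then have "(x, y) = pos (head G e)" using e h_head[of e] by (simp add: prod_eq_iff)
    then show ?thesis by (auto simp: drawing_def)
  next
    case 3
    then have "(x, y) \<in> open_edge G pos h e" using e by (auto simp: open_edge_def tail_x_def head_x_def)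
    then show ?thesis by (auto simp: drawing_def arcs_UNIV)
  qed
qed

definition closed_edge :: "'e \<Rightarrow> (real \<times> real) set" where
  "closed_edge e = (\<lambda>x. (x, h e x)) ` {X e..Y e}"

lemma closed_closed_edge: "closed (closed_edge e)"
  unfolding closed_edge_def
  by (intro compact_imp_closed compact_continuous_image continuous_intros h_continuous) auto

lemma closed_drawing: "closed D"
proof -
  have "D = (\<Union>e. closed_edge e)" by (force simp: closed_edge_def mem_drawing)
  then show ?thesis using closed_closed_edge by auto
qed

lemma pos_in_drawing: "v \<in> verts G \<Longrightarrow> pos v \<in> D"
  by (simp add: drawing_def)

subsection \<open>Heights of routes\<close>

text \<open>Follows the edges of a walk from left to right. Past the end of the walk the value 0 is
  arbitrary; at a common end point of consecutive edges the earlier edge is used.\<close>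

primrec ht :: "'e list \<Rightarrow> real \<Rightarrow> real" where
  "ht [] x = 0"
| "ht (e # p) x = (if x \<le> Y e then h e x else ht p x)"

lemma ht_on: "awalk u p v \<Longrightarrow> e \<in> set p \<Longrightarrow> X e \<le> x \<Longrightarrow> x \<le> Y e \<Longrightarrow> ht p x = h e x"
proof (induction p arbitrary: u)
  case (Cons d p)
  then have w: "awalk (head G d) p v" by (auto simp: awalk_Cons_iff)
  show ?case
  proof (cases "e = d")
    case False
    then have e: "e \<in> set p" using Cons.prems by simp
    show ?thesis
    proof (cases "x \<le> Y d")
      case True
      \<comment> \<open>\<open>ht\<close> reads off the earlier edge \<open>d\<close> only up to its
        head, so \<open>x\<close> can only be the single point where \<open>d\<close> ends and
        \<open>e\<close> begins; the walk between them must be empty.\<close>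
      have le: "Y d \<le> X e" using awalk_xc_tail[OF w e] .
      then have x: "x = Y d" "x = X e" using True Cons.prems by auto
      obtain p1 p2 where "p = p1 @ e # p2" "awalk (head G d) p1 (tail G e)"
        using awalk_splitE[OF w e] by metis
      then have "tail G e = head G d"
        using x awalk_xc_less[of "head G d" p1 "tail G e"] by (cases "p1 = []") (auto simp: awalk_Nil_iff)
      then show ?thesis using x h_tail[of e] h_head[of d] by simp
    qed (use Cons.IH[OF w e] Cons.prems in simp)
  qed (use Cons.prems in simp)
qed simp

text \<open>The half-open interval selects the edge running into \<open>x\<close> from the left; the
  variant below selects the one leaving to the right. At a vertex these differ, which matters where
  two routes join or separate.\<close>

lemma walk_left: "awalk u p v \<Longrightarrow> fst (pos u) < x \<Longrightarrow> x \<le> fst (pos v) \<Longrightarrow> \<exists>e\<in>set p. X e < x \<and> x \<le> Y e"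
proof (induction p arbitrary: u)
  case (Cons d p)
  then show ?case by (cases "x \<le> Y d") (auto simp: awalk_Cons_iff)
qed (auto simp: awalk_Nil_iff)

lemma walk_right: "awalk u p v \<Longrightarrow> fst (pos u) \<le> x \<Longrightarrow> x < fst (pos v) \<Longrightarrow> \<exists>e\<in>set p. X e \<le> x \<and> x < Y e"
proof (induction p arbitrary: u)
  case (Cons d p)
  then show ?case by (cases "x < Y d") (auto simp: awalk_Cons_iff)
qed (auto simp: awalk_Nil_iff)

lemma ht_continuous: "awalk u p v \<Longrightarrow> continuous_on {fst (pos u)..fst (pos v)} (ht p)"
proof (induction p arbitrary: u)
  case (Cons d p)
  then have w: "awalk (head G d) p v" and u: "u = tail G d" by (auto simp: awalk_Cons_iff)
  show ?case
  proof (cases "p = []")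
    case True
    then have "v = head G d" using w by (simp add: awalk_Nil_iff)
    have "continuous_on {X d..Y d} (ht (d # p)) = continuous_on {X d..Y d} (h d)"
      by (rule continuous_on_cong) auto
    then show ?thesis using h_continuous[of d] u \<open>v = head G d\<close> by simp
  next
    case False
    then obtain e p' where p: "p = e # p'" by (cases p) auto
    have e: "tail G e = head G d" using w p by (auto simp: awalk_Cons_iff)
    have eq: "{fst (pos u)..fst (pos v)} = {X d..Y d} \<union> {Y d..fst (pos v)}"
      using u xc_less[of d] awalk_xc_le[OF w] by auto
    have "continuous_on ({X d..Y d} \<union> {Y d..fst (pos v)}) (\<lambda>x. if x \<le> Y d then h d x else ht p x)"
    proof (rule continuous_on_If)
      fix x assume "x \<in> {Y d..fst (pos v)}" "x \<le> Y d"
      then have "x = X e" using e by simp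
      then show "h d x = ht p x" using h_tail[of e] h_head[of d] e xc_less[of e] p by simp
    qed (use h_continuous[of d] Cons.IH[OF w] in auto)
    then show ?thesis by (simp add: eq)
  qed
qed (auto simp: awalk_Nil_iff)

text \<open>Clamping the argument makes the height of a route continuous on the whole line, so that
  the sets above and below the route are open in the plane.\<close>

definition Hgt :: "'e list \<Rightarrow> real \<Rightarrow> real" where
  "Hgt R x = ht R (max xs (min xt x))"

lemma verts_x_range:
  assumes v: "v \<in> verts G"
  shows "xs \<le> fst (pos v) \<and> fst (pos v) \<le> xt"
proof
  have "xs < xt" if "v = s \<or> v = t"
  proof -
    obtain R where "route G s t R" using route_through by blast
    then show ?thesis using awalk_xc_less[of s R t] route_nonempty[of R] by (simp add: route_def)
  qed
  moreover have "xs \<le> fst (pos v)" if "v \<noteq> t"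
    using awalk_from_s_avoiding[OF v that] awalk_xc_le by blast
  moreover have "fst (pos v) \<le> xt" if "v \<noteq> s"
    using awalk_to_t_avoiding[OF v that] awalk_xc_le by blast
  ultimately show "xs \<le> fst (pos v)" "fst (pos v) \<le> xt" by fastforce+
qed

lemma edge_x_range: "xs \<le> X e" "Y e \<le> xt"
  using verts_x_range by auto

lemma xs_less_xt: "xs < xt"
  using edge_x_range[of undefined] xc_less[of undefined] by linarith

lemma Hgt_on: "route G s t R \<Longrightarrow> e \<in> set R \<Longrightarrow> X e \<le> x \<Longrightarrow> x \<le> Y e \<Longrightarrow> Hgt R x = h e x"
  using ht_on[of s R t e x] edge_x_range[of e] by (simp add: Hgt_def route_def)

lemma continuous_Hgt:
  assumes "route G s t R"
  shows "continuous_on S (Hgt R)"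
proof -
  have "continuous_on {xs..xt} (ht R)" using ht_continuous[of s R t] assms by (simp add: route_def)
  then show ?thesis
    unfolding Hgt_def
    by (rule continuous_on_compose2[OF _ continuous_on_max[OF continuous_on_const
            continuous_on_min[OF continuous_on_const continuous_on_id]]]) (use xs_less_xt in auto)
qed

lemma continuous_Hgt_fst:
  assumes "route G s t R"
  shows "continuous_on S (\<lambda>z. Hgt R (fst z))"
  by (rule continuous_on_compose2[OF continuous_Hgt[OF assms, of UNIV] continuous_on_fst[OF continuous_on_id]]) simp

lemma route_left: "route G s t R \<Longrightarrow> xs < x \<Longrightarrow> x \<le> xt \<Longrightarrow> \<exists>e\<in>set R. X e < x \<and> x \<le> Y e"
  and route_right: "route G s t R \<Longrightarrow> xs \<le> x \<Longrightarrow> x < xt \<Longrightarrow> \<exists>e\<in>set R. X e \<le> x \<and> x < Y e"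
  unfolding route_def by (rule walk_left; assumption) (rule walk_right; assumption)

lemma Hgt_s:
  assumes "route G s t R"
  shows "Hgt R xs = snd (pos s)"
proof -
  obtain e p where R: "R = e # p" using route_nonempty[OF assms] by (cases R) auto
  then have "tail G e = s" using assms by (auto simp: route_def awalk_Cons_iff)
  then show ?thesis using Hgt_on[OF assms, of e xs] R xc_less[of e] h_tail[of e] by simp
qed

lemma Hgt_t:
  assumes "route G s t R"
  shows "Hgt R xt = snd (pos t)"
proof -
  obtain e where e: "e \<in> set R" "X e < xt" "xt \<le> Y e"
    using route_left[OF assms, of xt] xs_less_xt by auto
  obtain p2 where "awalk (head G e) p2 t"
    using awalk_splitE[of s R t e] e assms by (metis route_def)
  moreover have "Y e = xt" using e edge_x_range[of e] by simp
  ultimately have "head G e = t"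
    using awalk_xc_less[of "head G e" p2 t] by (cases "p2 = []") (auto simp: awalk_Nil_iff)
  then show ?thesis using Hgt_on[OF assms, of e xt] e h_head[of e] by simp
qed

lemma Hgt_in_drawing:
  assumes "route G s t R" "xs \<le> x" "x \<le> xt"
  shows "(x, Hgt R x) \<in> D"
proof (cases "x = xs")
  case True
  then show ?thesis using Hgt_s[OF assms(1)] pos_in_drawing[of s] by (metis s_in_verts prod.collapse)
next
  case False
  then obtain e where "e \<in> set R" "X e < x" "x \<le> Y e" using route_left[OF assms(1), of x] assms by auto
  then show ?thesis using Hgt_on[OF assms(1), of e x] by (auto simp: mem_drawing intro: less_imp_le)
qed

lemma drawing_on_route:
  assumes "(x, y) \<in> D"
  obtains R where "route G s t R" "Hgt R x = y" "xs \<le> x" "x \<le> xt"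
proof -
  obtain e where e: "X e \<le> x" "x \<le> Y e" "h e x = y" using assms mem_drawing by auto
  obtain R where "route G s t R" "e \<in> set R" using route_through by blast
  then show thesis using that[of R] Hgt_on[of R e x] e edge_x_range[of e] by simp
qed

subsection \<open>The regions on both sides of an edge\<close>

text \<open>The sign \<open>\<sigma>\<close> is \<open>1\<close> for the upper side and \<open>-1\<close> for the lower side.\<close>

definition side :: "real \<Rightarrow> 'e \<Rightarrow> real \<Rightarrow> (real \<times> real) set \<Rightarrow> bool" where
  "side \<sigma> e x c \<longleftrightarrow> (\<exists>\<epsilon>>0. \<forall>\<tau>. 0 < \<tau> \<and> \<tau> < \<epsilon> \<longrightarrow> (x, h e x + \<sigma> * \<tau>) \<in> c)"

lemma directly_above_iff: "directly_above G pos h p e \<longleftrightarrow> (\<forall>x\<in>{X e<..<Y e}. side 1 e x p)"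
proof -
  have "(\<forall>\<^sub>F y in at_right (h e x). (x, y) \<in> p) \<longleftrightarrow> side 1 e x p" for x
  proof
    assume "\<forall>\<^sub>F y in at_right (h e x). (x, y) \<in> p"
    then obtain b where "b > h e x" "\<forall>y>h e x. y < b \<longrightarrow> (x, y) \<in> p" by (auto simp: eventually_at_right_field)
    then show "side 1 e x p" unfolding side_def by (intro exI[of _ "b - h e x"]) auto
  next
    assume "side 1 e x p"
    then obtain \<epsilon> where \<epsilon>: "\<epsilon> > 0" "\<forall>\<tau>. 0 < \<tau> \<and> \<tau> < \<epsilon> \<longrightarrow> (x, h e x + 1 * \<tau>) \<in> p" by (auto simp: side_def)
    have "(x, y) \<in> p" if "y > h e x" "y < h e x + \<epsilon>" for y
      using \<epsilon>(2)[rule_format, of "y - h e x"] that by simp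
    then show "\<forall>\<^sub>F y in at_right (h e x). (x, y) \<in> p"
      unfolding eventually_at_right_field using \<epsilon>(1) by (intro exI[of _ "h e x + \<epsilon>"]) auto
  qed
  then show ?thesis by (simp add: directly_above_def tail_x_def head_x_def)
qed

lemma directly_below_iff: "directly_below G pos h p e \<longleftrightarrow> (\<forall>x\<in>{X e<..<Y e}. side (-1) e x p)"
proof -
  have "(\<forall>\<^sub>F y in at_left (h e x). (x, y) \<in> p) \<longleftrightarrow> side (-1) e x p" for x
  proof
    assume "\<forall>\<^sub>F y in at_left (h e x). (x, y) \<in> p"
    then obtain b where "b < h e x" "\<forall>y>b. y < h e x \<longrightarrow> (x, y) \<in> p" by (auto simp: eventually_at_left_field)
    then show "side (-1) e x p" unfolding side_def by (intro exI[of _ "h e x - b"]) auto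
  next
    assume "side (-1) e x p"
    then obtain \<epsilon> where \<epsilon>: "\<epsilon> > 0" "\<forall>\<tau>. 0 < \<tau> \<and> \<tau> < \<epsilon> \<longrightarrow> (x, h e x + -1 * \<tau>) \<in> p" by (auto simp: side_def)
    have "(x, y) \<in> p" if "y < h e x" "y > h e x - \<epsilon>" for y
      using \<epsilon>(2)[rule_format, of "h e x - y"] that by simp
    then show "\<forall>\<^sub>F y in at_left (h e x). (x, y) \<in> p"
      unfolding eventually_at_left_field using \<epsilon>(1) by (intro exI[of _ "h e x - \<epsilon>"]) auto
  qed
  then show ?thesis by (simp add: directly_below_def tail_x_def head_x_def)
qed

lemma side_common_point:
  assumes "side \<sigma> e x c" "side \<sigma> e x c'" "0 < r"
  obtains \<tau> where "0 < \<tau>" "\<tau> < r" "(x, h e x + \<sigma> * \<tau>) \<in> c" "(x, h e x + \<sigma> * \<tau>) \<in> c'"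
proof -
  obtain \<epsilon> \<epsilon>' where *: "\<epsilon> > 0" "\<forall>\<tau>. 0 < \<tau> \<and> \<tau> < \<epsilon> \<longrightarrow> (x, h e x + \<sigma> * \<tau>) \<in> c"
    "\<epsilon>' > 0" "\<forall>\<tau>. 0 < \<tau> \<and> \<tau> < \<epsilon>' \<longrightarrow> (x, h e x + \<sigma> * \<tau>) \<in> c'"
    using assms by (auto simp: side_def)
  define \<tau> where "\<tau> = min (min \<epsilon> \<epsilon>') r / 2"
  then have "0 < \<tau>" "\<tau> < r" "\<tau> < \<epsilon>" "\<tau> < \<epsilon>'" using assms(3) * by (auto simp: \<tau>_def)
  then show thesis using that[of \<tau>] * by blast
qed

text \<open>The other closed edges form a closed set missing the point, hence missing a ball around
  it. By continuity of \<open>h e\<close> a thin strip along \<open>e\<close> of uniform height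
  stays in this ball; the thirds of its radius bound the horizontal distance, the variation of
  \<open>h e\<close> and the offset from \<open>e\<close>.\<close>

lemma edge_neighbourhood:
  assumes "X e < x0" "x0 < Y e"
  obtains \<delta> where "0 < \<delta>" "\<And>x. \<bar>x - x0\<bar> < \<delta> \<Longrightarrow> X e < x \<and> x < Y e"
    "\<And>x \<tau>. \<bar>x - x0\<bar> < \<delta> \<Longrightarrow> 0 < \<bar>\<tau>\<bar> \<Longrightarrow> \<bar>\<tau>\<bar> < \<delta> \<Longrightarrow> (x, h e x + \<tau>) \<notin> D"
proof -
  have "closed (\<Union>d\<in>-{e}. closed_edge d)" using closed_closed_edge by auto
  moreover have "(x0, h e x0) \<notin> (\<Union>d\<in>-{e}. closed_edge d)"
  proof
    assume "(x0, h e x0) \<in> (\<Union>d\<in>-{e}. closed_edge d)"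
    then obtain d where "d \<noteq> e" "X d \<le> x0" "x0 \<le> Y d" "h e x0 = h d x0"
      unfolding closed_edge_def by fastforce
    then show False using edges_meet_not_interior[of e d x0] assms by auto
  qed
  ultimately obtain r where r: "r > 0" "ball (x0, h e x0) r \<subseteq> - (\<Union>d\<in>-{e}. closed_edge d)"
    by (metis ComplI openE open_Compl)
  have "isCont (h e) x0"
    using continuous_on_interior[OF h_continuous[of e], of x0] assms by simp
  then obtain d1 where d1: "d1 > 0" "\<And>x. \<bar>x - x0\<bar> < d1 \<Longrightarrow> \<bar>h e x - h e x0\<bar> < r / 3"
    unfolding continuous_at_eps_delta dist_real_def using r(1)
    by (metis divide_pos_pos zero_less_numeral)
  define \<delta> where "\<delta> = min (min d1 (r / 3)) (min (x0 - X e) (Y e - x0))"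
  show thesis
  proof (rule that[of \<delta>])
    show "0 < \<delta>" using d1 r assms by (simp add: \<delta>_def)
    show "X e < x \<and> x < Y e" if "\<bar>x - x0\<bar> < \<delta>" for x using that by (auto simp: \<delta>_def)
    show "(x, h e x + \<tau>) \<notin> D" if *: "\<bar>x - x0\<bar> < \<delta>" "0 < \<bar>\<tau>\<bar>" "\<bar>\<tau>\<bar> < \<delta>" for x \<tau>
    proof
      assume "(x, h e x + \<tau>) \<in> D"
      then obtain d where d: "X d \<le> x" "x \<le> Y d" "h d x = h e x + \<tau>" by (auto simp: mem_drawing)
      then have "d \<noteq> e" using * by auto
      then have "(x, h e x + \<tau>) \<in> (\<Union>d\<in>-{e}. closed_edge d)"
        using d by (force simp: closed_edge_def)
      moreover have "dist (x, h e x + \<tau>) (x0, h e x0) < r"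
      proof -
        have "\<bar>h e x - h e x0\<bar> < r / 3" "\<bar>x - x0\<bar> < r / 3" "\<bar>\<tau>\<bar> < r / 3"
          using * d1 by (auto simp: \<delta>_def)
        then show ?thesis using dist_pair_le[of x "h e x + \<tau>" x0 "h e x0"] by linarith
      qed
      ultimately show False using r(2) by (metis ComplD dist_commute mem_ball subsetD)
    qed
  qed
qed

text \<open>Locally, a thin strip beside the open edge lies in a single component. Having a
  component in common is thus a locally constant relation on the open interval under the edge, and
  intervals are connected.\<close>

lemma side_component:
  assumes \<sigma>: "\<bar>\<sigma>\<bar> = 1"
  shows "\<exists>c\<in>components (- D). \<forall>x\<in>{X e<..<Y e}. side \<sigma> e x c"
proof -
  define same where "same x x' \<longleftrightarrow> (\<exists>c\<in>components (- D). side \<sigma> e x c \<and> side \<sigma> e x' c)" for x x'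
  have trans: "same x x'' \<or> same x'' x" if "same x x'" "same x' x''" for x x' x''
  proof -
    obtain c c' where c: "c \<in> components (- D)" "side \<sigma> e x c" "side \<sigma> e x' c"
      "c' \<in> components (- D)" "side \<sigma> e x' c'" "side \<sigma> e x'' c'" using \<open>same x x'\<close> \<open>same x' x''\<close>
      by (auto simp: same_def)
    obtain \<tau> where "(x', h e x' + \<sigma> * \<tau>) \<in> c" "(x', h e x' + \<sigma> * \<tau>) \<in> c'"
      using side_common_point[OF c(3,5), of 1] by auto
    then have "c = c'" using components_eq[OF c(1,4)] by blast
    then show ?thesis using c same_def by auto
  qed
  have "same a b" if ab: "a \<in> {X e<..<Y e}" "b \<in> {X e<..<Y e}" for a b
  proof (rule connected_equivalence_relation[of "{X e<..<Y e}" a b same])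
    show "same y x" if "same x y" for x y using that by (auto simp: same_def)
    show "same x z" if "same x y" "same y z" for x y z using trans[OF that] by (auto simp: same_def)
    show "\<exists>T. openin (top_of_set {X e<..<Y e}) T \<and> x0 \<in> T \<and> (\<forall>x\<in>T. same x0 x)" if x0: "x0 \<in> {X e<..<Y e}" for x0
    proof -
      have x0': "X e < x0" "x0 < Y e" using x0 by auto
      obtain \<delta> where \<delta>: "0 < \<delta>" "\<And>x. \<bar>x - x0\<bar> < \<delta> \<Longrightarrow> X e < x \<and> x < Y e"
        "\<And>x \<tau>. \<bar>x - x0\<bar> < \<delta> \<Longrightarrow> 0 < \<bar>\<tau>\<bar> \<Longrightarrow> \<bar>\<tau>\<bar> < \<delta> \<Longrightarrow> (x, h e x + \<tau>) \<notin> D"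
        by (rule edge_neighbourhood[OF x0'], rule that)
      define A where "A = {x0 - \<delta><..<x0 + \<delta>}"
      have A: "\<bar>x - x0\<bar> < \<delta>" if "x \<in> A" for x using that by (auto simp: A_def)
      let ?S = "(\<lambda>(x, \<tau>). (x, h e x + \<tau> * \<sigma>)) ` (A \<times> {0<..<\<delta>})"
      have "A \<subseteq> {X e..Y e}" using A \<delta>(2) by (force intro: less_imp_le)
      then have conn: "connected ?S"
        by (intro connected_strip continuous_on_subset[OF h_continuous]) (auto simp: A_def)
      moreover have S: "?S \<subseteq> - D"
      proof clarify
        fix x \<tau> assume "x \<in> A" "\<tau> \<in> {0<..<\<delta>}" "(x, h e x + \<tau> * \<sigma>) \<in> D"
        then show False using \<delta>(3)[of x "\<tau> * \<sigma>"] A[of x] \<sigma> by (simp add: abs_mult)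
      qed
      moreover have S_ne: "?S \<noteq> {}" using \<delta>(1) by (auto simp: A_def)
      moreover have "- D \<noteq> {}" using S S_ne by blast
      ultimately obtain c where c: "c \<in> components (- D)" "?S \<subseteq> c"
        using exists_component_superset[OF S _ conn] by blast
      have "side \<sigma> e x c" if "x \<in> A" for x
        unfolding side_def
      proof (intro exI[of _ \<delta>] conjI allI impI)
        fix \<tau> assume "0 < \<tau> \<and> \<tau> < \<delta>"
        then have "(x, h e x + \<tau> * \<sigma>) \<in> ?S" using that by force
        then have "(x, h e x + \<tau> * \<sigma>) \<in> c" using c(2) by blast
        then show "(x, h e x + \<sigma> * \<tau>) \<in> c" by (simp add: mult.commute)
      qed (use \<delta> in auto)
      then have "side \<sigma> e x0 c" "\<forall>x\<in>A. side \<sigma> e x c" using \<delta>(1) by (auto simp: A_def)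
      then have "\<forall>x\<in>A. same x0 x" using c(1) unfolding same_def by blast
      moreover have "openin (top_of_set {X e<..<Y e}) A"
        using A \<delta>(2) by (intro open_subset) (auto simp: A_def)
      ultimately show ?thesis using \<delta>(1) by (intro exI[of _ A]) (auto simp: A_def)
    qed
  qed (use ab in auto)
  moreover obtain a where a: "X e < a" "a < Y e" using dense[OF xc_less[of e]] by auto
  ultimately have same: "same a b" if "b \<in> {X e<..<Y e}" for b using that by simp
  then obtain c where c: "c \<in> components (- D)" "side \<sigma> e a c" using a by (auto simp: same_def)
  have "side \<sigma> e b c" if b: "b \<in> {X e<..<Y e}" for b
  proof -
    obtain c' where c': "c' \<in> components (- D)" "side \<sigma> e a c'" "side \<sigma> e b c'"
      using same[OF b] by (auto simp: same_def)
    obtain \<tau> where "(a, h e a + \<sigma> * \<tau>) \<in> c" "(a, h e a + \<sigma> * \<tau>) \<in> c'"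
      using side_common_point[OF c(2) c'(2), of 1] by auto
    then have "c = c'" using components_eq[OF c(1) c'(1)] by blast
    then show ?thesis using c' by simp
  qed
  then show ?thesis using c by blast
qed

text \<open>This component may be unbounded; \<open>reg\<close> below replaces it in that
  case.\<close>

definition beyond :: "real \<Rightarrow> 'e \<Rightarrow> (real \<times> real) set" where
  "beyond \<sigma> e = (SOME c. c \<in> components (- D) \<and> (\<forall>x\<in>{X e<..<Y e}. side \<sigma> e x c))"

lemma beyond:
  assumes "\<bar>\<sigma>\<bar> = 1"
  shows "beyond \<sigma> e \<in> components (- D)" "X e < x \<Longrightarrow> x < Y e \<Longrightarrow> side \<sigma> e x (beyond \<sigma> e)"
proof -
  have "beyond \<sigma> e \<in> components (- D) \<and> (\<forall>x\<in>{X e<..<Y e}. side \<sigma> e x (beyond \<sigma> e))"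
    unfolding beyond_def by (rule someI_ex) (use side_component[OF assms] in blast)
  then show "beyond \<sigma> e \<in> components (- D)" "X e < x \<Longrightarrow> x < Y e \<Longrightarrow> side \<sigma> e x (beyond \<sigma> e)"
    by auto
qed

lemma beyond_unique:
  assumes "\<bar>\<sigma>\<bar> = 1" "c \<in> components (- D)" "X e < x" "x < Y e" "side \<sigma> e x c"
  shows "c = beyond \<sigma> e"
proof -
  obtain \<tau> where "(x, h e x + \<sigma> * \<tau>) \<in> c" "(x, h e x + \<sigma> * \<tau>) \<in> beyond \<sigma> e"
    using side_common_point[OF assms(5) beyond(2)[OF assms(1,3,4)], of 1] by auto
  then show ?thesis using components_eq[OF assms(2) beyond(1)[OF assms(1)]] by blast
qed

section \<open>Sets enclosed by two routes and the infinite region\<close>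

definition gap :: "'e list \<Rightarrow> 'e list \<Rightarrow> (real \<times> real) set" where
  "gap P Q = {(x, y). xs < x \<and> x < xt \<and> Hgt P x < y \<and> y < Hgt Q x}"

text \<open>The gap lies in a continuous image of a rectangle, obtained by interpolating between the
  two heights.\<close>

lemma bounded_gap:
  assumes "route G s t P" "route G s t Q"
  shows "bounded (gap P Q)"
proof (rule bounded_subset)
  let ?K = "(\<lambda>(x, \<tau>). (x, Hgt P x + \<tau> * (Hgt Q x - Hgt P x))) ` ({xs..xt} \<times> {0..1})"
  have "compact ?K"
    unfolding case_prod_beta
    by (intro compact_continuous_image continuous_on_add continuous_on_mult continuous_on_diff
        continuous_on_Pair continuous_on_fst continuous_on_snd continuous_on_id compact_Times
        continuous_Hgt_fst assms compact_Icc)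
  then show "bounded ?K" by (rule compact_imp_bounded)
  show "gap P Q \<subseteq> ?K"
  proof
    fix z assume "z \<in> gap P Q"
    then obtain x y where z: "z = (x, y)" "xs < x" "x < xt" "Hgt P x < y" "y < Hgt Q x"
      by (auto simp: gap_def)
    define \<tau> where "\<tau> = (y - Hgt P x) / (Hgt Q x - Hgt P x)"
    have "\<tau> \<in> {0..1}" "y = Hgt P x + \<tau> * (Hgt Q x - Hgt P x)"
      using z by (auto simp: \<tau>_def divide_simps)
    then show "z \<in> ?K" using z by force
  qed
qed

text \<open>The frontier of the set between two routes lies in the drawing.\<close>

lemma connected_gap:
  assumes "route G s t P" "route G s t Q" "connected c" "c \<subseteq> - D" "z \<in> c" "z \<in> gap P Q"
  shows "c \<subseteq> gap P Q"
proof -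
  let ?K = "{z. xs \<le> fst z \<and> fst z \<le> xt \<and> Hgt P (fst z) \<le> snd z \<and> snd z \<le> Hgt Q (fst z)}"
  note cont = continuous_Hgt_fst[OF assms(1)] continuous_Hgt_fst[OF assms(2)]
    continuous_on_fst[OF continuous_on_id] continuous_on_snd[OF continuous_on_id] continuous_on_const
  have eq: "gap P Q = {z. xs < fst z} \<inter> {z. fst z < xt} \<inter> {z. Hgt P (fst z) < snd z} \<inter> {z. snd z < Hgt Q (fst z)}"
    by (auto simp: gap_def)
  have "open (gap P Q)"
    unfolding eq by (intro open_Int open_Collect_less cont)
  have "closed ?K"
    by (intro closed_Collect_conj closed_Collect_le cont)
  \<comment> \<open>Off the drawing, lying weakly and lying strictly between the routes agree, so
    the open gap and the open complement of \<open>?K\<close> separate \<open>c\<close>.\<close>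
  have "w \<in> gap P Q" if "w \<in> ?K" "w \<in> - D" for w
  proof -
    obtain x y where w: "w = (x, y)" by (cases w)
    have "x \<noteq> xs"
    proof
      assume "x = xs"
      then have "w = pos s" using that w Hgt_s[OF assms(1)] Hgt_s[OF assms(2)] by (simp add: prod_eq_iff)
      then show False using that pos_in_drawing[of s] by simp
    qed
    moreover have "x \<noteq> xt"
    proof
      assume "x = xt"
      then have "w = pos t" using that w Hgt_t[OF assms(1)] Hgt_t[OF assms(2)] by (simp add: prod_eq_iff)
      then show False using that pos_in_drawing[of t] by simp
    qed
    moreover have "y \<noteq> Hgt P x" "y \<noteq> Hgt Q x"
      using that w Hgt_in_drawing[OF assms(1), of x] Hgt_in_drawing[OF assms(2), of x] by auto
    ultimately show ?thesis using that w by (auto simp: gap_def)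
  qed
  then have "c \<subseteq> gap P Q \<union> - ?K" using assms(4) by blast
  moreover have "gap P Q \<inter> - ?K = {}" by (auto simp: gap_def)
  ultimately show ?thesis
    using connectedD[OF assms(3) \<open>open (gap P Q)\<close>, of "- ?K"] \<open>closed ?K\<close> assms(5,6) by blast
qed

lemma vertical_ray_unbounded:
  fixes p :: "(real \<times> real) set"
  assumes "\<bar>\<sigma>\<bar> = 1" "\<And>\<tau>. 0 \<le> \<tau> \<Longrightarrow> (x, y + \<sigma> * \<tau>) \<in> p"
  shows "\<not> bounded p"
proof
  assume "bounded p"
  then obtain B where B: "\<And>z. z \<in> p \<Longrightarrow> norm z \<le> B" by (auto simp: bounded_iff)
  define \<tau> where "\<tau> = \<bar>B\<bar> + \<bar>y\<bar> + 1"
  have "norm (x, y + \<sigma> * \<tau>) \<le> B"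
    by (rule B, rule assms(2)) (simp add: \<tau>_def)
  then have "norm (y + \<sigma> * \<tau>) \<le> B" by (rule order_trans[OF norm_snd_le])
  moreover have "\<bar>\<sigma> * \<tau>\<bar> = \<tau>" using assms(1) by (simp add: \<tau>_def abs_mult)
  ultimately show False by (simp add: \<tau>_def)
qed

lemma component_vertical:
  assumes "c \<in> components (- D)" "(x, y) \<in> c" "connected T" "0 \<in> T"
    and "\<And>\<tau>. \<tau> \<in> T \<Longrightarrow> (x, y + r * \<tau>) \<notin> D" "\<tau> \<in> T"
  shows "(x, y + r * \<tau>) \<in> c"
proof -
  have "(x, y) \<in> (\<lambda>\<tau>. (x, y + r * \<tau>)) ` T" using assms(4) by force
  then have "(\<lambda>\<tau>. (x, y + r * \<tau>)) ` T \<subseteq> c"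
    by (intro components_maximal[OF assms(1) connected_vertical[OF assms(3)]]) (use assms(2,5) in auto)
  then show ?thesis using assms(6) by blast
qed

lemma bounded_region_ray:
  assumes "p \<in> bounded_regions G pos h" "(x, y) \<in> p" "\<bar>\<sigma>\<bar> = 1"
  shows "\<exists>\<tau>\<ge>0. (x, y + \<sigma> * \<tau>) \<in> D"
proof (rule ccontr)
  assume "\<not> ?thesis"
  then have "(x, y + \<sigma> * \<tau>) \<in> p" if "0 \<le> \<tau>" for \<tau>
    using component_vertical[of p x y "{0..}" \<sigma> \<tau>] assms that by (auto simp: bounded_regions_def)
  then show False using vertical_ray_unbounded[OF assms(3), of x y p] assms(1)
    by (auto simp: bounded_regions_def)
qed

text \<open>From a point of the region whose x-coordinate is that of no vertex, the vertical ray in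
  direction \<open>\<sigma>\<close> first hits the interior of an edge. The segment before this hit
  stays in the region, which therefore lies on the side \<open>- \<sigma>\<close> of that
  edge.\<close>

lemma bounded_region_edges:
  assumes p: "p \<in> bounded_regions G pos h"
  obtains x y where "(x, y) \<in> p"
    "\<And>\<sigma>. \<bar>\<sigma>\<bar> = 1 \<Longrightarrow> \<exists>e. X e < x \<and> x < Y e \<and> 0 < \<sigma> * (h e x - y) \<and> beyond (- \<sigma>) e = p"
proof -
  have pc: "p \<in> components (- D)" and "bounded p" using p by (auto simp: bounded_regions_def)
  have "open p" using open_components[OF _ pc] closed_drawing by auto
  have "p \<noteq> {}" using pc in_components_nonempty by blast
  then obtain x0 y where "(x0, y) \<in> p" by fastforce
  then obtain r where r: "r > 0" "ball (x0, y) r \<subseteq> p" using \<open>open p\<close> openE by metis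
  \<comment> \<open>Only finitely many vertical lines pass through vertices, so one that does not
    meets the ball.\<close>
  have "infinite ({x0<..<x0 + r} - (fst \<circ> pos) ` verts G)"
    by (intro Diff_infinite_finite finite_imageI infinite_Ioo) (use r in auto)
  then obtain x where x: "x0 < x" "x < x0 + r" "x \<notin> (fst \<circ> pos) ` verts G"
    by (metis (no_types, lifting) DiffD1 DiffD2 finite.emptyI greaterThanLessThan_iff equals0I)
  have gen: "x \<noteq> X e" "x \<noteq> Y e" for e using x(3) by (auto simp: image_iff)
  have "dist (x, y) (x0, y) < r" using dist_pair_le[of x y x0 y] x by simp
  then have xy: "(x, y) \<in> p" using r by (auto simp: dist_commute)
  then have "(x, y) \<notin> D" using in_components_subset[OF pc] by auto
  have "\<exists>e. X e < x \<and> x < Y e \<and> 0 < \<sigma> * (h e x - y) \<and> beyond (- \<sigma>) e = p" if \<sigma>: "\<bar>\<sigma>\<bar> = 1" for \<sigma>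
  proof -
    have \<sigma>\<sigma>: "\<sigma> * \<sigma> = 1" using \<sigma> by (metis abs_mult_self_eq mult_1)
    define M where "M = {e. X e < x \<and> x < Y e \<and> 0 < \<sigma> * (h e x - y)}"
    have hit: "\<exists>e\<in>M. \<sigma> * (h e x - y) = \<tau>" if on: "(x, y + \<sigma> * \<tau>) \<in> D" and "0 \<le> \<tau>" for \<tau>
    proof -
      obtain e where e: "X e \<le> x" "x \<le> Y e" "h e x = y + \<sigma> * \<tau>" using iffD1[OF mem_drawing on] by blast
      have height: "\<sigma> * (h e x - y) = \<tau>" using \<sigma>\<sigma> by (simp add: e(3) flip: mult.assoc)
      have "X e < x" "x < Y e" using e(1,2) gen[of e] by (simp_all add: order_le_less)
      moreover have "\<tau> \<noteq> 0" using on \<open>(x, y) \<notin> D\<close> by auto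
      ultimately have "e \<in> M" using \<open>0 \<le> \<tau>\<close> unfolding M_def mem_Collect_eq height by simp
      then show ?thesis using height by blast
    qed
    obtain \<tau>0 where "\<tau>0 \<ge> 0" "(x, y + \<sigma> * \<tau>0) \<in> D" using bounded_region_ray[OF p xy \<sigma>] by blast
    then have "M \<noteq> {}" using hit by blast
    then obtain e where e: "e \<in> M" and min: "\<And>d. d \<in> M \<Longrightarrow> \<sigma> * (h e x - y) \<le> \<sigma> * (h d x - y)"
      using ex_min_if_finite[of "(\<lambda>d. \<sigma> * (h d x - y)) ` M"] by (force simp: not_less)
    define T where "T = \<sigma> * (h e x - y)"
    have T: "0 < T" using e by (simp add: T_def M_def)
    have he: "h e x = y + \<sigma> * T" using \<sigma>\<sigma> by (simp add: T_def flip: mult.assoc)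
    have off: "(x, y + \<sigma> * \<tau>) \<notin> D" if "\<tau> \<in> {0..<T}" for \<tau>
      using hit[of \<tau>] min that by (force simp: T_def)
    have "side (- \<sigma>) e x p"
      unfolding side_def
    proof (intro exI[of _ T] conjI allI impI)
      fix \<tau> assume "0 < \<tau> \<and> \<tau> < T"
      then have "(x, y + \<sigma> * (T - \<tau>)) \<in> p"
        using component_vertical[OF pc xy, of "{0..<T}" \<sigma> "T - \<tau>"] off T by auto
      then show "(x, h e x + - \<sigma> * \<tau>) \<in> p" by (simp add: he algebra_simps)
    qed (use T in auto)
    then have "p = beyond (- \<sigma>) e" using beyond_unique[of "- \<sigma>" p e x] \<sigma> pc e by (auto simp: M_def)
    then show ?thesis using e by (auto simp: M_def)
  qed
  then show thesis using that xy by blast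
qed

text \<open>Routes through edges above and below a point of the region enclose the point and hence,
  by connectedness, the region.\<close>

lemma bounded_region_gap:
  assumes "p \<in> bounded_regions G pos h"
  obtains P Q where "route G s t P" "route G s t Q" "p \<subseteq> gap P Q"
proof -
  obtain x y where xy: "(x, y) \<in> p"
    "\<And>\<sigma>. \<bar>\<sigma>\<bar> = 1 \<Longrightarrow> \<exists>e. X e < x \<and> x < Y e \<and> 0 < \<sigma> * (h e x - y) \<and> beyond (- \<sigma>) e = p"
    using bounded_region_edges[OF assms] by metis
  obtain e where e: "X e < x" "x < Y e" "y < h e x" using xy(2)[of 1] by auto
  obtain d where d: "X d < x" "x < Y d" "h d x < y" using xy(2)[of "-1"] by auto
  obtain P where P: "route G s t P" "d \<in> set P" using route_through by blast
  obtain Q where Q: "route G s t Q" "e \<in> set Q" using route_through by blast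
  have "(x, y) \<in> gap P Q"
    using e d Hgt_on[OF P, of x] Hgt_on[OF Q, of x] edge_x_range[of e] by (auto simp: gap_def)
  then have "p \<subseteq> gap P Q"
    using assms xy(1) in_components_connected[of p "- D"] in_components_subset[of p "- D"]
    by (intro connected_gap[OF P(1) Q(1)]) (auto simp: bounded_regions_def)
  then show thesis using that P Q by blast
qed

text \<open>Both parts of the infinite region at once, selected by a sign. They are described by
  vertical rays, being parts of a region rather than components.\<close>

definition outer :: "real \<Rightarrow> (real \<times> real) set" where
  "outer \<sigma> = {(x, y). xs < x \<and> x < xt \<and> (\<forall>\<tau>\<ge>0. (x, y + \<sigma> * \<tau>) \<notin> D)}"

lemma outer_below_eq: "outer_below G s t pos h = outer (-1)"
proof -
  have "(\<forall>y'\<le>y. (x, y') \<notin> D) \<longleftrightarrow> (\<forall>\<tau>\<ge>0. (x, y - \<tau>) \<notin> D)" for x y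
  proof
    assume *: "\<forall>\<tau>\<ge>0. (x, y - \<tau>) \<notin> D"
    show "\<forall>y'\<le>y. (x, y') \<notin> D"
    proof (intro allI impI)
      fix y' assume "y' \<le> y"
      then show "(x, y') \<notin> D" using *[rule_format, of "y - y'"] by simp
    qed
  qed simp
  then show ?thesis by (auto simp: outer_below_def outer_def)
qed

lemma outer_above_eq: "outer_above G s t pos h = outer 1"
proof -
  have "(\<forall>y'\<ge>y. (x, y') \<notin> D) \<longleftrightarrow> (\<forall>\<tau>\<ge>0. (x, y + \<tau>) \<notin> D)" for x y
  proof
    assume *: "\<forall>\<tau>\<ge>0. (x, y + \<tau>) \<notin> D"
    show "\<forall>y'\<ge>y. (x, y') \<notin> D"
    proof (intro allI impI)
      fix y' assume "y' \<ge> y"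
      then show "(x, y') \<notin> D" using *[rule_format, of "y' - y"] by simp
    qed
  qed simp
  then show ?thesis by (auto simp: outer_above_def outer_def)
qed

abbreviation PG :: "(real \<times> real) set set" where "PG \<equiv> bounded_regions G pos h"
abbreviation hat :: "(real \<times> real) set set" where "hat \<equiv> regions_hat G s t pos h"

lemma hat_eq: "hat = PG \<union> {outer (-1), outer 1}"
  by (simp add: regions_hat_def outer_below_eq outer_above_eq)

lemma bounded_not_outer:
  assumes "p \<in> PG" "z \<in> p" "z \<in> outer \<sigma>" "\<bar>\<sigma>\<bar> = 1"
  shows False
  using bounded_region_ray[of p "fst z" "snd z" \<sigma>] assms by (auto simp: outer_def)

text \<open>Otherwise the ray in direction \<open>\<sigma>\<close> would run into the route.\<close>

lemma outer_off_route:
  assumes "route G s t R" "(x, y) \<in> outer \<sigma>" "\<bar>\<sigma>\<bar> = 1"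
  shows "\<sigma> * (Hgt R x - y) < 0"
proof (rule ccontr)
  assume neg: "\<not> \<sigma> * (Hgt R x - y) < 0"
  have "\<sigma> * (\<sigma> * (Hgt R x - y)) = Hgt R x - y"
    using assms(3) by (metis abs_mult_self_eq mult.assoc mult_1)
  then have "y + \<sigma> * (\<sigma> * (Hgt R x - y)) = Hgt R x" by linarith
  moreover have "(x, Hgt R x) \<in> D"
    using Hgt_in_drawing[OF assms(1), of x] assms(2) by (auto simp: outer_def)
  ultimately have "(x, y + \<sigma> * (\<sigma> * (Hgt R x - y))) \<in> D" by (simp only:)
  moreover have "\<forall>\<tau>\<ge>0. (x, y + \<sigma> * \<tau>) \<notin> D" using assms(2) by (simp add: outer_def)
  ultimately show False using neg by (simp add: not_less)
qed

lemma outer_disjoint: "z \<in> outer 1 \<Longrightarrow> z \<in> outer (-1) \<Longrightarrow> False"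
proof -
  assume z: "z \<in> outer 1" "z \<in> outer (-1)"
  obtain R where R: "route G s t R" using route_through by blast
  show False using outer_off_route[OF R, of "fst z" "snd z" 1] outer_off_route[OF R, of "fst z" "snd z" "-1"] z
    by simp
qed

lemma hat_disjoint: "p \<in> hat \<Longrightarrow> q \<in> hat \<Longrightarrow> z \<in> p \<Longrightarrow> z \<in> q \<Longrightarrow> p = q"
proof -
  assume "p \<in> hat" "q \<in> hat" and z: "z \<in> p" "z \<in> q"
  then consider "p \<in> PG" "q \<in> PG" | "p \<in> PG" "q = outer 1 \<or> q = outer (-1)"
    | "q \<in> PG" "p = outer 1 \<or> p = outer (-1)"
    | "p = outer 1 \<or> p = outer (-1)" "q = outer 1 \<or> q = outer (-1)"
    by (auto simp: hat_eq)
  then show "p = q"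
  proof cases
    case 1
    then show ?thesis using components_eq[of p "- D" q] z by (auto simp: bounded_regions_def)
  next
    case 2
    then show ?thesis using bounded_not_outer[of p z 1] bounded_not_outer[of p z "-1"] z by auto
  next
    case 3
    then show ?thesis using bounded_not_outer[of q z 1] bounded_not_outer[of q z "-1"] z by auto
  next
    case 4
    then show ?thesis using outer_disjoint z by blast
  qed
qed

lemma beyond_bounded_iff: "\<bar>\<sigma>\<bar> = 1 \<Longrightarrow> bounded (beyond \<sigma> e) \<longleftrightarrow> beyond \<sigma> e \<in> PG"
  using beyond(1) by (auto simp: bounded_regions_def)

text \<open>If some route passes beyond \<open>e\<close> on the side \<open>\<sigma>\<close>, points
  close to \<open>e\<close> on that side lie between it and a route through \<open>e\<close>. Their
  component is then trapped in a bounded gap.\<close>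

lemma unbounded_beyond:
  assumes \<sigma>: "\<sigma> = 1 \<or> \<sigma> = -1" and "\<not> bounded (beyond \<sigma> e)" "route G s t R" "X e < x" "x < Y e"
  shows "\<sigma> * (Hgt R x - h e x) \<le> 0"
proof (rule ccontr)
  assume "\<not> ?thesis"
  then have pos: "0 < \<sigma> * (Hgt R x - h e x)" by simp
  have \<sigma>1: "\<bar>\<sigma>\<bar> = 1" using \<sigma> by auto
  obtain S where S: "route G s t S" "e \<in> set S" using route_through by blast
  have hS: "Hgt S x = h e x" using Hgt_on[OF S] assms by simp
  note side = beyond(2)[OF \<sigma>1 assms(4,5)]
  obtain \<tau> where \<tau>: "0 < \<tau>" "\<tau> < \<sigma> * (Hgt R x - h e x)" "(x, h e x + \<sigma> * \<tau>) \<in> beyond \<sigma> e"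
    using side_common_point[OF side side pos] by metis
  have x: "xs < x" "x < xt" using edge_x_range[of e] assms by linarith+
  note conn = in_components_connected[OF beyond(1)[OF \<sigma>1]] in_components_subset[OF beyond(1)[OF \<sigma>1]]
  have "bounded (beyond \<sigma> e)"
  proof (cases "\<sigma> = 1")
    case True
    then have "(x, h e x + \<sigma> * \<tau>) \<in> gap S R" using \<tau> x hS by (auto simp: gap_def)
    then show ?thesis using connected_gap[OF S(1) assms(3) conn \<tau>(3)] bounded_gap[OF S(1) assms(3)]
      by (metis bounded_subset)
  next
    case False
    then have "(x, h e x + \<sigma> * \<tau>) \<in> gap R S" using \<tau> x hS \<sigma> by (auto simp: gap_def)
    then show ?thesis using connected_gap[OF assms(3) S(1) conn \<tau>(3)] bounded_gap[OF assms(3) S(1)]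
      by (metis bounded_subset)
  qed
  then show False using assms(2) by blast
qed

text \<open>The neighbour of \<open>e\<close> as an element of \<open>hat\<close>: an unbounded
  component is replaced by the part of the infinite region on that side.\<close>

definition reg :: "real \<Rightarrow> 'e \<Rightarrow> (real \<times> real) set" where
  "reg \<sigma> e = (if bounded (beyond \<sigma> e) then beyond \<sigma> e else outer \<sigma>)"

lemma reg_in_hat: "\<sigma> = 1 \<or> \<sigma> = -1 \<Longrightarrow> reg \<sigma> e \<in> hat"
  using beyond_bounded_iff[of \<sigma> e] by (auto simp: reg_def hat_eq)

text \<open>In the unbounded case \<open>unbounded_beyond\<close> keeps all routes, hence the whole
  drawing, off the ray beyond \<open>e\<close>.\<close>

lemma reg_side:
  assumes \<sigma>: "\<sigma> = 1 \<or> \<sigma> = -1" and x: "X e < x" "x < Y e"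
  shows "side \<sigma> e x (reg \<sigma> e)"
proof (cases "bounded (beyond \<sigma> e)")
  case True
  then show ?thesis using beyond(2)[of \<sigma> e x] \<sigma> x by (auto simp: reg_def)
next
  case False
  have "(x, h e x + \<sigma> * \<tau>) \<in> outer \<sigma>" if \<tau>: "0 < \<tau>" for \<tau>
    unfolding outer_def
  proof (clarify, intro conjI allI impI notI)
    show "xs < x" "x < xt" using edge_x_range[of e] x by linarith+
    fix \<tau>' :: real assume "0 \<le> \<tau>'" "(x, h e x + \<sigma> * \<tau> + \<sigma> * \<tau>') \<in> D"
    then obtain R where R: "route G s t R" "Hgt R x = h e x + \<sigma> * \<tau> + \<sigma> * \<tau>'"
      using drawing_on_route by metis
    have "\<sigma> * (Hgt R x - h e x) = \<tau> + \<tau>'" using R(2) \<sigma> by auto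
    then show False using unbounded_beyond[OF \<sigma> False R(1) x] \<tau> \<open>0 \<le> \<tau>'\<close> by simp
  qed
  then show ?thesis using False by (auto simp: side_def reg_def intro: exI[of _ 1])
qed

lemma reg_unique:
  assumes "\<sigma> = 1 \<or> \<sigma> = -1" "p \<in> hat" "X e < x" "x < Y e" "side \<sigma> e x p"
  shows "p = reg \<sigma> e"
proof -
  obtain \<tau> where "(x, h e x + \<sigma> * \<tau>) \<in> p" "(x, h e x + \<sigma> * \<tau>) \<in> reg \<sigma> e"
    using side_common_point[OF assms(5) reg_side[OF assms(1,3,4)], of 1] by auto
  then show ?thesis using hat_disjoint[OF assms(2) reg_in_hat[OF assms(1)]] by blast
qed

lemma upper_region_eq: "upper_region G s t pos h e = reg 1 e"
  unfolding upper_region_def directly_above_iff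
proof (rule the_equality)
  obtain x where x: "X e < x" "x < Y e" using dense[OF xc_less[of e]] by auto
  show "reg 1 e \<in> hat \<and> (\<forall>x\<in>{X e<..<Y e}. side 1 e x (reg 1 e))"
    using reg_in_hat reg_side by auto
  show "p = reg 1 e" if "p \<in> hat \<and> (\<forall>x\<in>{X e<..<Y e}. side 1 e x p)" for p
    using reg_unique[OF _ _ x, of 1 p] that x by auto
qed

lemma lower_region_eq: "lower_region G s t pos h e = reg (-1) e"
  unfolding lower_region_def directly_below_iff
proof (rule the_equality)
  obtain x where x: "X e < x" "x < Y e" using dense[OF xc_less[of e]] by auto
  show "reg (-1) e \<in> hat \<and> (\<forall>x\<in>{X e<..<Y e}. side (-1) e x (reg (-1) e))"
    using reg_in_hat reg_side by auto
  show "p = reg (-1) e" if "p \<in> hat \<and> (\<forall>x\<in>{X e<..<Y e}. side (-1) e x p)" for p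
    using reg_unique[OF _ _ x, of "-1" p] that x by auto
qed

lemma region_cover_iff:
  "(p, q) \<in> region_cover G pos h \<longleftrightarrow> p \<in> PG \<and> q \<in> PG \<and> (\<exists>e. reg (-1) e = p \<and> reg 1 e = q)"
proof -
  have "directly_below G pos h p e \<longleftrightarrow> reg (-1) e = p" "directly_above G pos h p e \<longleftrightarrow> reg 1 e = p"
    if "p \<in> PG" for p e
  proof -
    have p: "p \<in> hat" using that by (simp add: hat_eq)
    obtain x where x: "X e < x" "x < Y e" using dense[OF xc_less[of e]] by auto
    show "directly_below G pos h p e \<longleftrightarrow> reg (-1) e = p"
      using reg_unique[OF _ p x, of "-1"] reg_side[of "-1" e] x by (auto simp: directly_below_iff)
    show "directly_above G pos h p e \<longleftrightarrow> reg 1 e = p"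
      using reg_unique[OF _ p x, of 1] reg_side[of 1 e] x by (auto simp: directly_above_iff)
  qed
  then show ?thesis by (auto simp: region_cover_def arcs_UNIV)
qed

lemma bounded_region_reg:
  assumes "p \<in> PG" "\<sigma> = 1 \<or> \<sigma> = -1"
  obtains e where "reg \<sigma> e = p"
proof -
  obtain x y where "\<And>\<sigma>. \<bar>\<sigma>\<bar> = 1 \<Longrightarrow> \<exists>e. X e < x \<and> x < Y e \<and> 0 < \<sigma> * (h e x - y) \<and> beyond (- \<sigma>) e = p"
    using bounded_region_edges[OF assms(1)] by metis
  \<comment> \<open>The ray is followed in direction \<open>- \<sigma>\<close>: an edge hit there
    has the region on its side \<open>\<sigma>\<close>.\<close>
  from this[of "- \<sigma>"] obtain e where "beyond \<sigma> e = p" using assms(2) by auto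
  then have "reg \<sigma> e = p" using assms by (auto simp: reg_def bounded_regions_def)
  then show thesis using that by blast
qed

lemma finite_bounded_regions: "finite PG"
proof (rule finite_subset)
  show "PG \<subseteq> range (reg 1)" using bounded_region_reg[of _ 1] by blast
qed simp

section \<open>Regions above and below a route\<close>

definition lies_above :: "'e list \<Rightarrow> (real \<times> real) set \<Rightarrow> bool" where
  "lies_above R p \<longleftrightarrow> (\<forall>(x, y)\<in>p. Hgt R x < y)"

text \<open>A bounded region is connected and misses the drawing, so it cannot meet both the open
  set above and the open set below the graph of \<open>R\<close>. For the outer parts this is
  \<open>outer_off_route\<close>.\<close>

lemma hat_above_or_below:
  assumes R: "route G s t R" and p: "p \<in> hat"
  shows "(\<forall>(x, y)\<in>p. xs < x \<and> x < xt \<and> Hgt R x < y) \<or> (\<forall>(x, y)\<in>p. xs < x \<and> x < xt \<and> y < Hgt R x)"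
proof -
  consider "p \<in> PG" | "p = outer 1" | "p = outer (-1)" using p hat_eq by auto
  then show ?thesis
  proof cases
    case 1
    obtain P Q where PQ: "p \<subseteq> gap P Q" using bounded_region_gap[OF 1] by metis
    have c: "connected p" "p \<subseteq> - D"
      using 1 in_components_connected[of p "- D"] in_components_subset[of p "- D"] by (auto simp: bounded_regions_def)
    let ?U = "{z. Hgt R (fst z) < snd z}" and ?V = "{z. snd z < Hgt R (fst z)}"
    have "open ?U" "open ?V"
      by (intro open_Collect_less continuous_Hgt_fst[OF R] continuous_on_snd[OF continuous_on_id])+
    moreover have "p \<subseteq> ?U \<union> ?V"
    proof
      fix z assume z: "z \<in> p"
      then have "fst z \<in> {xs<..<xt}" using PQ by (auto simp: gap_def)
      then have "(fst z, Hgt R (fst z)) \<in> D" using Hgt_in_drawing[OF R, of "fst z"] by simp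
      then have "snd z \<noteq> Hgt R (fst z)" using z c(2) by (metis ComplD prod.collapse subsetD)
      then show "z \<in> ?U \<union> ?V" by auto
    qed
    moreover have "?U \<inter> ?V \<inter> p = {}" by auto
    ultimately have "?U \<inter> p = {} \<or> ?V \<inter> p = {}" using connectedD[OF c(1), of ?U ?V] by blast
    then have "p \<subseteq> ?U \<or> p \<subseteq> ?V" using \<open>p \<subseteq> ?U \<union> ?V\<close> by blast
    then show ?thesis using PQ by (fastforce simp: gap_def)
  next
    case 2
    then show ?thesis using outer_off_route[OF R, of _ _ 1] by (auto simp: outer_def)
  next
    case 3
    then show ?thesis using outer_off_route[OF R, of _ _ "-1"] by (auto simp: outer_def)
  qed
qed

lemma above_iff_point:
  assumes "route G s t R" "p \<in> hat" "(x, y) \<in> p"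
  shows "lies_above R p \<longleftrightarrow> Hgt R x < y"
  using hat_above_or_below[OF assms(1,2)] assms(3) unfolding lies_above_def by fastforce

lemma above_reg_on:
  assumes R: "route G s t R" "e \<in> set R" and \<sigma>: "\<sigma> = 1 \<or> \<sigma> = -1"
  shows "lies_above R (reg \<sigma> e) \<longleftrightarrow> \<sigma> = 1"
proof -
  obtain x where x: "X e < x" "x < Y e" using dense[OF xc_less[of e]] by auto
  obtain \<tau> where \<tau>: "0 < \<tau>" "(x, h e x + \<sigma> * \<tau>) \<in> reg \<sigma> e"
    using side_common_point[OF reg_side[OF \<sigma> x] reg_side[OF \<sigma> x], of 1] by auto
  show ?thesis using above_iff_point[OF R(1) reg_in_hat[OF \<sigma>] \<tau>(2)] Hgt_on[OF R, of x] x \<sigma> \<tau>(1) by auto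
qed

lemma Hgt_off:
  assumes R: "route G s t R" "e \<notin> set R" and x: "X e < x" "x < Y e"
  shows "Hgt R x \<noteq> h e x"
proof
  assume eq: "Hgt R x = h e x"
  obtain d where d: "d \<in> set R" "X d < x" "x \<le> Y d"
    using route_left[OF R(1), of x] edge_x_range[of e] x by auto
  then have "h d x = h e x" using Hgt_on[OF R(1), of d x] eq by simp
  then show False using edges_meet_not_interior[of e d x] d R x by auto
qed

text \<open>Points beside \<open>e\<close> that are closer to it than the route is lie on the same
  side of the route as \<open>e\<close> itself, whichever side of \<open>e\<close> they are
  on.\<close>

lemma above_reg_off:
  assumes R: "route G s t R" "e \<notin> set R" and \<sigma>: "\<sigma> = 1 \<or> \<sigma> = -1" and x: "X e < x" "x < Y e"
  shows "lies_above R (reg \<sigma> e) \<longleftrightarrow> Hgt R x < h e x"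
proof -
  have "Hgt R x \<noteq> h e x" by (rule Hgt_off[OF R x])
  then obtain \<tau> where \<tau>: "0 < \<tau>" "\<tau> < \<bar>Hgt R x - h e x\<bar>" "(x, h e x + \<sigma> * \<tau>) \<in> reg \<sigma> e"
    using side_common_point[OF reg_side[OF \<sigma> x] reg_side[OF \<sigma> x], of "\<bar>Hgt R x - h e x\<bar>"] by auto
  show ?thesis using above_iff_point[OF R(1) reg_in_hat[OF \<sigma>] \<tau>(3)] \<sigma> \<tau>(1,2) by (auto simp: abs_if split: if_splits)
qed

text \<open>Crossing an edge upwards passes from below to above \<open>R\<close> exactly when the
  edge belongs to \<open>R\<close>. As an equation of 0/1 values this can be summed over routes with
  any coefficients: the edge indicator of a route is the jump of its position function.\<close>

lemma above_upper_lower: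
  assumes "route G s t R"
  shows "of_bool (lies_above R (reg 1 e)) = of_bool (lies_above R (reg (-1) e)) + (of_bool (e \<in> set R) :: 'a::semiring_1)"
proof (cases "e \<in> set R")
  case True
  then show ?thesis using above_reg_on[OF assms True, of 1] above_reg_on[OF assms True, of "-1"] by auto
next
  case False
  obtain x where x: "X e < x" "x < Y e" using dense[OF xc_less[of e]] by auto
  show ?thesis using above_reg_off[OF assms False _ x, of 1] above_reg_off[OF assms False _ x, of "-1"] False by auto
qed

lemma hat_nonempty:
  assumes "p \<in> hat"
  shows "p \<noteq> {}"
proof -
  consider "p \<in> PG" | \<sigma> where "\<sigma> = 1 \<or> \<sigma> = -1" "p = outer \<sigma>" using assms hat_eq by auto
  then show ?thesis
  proof cases
    case 1
    then show ?thesis using in_components_nonempty by (auto simp: bounded_regions_def)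
  next
    case 2
    obtain x where x: "xs < x" "x < xt" using dense[OF xs_less_xt] by auto
    \<comment> \<open>The maximum includes edges that do not lie over \<open>x\<close>, whose
      heights there are arbitrary; only an upper bound matters.\<close>
    define M where "M = Max (range (\<lambda>e. \<sigma> * h e x))"
    have M: "\<sigma> * h e x \<le> M" for e unfolding M_def by (rule Max_ge) auto
    have "(x, \<sigma> * (M + 1) + \<sigma> * \<tau>) \<notin> D" if "\<tau> \<ge> 0" for \<tau>
    proof
      assume "(x, \<sigma> * (M + 1) + \<sigma> * \<tau>) \<in> D"
      then obtain e where "h e x = \<sigma> * (M + 1) + \<sigma> * \<tau>" by (auto simp: mem_drawing)
      then have "\<sigma> * h e x = M + 1 + \<tau>" using 2(1) by auto
      then show False using M[of e] that by linarith
    qed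
    then have "(x, \<sigma> * (M + 1)) \<in> p" using 2 x by (auto simp: outer_def)
    then show ?thesis by blast
  qed
qed

lemma above_outer:
  assumes "route G s t R"
  shows "lies_above R (outer 1)" "\<not> lies_above R (outer (-1))"
proof -
  show "lies_above R (outer 1)"
    using outer_off_route[OF assms, of _ _ 1] by (auto simp: lies_above_def)
  have hat: "outer (-1) \<in> hat" by (simp add: hat_eq)
  then obtain x y where xy: "(x, y) \<in> outer (-1)" using hat_nonempty by fastforce
  then show "\<not> lies_above R (outer (-1))"
    using outer_off_route[OF assms xy] above_iff_point[OF assms hat xy] by simp
qed

lemma outer_distinct: "outer 1 \<noteq> outer (-1)"
  using above_outer route_through by metis

lemma outer_unbounded_region: "\<sigma> = 1 \<or> \<sigma> = -1 \<Longrightarrow> outer \<sigma> \<notin> PG"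
  using hat_nonempty[of "outer \<sigma>"] bounded_not_outer[of "outer \<sigma>" _ \<sigma>] by (auto simp: hat_eq)

text \<open>The direction \<open>\<rho>\<close> is \<open>1\<close> for outgoing and \<open>-1\<close> for incoming edges.\<close>

definition arcs_at :: "real \<Rightarrow> 'v \<Rightarrow> 'e set" where
  "arcs_at \<rho> v = (if \<rho> = 1 then out_arcs G v else in_arcs G v)"

section \<open>The regions around a vertex\<close>

lemma no_crossing:
  assumes z: "X e < z" "z < Y e" "X d < z" "z < Y d" "h e z < h d z"
    and x: "X e < x" "x < Y e" "X d < x" "x < Y d"
  shows "h e x < h d x"
proof (rule ccontr)
  assume "\<not> h e x < h d x"
  then have neg: "h d x - h e x \<le> 0" by simp
  have "e \<noteq> d" using z by auto
  have cont: "continuous_on {a..b} (\<lambda>w. h d w - h e w)" if "{a..b} \<subseteq> {X e<..<Y e} \<inter> {X d<..<Y d}" for a b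
  proof (intro continuous_on_diff continuous_on_subset[OF h_continuous])
    show "{a..b} \<subseteq> {X e..Y e}" "{a..b} \<subseteq> {X d..Y d}" using that by fastforce+
  qed
  have "\<exists>w. X e < w \<and> w < Y e \<and> X d < w \<and> w < Y d \<and> h d w - h e w = 0"
  proof (cases "x \<le> z")
    case True
    have "{x..z} \<subseteq> {X e<..<Y e} \<inter> {X d<..<Y d}" using x z by auto
    then obtain w where "x \<le> w" "w \<le> z" "h d w - h e w = 0"
      using IVT'[OF neg _ True cont] z by auto
    then show ?thesis using x z by (intro exI[of _ w]) auto
  next
    case False
    have "{z..x} \<subseteq> {X e<..<Y e} \<inter> {X d<..<Y d}" using x z by auto
    then obtain w where "z \<le> w" "w \<le> x" "h d w - h e w = 0"
      using IVT2'[OF neg _ _ cont, of z] z False by auto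
    then show ?thesis using x z by (intro exI[of _ w]) auto
  qed
  then obtain w where "X e < w" "w < Y e" "X d < w" "w < Y d" "h d w = h e w" by auto
  then show False using open_edges_disjoint[OF \<open>e \<noteq> d\<close>, of w] by simp
qed

text \<open>Edges not incident with \<open>v\<close> stay away from its position. Within the box the
  incident edges span the full width on their side of \<open>v\<close>, and their heights use only
  half of the vertical size, which leaves room for offsets.\<close>

lemma vertex_box:
  assumes v: "v \<in> verts G"
  obtains \<delta> \<epsilon> where "0 < \<delta>" "0 < \<epsilon>"
    "\<And>x y. \<bar>x - fst (pos v)\<bar> < \<delta> \<Longrightarrow> \<bar>y - snd (pos v)\<bar> < \<epsilon> \<Longrightarrow> (x, y) \<in> D \<Longrightarrow>
      \<exists>e. (tail G e = v \<or> head G e = v) \<and> X e \<le> x \<and> x \<le> Y e \<and> h e x = y"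
    "\<And>e x. tail G e = v \<Longrightarrow> fst (pos v) < x \<Longrightarrow> x < fst (pos v) + \<delta> \<Longrightarrow> x < Y e"
    "\<And>e x. head G e = v \<Longrightarrow> fst (pos v) - \<delta> < x \<Longrightarrow> x < fst (pos v) \<Longrightarrow> X e < x"
    "\<And>e x. tail G e = v \<or> head G e = v \<Longrightarrow> X e \<le> x \<Longrightarrow> x \<le> Y e \<Longrightarrow> \<bar>x - fst (pos v)\<bar> < \<delta> \<Longrightarrow>
      \<bar>h e x - snd (pos v)\<bar> < \<epsilon> / 2"
proof -
  let ?I = "{e. tail G e = v \<or> head G e = v}"
  have op: "open (- (\<Union>d\<in>-?I. closed_edge d))" using closed_closed_edge by (auto intro!: open_Compl)
  have off: "pos v \<in> - (\<Union>d\<in>-?I. closed_edge d)"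
  proof (rule ComplI)
    assume "pos v \<in> (\<Union>d\<in>-?I. closed_edge d)"
    then obtain d where d: "d \<notin> ?I" "pos v \<in> closed_edge d" by blast
    then have *: "X d \<le> fst (pos v)" "fst (pos v) \<le> Y d" "h d (fst (pos v)) = snd (pos v)"
      by (auto simp: closed_edge_def)
    then have "fst (pos v) = X d \<or> fst (pos v) = Y d"
      using vertex_off_open_edge[OF v, of d] by linarith
    then show False
    proof
      assume eq: "fst (pos v) = X d"
      then have "snd (pos v) = snd (pos (tail G d))" using *(3) h_tail[of d] by simp
      then show False using pos_inj[OF v _ eq] d(1) by simp
    next
      assume eq: "fst (pos v) = Y d"
      then have "snd (pos v) = snd (pos (head G d))" using *(3) h_head[of d] by simp
      then show False using pos_inj[OF v _ eq] d(1) by simp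
    qed
  qed
  obtain r where r: "r > 0" "ball (pos v) r \<subseteq> - (\<Union>d\<in>-?I. closed_edge d)"
    using openE[OF op off] by blast
  have "\<exists>d. 0 < d \<and> (\<forall>x. e \<in> ?I \<longrightarrow> X e \<le> x \<longrightarrow> x \<le> Y e \<longrightarrow> \<bar>x - fst (pos v)\<bar> < d \<longrightarrow> \<bar>h e x - snd (pos v)\<bar> < r / 4)" for e
  proof (cases "e \<in> ?I")
    case True
    have "fst (pos v) \<in> {X e..Y e}" "h e (fst (pos v)) = snd (pos v)"
      using True h_tail[of e] h_head[of e] xc_less[of e] by auto
    then show ?thesis using h_continuous[of e, unfolded continuous_on_iff, rule_format, of "fst (pos v)" "r / 4"] r(1)
      by (auto simp: dist_real_def)
  qed (auto intro: exI[of _ 1])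
  then have "\<exists>dd. \<forall>e. 0 < dd e \<and> (\<forall>x. e \<in> ?I \<longrightarrow> X e \<le> x \<longrightarrow> x \<le> Y e \<longrightarrow>
      \<bar>x - fst (pos v)\<bar> < dd e \<longrightarrow> \<bar>h e x - snd (pos v)\<bar> < r / 4)"
    by (intro choice allI)
  then obtain dd where dd: "\<And>e. dd e > 0" "\<And>e x. e \<in> ?I \<Longrightarrow> X e \<le> x \<Longrightarrow> x \<le> Y e \<Longrightarrow>
      \<bar>x - fst (pos v)\<bar> < dd e \<Longrightarrow> \<bar>h e x - snd (pos v)\<bar> < r / 4"
    by blast
  \<comment> \<open>Small enough for the continuity of all incident edges and for the ball of radius
    \<open>r\<close>, and at most the width of any edge.\<close>
  define \<delta> where "\<delta> = Min (insert (r / 2) (range (\<lambda>e. min (dd e) (Y e - X e))))"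
  let ?M = "insert (r / 2) (range (\<lambda>e. min (dd e) (Y e - X e)))"
  have "\<delta> \<le> min (dd e) (Y e - X e)" for e unfolding \<delta>_def by (rule Min_le) auto
  then have \<delta>: "\<delta> \<le> dd e" "\<delta> \<le> Y e - X e" for e by simp_all
  have \<delta>r: "\<delta> \<le> r / 2" unfolding \<delta>_def by (rule Min_le) auto
  have "0 < m" if "m \<in> ?M" for m using that r(1) dd(1) xc_less by auto
  moreover have "\<delta> \<in> ?M" unfolding \<delta>_def by (rule Min_in) auto
  ultimately have "\<delta> > 0" by blast
  show thesis
  proof (rule that[of \<delta> "r / 2"])
    fix x y assume *: "\<bar>x - fst (pos v)\<bar> < \<delta>" "\<bar>y - snd (pos v)\<bar> < r / 2" "(x, y) \<in> D"
    obtain e where e: "X e \<le> x" "x \<le> Y e" "h e x = y" using iffD1[OF mem_drawing *(3)] by blast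
    have "dist (x, y) (pos v) < r"
      using dist_pair_le[of x y "fst (pos v)" "snd (pos v)"] * \<delta>r by simp
    then have "(x, y) \<notin> (\<Union>d\<in>-?I. closed_edge d)" using r(2) by (force simp: dist_commute)
    moreover have "(x, y) \<in> closed_edge e" using e by (auto simp: closed_edge_def)
    ultimately show "\<exists>e. (tail G e = v \<or> head G e = v) \<and> X e \<le> x \<and> x \<le> Y e \<and> h e x = y"
      using e by blast
  next
    show "x < Y e" if "tail G e = v" "fst (pos v) < x" "x < fst (pos v) + \<delta>" for e x
      using that \<delta>(2)[of e] by auto
    show "X e < x" if "head G e = v" "fst (pos v) - \<delta> < x" "x < fst (pos v)" for e x
      using that \<delta>(2)[of e] by auto
    show "\<bar>h e x - snd (pos v)\<bar> < r / 2 / 2"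
      if "tail G e = v \<or> head G e = v" "X e \<le> x" "x \<le> Y e" "\<bar>x - fst (pos v)\<bar> < \<delta>" for e x
      using dd(2)[of e x] that \<delta>(1)[of e] by simp
  qed (use r \<open>\<delta> > 0\<close> in auto)
qed

lemma strip_in_component:
  assumes "connected A" "A \<noteq> {}" "continuous_on A a" "continuous_on A b" "0 < d"
    and "\<And>x \<tau>. x \<in> A \<Longrightarrow> 0 < \<tau> \<Longrightarrow> \<tau> < d \<Longrightarrow> (x, a x + \<tau> * b x) \<notin> D"
  obtains c where "c \<in> components (- D)"
    "\<And>x \<tau>. x \<in> A \<Longrightarrow> 0 < \<tau> \<Longrightarrow> \<tau> < d \<Longrightarrow> (x, a x + \<tau> * b x) \<in> c"
proof -
  let ?S = "(\<lambda>(x, \<tau>). (x, a x + \<tau> * b x)) ` (A \<times> {0<..<d})"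
  have conn: "connected ?S" by (rule connected_strip[OF assms(1,3,4)])
  have S: "?S \<subseteq> - D" using assms(6) by auto
  have "A \<times> {0<..<d} \<noteq> {}" using assms(2,5) by (auto simp: Sigma_empty_iff)
  then have "?S \<noteq> {}" by blast
  then have "- D \<noteq> {}" using S by blast
  then obtain c where "c \<in> components (- D)" "?S \<subseteq> c"
    using exists_component_superset[OF S _ conn] by blast
  then show thesis using that by force
qed

text \<open>The strip between the two edges lies in one component, which is above \<open>e\<close>
  and below \<open>d\<close>. It is bounded because a route through \<open>d\<close> passes above
  \<open>e\<close>.\<close>

lemma consecutive_regions:
  assumes I: "connected I" "x1 \<in> I" "\<And>x. x \<in> I \<Longrightarrow> X e < x \<and> x < Y e \<and> X d < x \<and> x < Y d"
    and less: "h e x1 < h d x1"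
    and off: "\<And>x y. x \<in> I \<Longrightarrow> h e x < y \<Longrightarrow> y < h d x \<Longrightarrow> (x, y) \<notin> D"
  shows "reg 1 e = reg (-1) d"
proof -
  have sub: "I \<subseteq> {X e..Y e}" "I \<subseteq> {X d..Y d}" using I(3) by (fastforce intro: less_imp_le)+
  have lt: "h e x < h d x" if "x \<in> I" for x
    using no_crossing[of e x1 d x] I(3)[OF that] I(3)[OF I(2)] less by blast
  have "(x, h e x + \<tau> * (h d x - h e x)) \<notin> D" if "x \<in> I" "0 < \<tau>" "\<tau> < 1" for x \<tau>
  proof (rule off[OF that(1)])
    have "\<tau> * (h d x - h e x) < 1 * (h d x - h e x)" using that(3) lt[OF that(1)] by (intro mult_strict_right_mono) auto
    then show "h e x + \<tau> * (h d x - h e x) < h d x" by simp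
  qed (use that lt in auto)
  then obtain c where c: "c \<in> components (- D)"
    "\<And>x \<tau>. x \<in> I \<Longrightarrow> 0 < \<tau> \<Longrightarrow> \<tau> < 1 \<Longrightarrow> (x, h e x + \<tau> * (h d x - h e x)) \<in> c"
    using strip_in_component[OF I(1) _ continuous_on_subset[OF h_continuous sub(1)]
        continuous_on_diff[OF continuous_on_subset[OF h_continuous sub(2)] continuous_on_subset[OF h_continuous sub(1)]], of 1]
      I(2) by (metis empty_iff zero_less_one)
  define L where "L = h d x1 - h e x1"
  have L: "L > 0" using less by (simp add: L_def)
  have mem: "(x1, h e x1 + \<tau>) \<in> c" if "0 < \<tau>" "\<tau> < L" for \<tau>
    using c(2)[OF I(2), of "\<tau> / L"] that L by (simp add: L_def[symmetric])
  have "side 1 e x1 c" unfolding side_def using mem L by (intro exI[of _ L]) auto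
  moreover have "side (-1) d x1 c" unfolding side_def
  proof (intro exI[of _ L] conjI allI impI)
    fix \<tau> assume "0 < \<tau> \<and> \<tau> < L"
    then show "(x1, h d x1 + - 1 * \<tau>) \<in> c" using mem[of "L - \<tau>"] by (simp add: L_def algebra_simps)
  qed (rule L)
  ultimately have eq: "c = beyond 1 e" "c = beyond (-1) d"
    using beyond_unique[of 1 c e x1] beyond_unique[of "-1" c d x1] c(1) I(3)[OF I(2)] by auto
  have "bounded c"
  proof (rule ccontr)
    assume "\<not> bounded c"
    obtain R where R: "route G s t R" "d \<in> set R" using route_through by blast
    then show False
      using unbounded_beyond[of 1 e R x1] \<open>\<not> bounded c\<close> eq(1) I(3)[OF I(2)] Hgt_on[OF R, of x1] less by auto
  qed
  then show ?thesis using eq by (simp add: reg_def)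
qed

text \<open>A strip beside the path formed by \<open>d\<close> and \<open>e\<close> passes over or
  under \<open>v\<close> without meeting the drawing, so it lies in one component that borders both
  edges.\<close>

lemma extreme_regions:
  assumes v: "fst (pos v) = xv" "snd (pos v) = yv" and e: "tail G e = v" "head G d = v"
    and \<sigma>: "\<sigma> = 1 \<or> \<sigma> = -1" and \<eta>: "0 < \<eta>" "0 < \<epsilon>" "xv + \<eta> < Y e" "X d < xv - \<eta>"
    and off: "\<And>x \<tau>. xv - \<eta> \<le> x \<Longrightarrow> x \<le> xv + \<eta> \<Longrightarrow> 0 < \<tau> \<Longrightarrow> \<tau> < \<epsilon> \<Longrightarrow>
      (x, (if x \<le> xv then h d x else h e x) + \<tau> * \<sigma>) \<notin> D"
  shows "reg \<sigma> e = reg \<sigma> d"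
proof -
  have *: "X e = xv" "Y d = xv" "h e xv = yv" "h d xv = yv" using v e h_tail[of e] h_head[of d] by auto
  have eq: "{xv - \<eta>..xv + \<eta>} = {xv - \<eta>..xv} \<union> {xv..xv + \<eta>}" using \<eta> by auto
  have cont: "continuous_on {xv - \<eta>..xv + \<eta>} (\<lambda>x. if x \<le> xv then h d x else h e x)"
    unfolding eq
    by (rule continuous_on_If) (use * \<eta> in \<open>auto intro!: continuous_on_subset[OF h_continuous]\<close>)
  have conn: "connected {xv - \<eta>..xv + \<eta>}" and ne: "{xv - \<eta>..xv + \<eta>} \<noteq> {}" using \<eta> by auto
  obtain c where c: "c \<in> components (- D)"
    "\<And>x \<tau>. x \<in> {xv - \<eta>..xv + \<eta>} \<Longrightarrow> 0 < \<tau> \<Longrightarrow> \<tau> < \<epsilon> \<Longrightarrow> (x, (if x \<le> xv then h d x else h e x) + \<tau> * \<sigma>) \<in> c"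
    using strip_in_component[OF conn ne cont continuous_on_const \<eta>(2), of \<sigma>] off
    by (metis (no_types, lifting) atLeastAtMost_iff)
  have "side \<sigma> e (xv + \<eta>) c" unfolding side_def
    using c(2)[of "xv + \<eta>"] \<eta> by (intro exI[of _ \<epsilon>]) (auto simp: mult.commute)
  moreover have "side \<sigma> d (xv - \<eta>) c" unfolding side_def
    using c(2)[of "xv - \<eta>"] \<eta> by (intro exI[of _ \<epsilon>]) (auto simp: mult.commute)
  ultimately have "c = beyond \<sigma> e" "c = beyond \<sigma> d"
    using beyond_unique[of \<sigma> c e "xv + \<eta>"] beyond_unique[of \<sigma> c d "xv - \<eta>"] c(1) \<sigma> * \<eta> by auto
  then show ?thesis by (simp add: reg_def)
qed

text \<open>This is all the local geometry that sums over the edges at a vertex need.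
  \<open>\<kappa>\<close> is the height of an edge at a small distance from \<open>v\<close>, on the
  right for \<open>\<rho> = 1\<close> and on the left for \<open>\<rho> = -1\<close>; the sign
  \<open>\<sigma>\<close> treats topmost and bottommost edges together.\<close>

lemma vertex_structure:
  assumes v: "v \<in> verts G"
  obtains \<kappa> :: "real \<Rightarrow> 'e \<Rightarrow> real" where
    "\<And>\<rho>. \<rho> = 1 \<or> \<rho> = -1 \<Longrightarrow> inj_on (\<kappa> \<rho>) (arcs_at \<rho> v)"
    "\<And>\<rho> e d. \<rho> = 1 \<or> \<rho> = -1 \<Longrightarrow> e \<in> arcs_at \<rho> v \<Longrightarrow> d \<in> arcs_at \<rho> v \<Longrightarrow> \<kappa> \<rho> e < \<kappa> \<rho> d \<Longrightarrow>
      (\<And>c. c \<in> arcs_at \<rho> v \<Longrightarrow> \<not> (\<kappa> \<rho> e < \<kappa> \<rho> c \<and> \<kappa> \<rho> c < \<kappa> \<rho> d)) \<Longrightarrow> reg 1 e = reg (-1) d"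
    "\<And>\<sigma> e d. \<sigma> = 1 \<or> \<sigma> = -1 \<Longrightarrow> e \<in> arcs_at 1 v \<Longrightarrow> d \<in> arcs_at (-1) v \<Longrightarrow>
      (\<And>c. c \<in> arcs_at 1 v \<Longrightarrow> \<sigma> * \<kappa> 1 c \<le> \<sigma> * \<kappa> 1 e) \<Longrightarrow>
      (\<And>c. c \<in> arcs_at (-1) v \<Longrightarrow> \<sigma> * \<kappa> (-1) c \<le> \<sigma> * \<kappa> (-1) d) \<Longrightarrow> reg \<sigma> e = reg \<sigma> d"
    "\<And>\<sigma> e. v = s \<Longrightarrow> \<sigma> = 1 \<or> \<sigma> = -1 \<Longrightarrow> e \<in> arcs_at 1 v \<Longrightarrow>
      (\<And>c. c \<in> arcs_at 1 v \<Longrightarrow> \<sigma> * \<kappa> 1 c \<le> \<sigma> * \<kappa> 1 e) \<Longrightarrow> reg \<sigma> e = outer \<sigma>"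
proof -
  define xv yv where "xv = fst (pos v)" and "yv = snd (pos v)"
  obtain \<delta> \<epsilon> where \<delta>: "0 < \<delta>" "0 < \<epsilon>"
    and box: "\<And>x y. \<bar>x - xv\<bar> < \<delta> \<Longrightarrow> \<bar>y - yv\<bar> < \<epsilon> \<Longrightarrow> (x, y) \<in> D \<Longrightarrow>
      \<exists>e. (tail G e = v \<or> head G e = v) \<and> X e \<le> x \<and> x \<le> Y e \<and> h e x = y"
    and out: "\<And>e x. tail G e = v \<Longrightarrow> xv < x \<Longrightarrow> x < xv + \<delta> \<Longrightarrow> x < Y e"
    and inc: "\<And>e x. head G e = v \<Longrightarrow> xv - \<delta> < x \<Longrightarrow> x < xv \<Longrightarrow> X e < x"
    and near: "\<And>e x. tail G e = v \<or> head G e = v \<Longrightarrow> X e \<le> x \<Longrightarrow> x \<le> Y e \<Longrightarrow> \<bar>x - xv\<bar> < \<delta> \<Longrightarrow>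
      \<bar>h e x - yv\<bar> < \<epsilon> / 2"
    by (rule vertex_box[OF v, folded xv_def yv_def], rule that)
  define \<eta> where "\<eta> = \<delta> / 2"
  have \<eta>: "0 < \<eta>" "\<eta> < \<delta>" using \<delta>(1) by (auto simp: \<eta>_def)
  define I where "I \<rho> = (if \<rho> = 1 then {xv<..<xv + \<delta>} else {xv - \<delta><..<xv})" for \<rho> :: real
  define x1 where "x1 \<rho> = xv + \<rho> * \<eta>" for \<rho> :: real
  define \<kappa> where "\<kappa> \<rho> e = h e (x1 \<rho>)" for \<rho> e
  have I: "connected (I \<rho>)" "\<rho> = 1 \<or> \<rho> = -1 \<Longrightarrow> x1 \<rho> \<in> I \<rho>" for \<rho> using \<eta> by (auto simp: I_def x1_def)
  have I_span: "X e < x \<and> x < Y e" if "x \<in> I \<rho>" "e \<in> arcs_at \<rho> v" for e x \<rho>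
    using that out[of e x] inc[of e x] by (auto simp: I_def arcs_at_def xv_def split: if_splits)
  have I_near: "\<bar>x - xv\<bar> < \<delta>" if "x \<in> I \<rho>" for x \<rho> using that \<delta>(1) by (auto simp: I_def split: if_splits)
  have incident: "tail G e = v \<or> head G e = v" if "e \<in> arcs_at \<rho> v" for e \<rho>
    using that by (auto simp: arcs_at_def split: if_splits)
  have arcs_I: "e \<in> arcs_at \<rho> v" if "tail G e = v \<or> head G e = v" "X e \<le> x" "x \<le> Y e" "x \<in> I \<rho>" for e x \<rho>
    using that xc_less[of e] by (auto simp: I_def arcs_at_def xv_def split: if_splits)
  \<comment> \<open>Edges do not cross, so their order at the single abscissa
    \<open>x1 \<rho>\<close> holds over all of \<open>I \<rho>\<close>.\<close>
  have order: "\<sigma> * h c x \<le> \<sigma> * h e x"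
    if "\<rho> = 1 \<or> \<rho> = -1" "\<sigma> = 1 \<or> \<sigma> = -1" "e \<in> arcs_at \<rho> v" "c \<in> arcs_at \<rho> v" "\<sigma> * \<kappa> \<rho> c \<le> \<sigma> * \<kappa> \<rho> e" "x \<in> I \<rho>"
    for e c \<rho> \<sigma> x
  proof (rule ccontr)
    assume "\<not> \<sigma> * h c x \<le> \<sigma> * h e x"
    then show False
      using no_crossing[of e x c "x1 \<rho>"] no_crossing[of c x e "x1 \<rho>"] that
        I_span[of x \<rho> e] I_span[of x \<rho> c] I_span[of "x1 \<rho>" \<rho> e] I_span[of "x1 \<rho>" \<rho> c] I(2)[of \<rho>]
      by (auto simp: \<kappa>_def)
  qed
  show thesis
  proof (rule that[of \<kappa>])
    show "inj_on (\<kappa> \<rho>) (arcs_at \<rho> v)" if \<rho>: "\<rho> = 1 \<or> \<rho> = -1" for \<rho>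
    proof (rule inj_onI, rule ccontr)
      fix e d assume "e \<in> arcs_at \<rho> v" "d \<in> arcs_at \<rho> v" "\<kappa> \<rho> e = \<kappa> \<rho> d" "e \<noteq> d"
      then show False using open_edges_disjoint[of e d "x1 \<rho>"] I_span[OF I(2)[OF \<rho>]] by (simp add: \<kappa>_def)
    qed
  next
    fix \<rho> :: real and e d
    assume \<rho>: "\<rho> = 1 \<or> \<rho> = -1" and ed: "e \<in> arcs_at \<rho> v" "d \<in> arcs_at \<rho> v" "\<kappa> \<rho> e < \<kappa> \<rho> d"
      and cons: "\<And>c. c \<in> arcs_at \<rho> v \<Longrightarrow> \<not> (\<kappa> \<rho> e < \<kappa> \<rho> c \<and> \<kappa> \<rho> c < \<kappa> \<rho> d)"
    show "reg 1 e = reg (-1) d"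
    proof (rule consecutive_regions[OF I(1) I(2)[OF \<rho>]])
      fix x y assume *: "x \<in> I \<rho>" "h e x < y" "y < h d x"
      show "(x, y) \<notin> D"
      proof
        assume "(x, y) \<in> D"
        have sp: "X e < x" "x < Y e" "X d < x" "x < Y d" using I_span[OF *(1)] ed by auto
        then have "\<bar>h e x - yv\<bar> < \<epsilon> / 2" "\<bar>h d x - yv\<bar> < \<epsilon> / 2"
          using near[of e x] near[of d x] incident[OF ed(1)] incident[OF ed(2)] I_near[OF *(1)] by auto
        then have "\<bar>y - yv\<bar> < \<epsilon>" using * \<delta>(2) by linarith
        then obtain c where c: "tail G c = v \<or> head G c = v" "X c \<le> x" "x \<le> Y c" "h c x = y"
          using box[OF I_near[OF *(1)] _ \<open>(x, y) \<in> D\<close>] by blast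
        then have cv: "c \<in> arcs_at \<rho> v" using arcs_I *(1) by blast
        have "\<kappa> \<rho> e < \<kappa> \<rho> c" "\<kappa> \<rho> c < \<kappa> \<rho> d"
          using no_crossing[of e x c "x1 \<rho>"] no_crossing[of c x d "x1 \<rho>"] sp * c(4)
            I_span[OF *(1) cv] I_span[OF I(2)[OF \<rho>] cv] I_span[OF I(2)[OF \<rho>] ed(1)] I_span[OF I(2)[OF \<rho>] ed(2)]
          by (auto simp: \<kappa>_def)
        then show False using cons[OF cv] by blast
      qed
    qed (use I_span ed in \<open>auto simp: \<kappa>_def\<close>)
  next
    fix \<sigma> :: real and e d
    assume \<sigma>: "\<sigma> = 1 \<or> \<sigma> = -1" and ed: "e \<in> arcs_at 1 v" "d \<in> arcs_at (-1) v"
      and max_e: "\<And>c. c \<in> arcs_at 1 v \<Longrightarrow> \<sigma> * \<kappa> 1 c \<le> \<sigma> * \<kappa> 1 e"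
      and max_d: "\<And>c. c \<in> arcs_at (-1) v \<Longrightarrow> \<sigma> * \<kappa> (-1) c \<le> \<sigma> * \<kappa> (-1) d"
    have e: "tail G e = v" and d: "head G d = v" using ed by (auto simp: arcs_at_def)
    have fs: "fst (pos v) = xv" "snd (pos v) = yv" by (auto simp: xv_def yv_def)
    have ends: "xv + \<eta> < Y e" "X d < xv - \<eta>" using out[OF e, of "xv + \<eta>"] inc[OF d, of "xv - \<eta>"] \<eta> by auto
    show "reg \<sigma> e = reg \<sigma> d"
    proof (rule extreme_regions[OF fs e d \<sigma> \<eta>(1) half_gt_zero[OF \<delta>(2)] ends], rule notI)
      fix x \<tau> assume x: "xv - \<eta> \<le> x" "x \<le> xv + \<eta>" and \<tau>: "0 < \<tau>" "\<tau> < \<epsilon> / 2"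
        and on: "(x, (if x \<le> xv then h d x else h e x) + \<tau> * \<sigma>) \<in> D"
      define f where "f = (if x \<le> xv then d else e)"
      have f: "tail G f = v \<or> head G f = v" "X f \<le> x" "x \<le> Y f"
        using e d x ends by (auto simp: f_def xv_def)
      have x\<delta>: "\<bar>x - xv\<bar> < \<delta>" using x \<eta> by linarith
      have on: "(x, h f x + \<tau> * \<sigma>) \<in> D" using on by (auto simp: f_def split: if_splits)
      have "\<bar>\<tau> * \<sigma>\<bar> < \<epsilon> / 2" using \<tau> \<sigma> by auto
      then have "\<bar>h f x + \<tau> * \<sigma> - yv\<bar> < \<epsilon>" using near[OF f x\<delta>] by linarith
      then obtain c where c: "tail G c = v \<or> head G c = v" "X c \<le> x" "x \<le> Y c" "h c x = h f x + \<tau> * \<sigma>"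
        using box[OF x\<delta> _ on] by blast
      consider "x = xv" | "x > xv" | "x < xv" by linarith
      then show False
      proof cases
        case 1
        then have "h c x = yv" "h f x = yv"
          using c(1) f(1) h_tail h_head by (metis xv_def yv_def)+
        then show False using c(4) \<tau>(1) \<sigma> by auto
      next
        case 2
        then have xI: "x \<in> I 1" "f = e" using x \<eta> by (auto simp: I_def f_def)
        then have "\<sigma> * h c x \<le> \<sigma> * h e x"
          using order[of 1 \<sigma> e c x] \<sigma> ed(1) arcs_I[OF c(1-3)] max_e by auto
        then show False using c(4) \<tau>(1) \<sigma> xI by auto
      next
        case 3
        then have xI: "x \<in> I (-1)" "f = d" using x \<eta> by (auto simp: I_def f_def)
        then have "\<sigma> * h c x \<le> \<sigma> * h d x"
          using order[of "-1" \<sigma> d c x] \<sigma> ed(2) arcs_I[OF c(1-3)] max_d by auto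
        then show False using c(4) \<tau>(1) \<sigma> xI by auto
      qed
    qed
  next
    fix \<sigma> :: real and e
    assume vs: "v = s" and \<sigma>: "\<sigma> = 1 \<or> \<sigma> = -1" and e: "e \<in> arcs_at 1 v"
      and max_e: "\<And>c. c \<in> arcs_at 1 v \<Longrightarrow> \<sigma> * \<kappa> 1 c \<le> \<sigma> * \<kappa> 1 e"
    have x: "X e < x1 1" "x1 1 < Y e" using I_span[OF I(2) e] by auto
    have "(x1 1, h e (x1 1) + \<sigma> * \<tau>) \<in> outer \<sigma>" if \<tau>: "0 < \<tau>" for \<tau>
      unfolding outer_def
    proof (clarify, intro conjI allI impI notI)
      show "xs < x1 1" "x1 1 < xt" using edge_x_range[of e] x by linarith+
      fix \<tau>' :: real assume \<tau>': "0 \<le> \<tau>'" "(x1 1, h e (x1 1) + \<sigma> * \<tau> + \<sigma> * \<tau>') \<in> D"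
      then obtain R where R: "route G s t R" "Hgt R (x1 1) = h e (x1 1) + \<sigma> * \<tau> + \<sigma> * \<tau>'"
        using drawing_on_route by metis
      \<comment> \<open>The route meets this vertical line on its first edge, which leaves
        \<open>s\<close> and hence is not beyond \<open>e\<close>.\<close>
      obtain c R' where cR: "R = c # R'" using route_nonempty[OF R(1)] by (cases R) auto
      then have c: "c \<in> arcs_at 1 v" using R(1) vs by (auto simp: route_def awalk_Cons_iff arcs_at_def)
      have "X c < x1 1" "x1 1 < Y c" using I_span[OF I(2) c] by auto
      then have "Hgt R (x1 1) = h c (x1 1)" using Hgt_on[OF R(1), of c] cR by simp
      then show False using max_e[OF c] R(2) \<sigma> \<tau> \<tau>'(1) by (auto simp: \<kappa>_def)
    qed
    then have "side \<sigma> e (x1 1) (outer \<sigma>)" unfolding side_def by (intro exI[of _ 1]) auto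
    then show "reg \<sigma> e = outer \<sigma>" using reg_unique[OF \<sigma> _ x, of "outer \<sigma>"] \<sigma> by (auto simp: hat_eq)
  qed
qed

lemma finite_arcs_at: "finite (arcs_at \<rho> v)"
  by (rule finite_subset[OF subset_UNIV]) simp

text \<open>Over consecutive edges the jumps of \<open>g\<close> telescope to a difference between
  the regions beyond the extreme edges. At an inner vertex these two regions are the same for
  incoming and outgoing edges; at the source they are the two outer parts.\<close>

lemma potential_at_vertex:
  fixes g :: "(real \<times> real) set \<Rightarrow> 'b::ab_group_add"
  assumes v: "v \<in> verts G"
  defines "S \<rho> \<equiv> \<Sum>e\<in>arcs_at \<rho> v. g (reg 1 e) - g (reg (-1) e)"
  shows "(v \<noteq> s \<and> v \<noteq> t \<longrightarrow> S (-1) = S 1) \<and> (v = s \<longrightarrow> S 1 = g (outer 1) - g (outer (-1)))"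
proof (rule vertex_structure[OF v])
  fix \<kappa> :: "real \<Rightarrow> 'e \<Rightarrow> real"
  assume inj: "\<And>\<rho>. \<rho> = 1 \<or> \<rho> = -1 \<Longrightarrow> inj_on (\<kappa> \<rho>) (arcs_at \<rho> v)"
    and cons: "\<And>\<rho> e d. \<rho> = 1 \<or> \<rho> = -1 \<Longrightarrow> e \<in> arcs_at \<rho> v \<Longrightarrow> d \<in> arcs_at \<rho> v \<Longrightarrow> \<kappa> \<rho> e < \<kappa> \<rho> d \<Longrightarrow>
      (\<And>c. c \<in> arcs_at \<rho> v \<Longrightarrow> \<not> (\<kappa> \<rho> e < \<kappa> \<rho> c \<and> \<kappa> \<rho> c < \<kappa> \<rho> d)) \<Longrightarrow> reg 1 e = reg (-1) d"
    and ext: "\<And>\<sigma> e d. \<sigma> = 1 \<or> \<sigma> = -1 \<Longrightarrow> e \<in> arcs_at 1 v \<Longrightarrow> d \<in> arcs_at (-1) v \<Longrightarrow>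
      (\<And>c. c \<in> arcs_at 1 v \<Longrightarrow> \<sigma> * \<kappa> 1 c \<le> \<sigma> * \<kappa> 1 e) \<Longrightarrow>
      (\<And>c. c \<in> arcs_at (-1) v \<Longrightarrow> \<sigma> * \<kappa> (-1) c \<le> \<sigma> * \<kappa> (-1) d) \<Longrightarrow> reg \<sigma> e = reg \<sigma> d"
    and ext_s: "\<And>\<sigma> e. v = s \<Longrightarrow> \<sigma> = 1 \<or> \<sigma> = -1 \<Longrightarrow> e \<in> arcs_at 1 v \<Longrightarrow>
      (\<And>c. c \<in> arcs_at 1 v \<Longrightarrow> \<sigma> * \<kappa> 1 c \<le> \<sigma> * \<kappa> 1 e) \<Longrightarrow> reg \<sigma> e = outer \<sigma>"
  have ends: "\<exists>m\<in>arcs_at \<rho> v. \<exists>M\<in>arcs_at \<rho> v. (\<forall>c\<in>arcs_at \<rho> v. \<kappa> \<rho> m \<le> \<kappa> \<rho> c \<and> \<kappa> \<rho> c \<le> \<kappa> \<rho> M) \<and>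
    S \<rho> = g (reg 1 M) - g (reg (-1) m)" if \<rho>: "\<rho> = 1 \<or> \<rho> = -1" and ne: "arcs_at \<rho> v \<noteq> {}" for \<rho>
    unfolding S_def
  proof (rule telescoping_sum_consecutive[OF finite_arcs_at ne inj[OF \<rho>]])
    show "g (reg 1 e) = g (reg (-1) d)" if "e \<in> arcs_at \<rho> v" "d \<in> arcs_at \<rho> v" "\<kappa> \<rho> e < \<kappa> \<rho> d"
      "\<And>c. c \<in> arcs_at \<rho> v \<Longrightarrow> \<not> (\<kappa> \<rho> e < \<kappa> \<rho> c \<and> \<kappa> \<rho> c < \<kappa> \<rho> d)" for e d
      using cons[OF \<rho> that] by simp
  qed
  show ?thesis
  proof (cases "v = t")
    case False
    then have "arcs_at 1 v \<noteq> {}" using out_arcs_nonempty[OF v] by (simp add: arcs_at_def)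
    then obtain m M where mM: "m \<in> arcs_at 1 v" "M \<in> arcs_at 1 v"
      "\<And>c. c \<in> arcs_at 1 v \<Longrightarrow> \<kappa> 1 m \<le> \<kappa> 1 c \<and> \<kappa> 1 c \<le> \<kappa> 1 M"
      "S 1 = g (reg 1 M) - g (reg (-1) m)"
      using ends[of 1] by blast
    show ?thesis
    proof (cases "v = s")
      case True
      have "reg 1 M = outer 1" by (rule ext_s[OF True]) (use mM in auto)
      moreover have "reg (-1) m = outer (-1)" by (rule ext_s[OF True]) (use mM in auto)
      ultimately show ?thesis using mM(4) True by simp
    next
      case s: False
      then have "arcs_at (-1) v \<noteq> {}" using in_arcs_nonempty[OF v] by (simp add: arcs_at_def)
      then obtain m' M' where mM': "m' \<in> arcs_at (-1) v" "M' \<in> arcs_at (-1) v"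
        "\<And>c. c \<in> arcs_at (-1) v \<Longrightarrow> \<kappa> (-1) m' \<le> \<kappa> (-1) c \<and> \<kappa> (-1) c \<le> \<kappa> (-1) M'"
        "S (-1) = g (reg 1 M') - g (reg (-1) m')"
        using ends[of "-1"] by blast
      have "reg 1 M = reg 1 M'" by (rule ext) (use mM mM' in auto)
      moreover have "reg (-1) m = reg (-1) m'" by (rule ext) (use mM mM' in auto)
      ultimately show ?thesis using mM(4) mM'(4) s by simp
    qed
  qed (use s_neq_t in auto)
qed

lemma potential_conserved:
  fixes g :: "(real \<times> real) set \<Rightarrow> 'b::ab_group_add"
  assumes "v \<in> inner_verts G s t"
  shows "(\<Sum>e\<in>in_arcs G v. g (reg 1 e) - g (reg (-1) e)) = (\<Sum>e\<in>out_arcs G v. g (reg 1 e) - g (reg (-1) e))"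
  using potential_at_vertex[of v g] assms by (simp add: arcs_at_def inner_verts_def)

lemma potential_value:
  fixes g :: "(real \<times> real) set \<Rightarrow> 'b::ab_group_add"
  shows "(\<Sum>e\<in>out_arcs G s. g (reg 1 e) - g (reg (-1) e)) = g (outer 1) - g (outer (-1))"
  using potential_at_vertex[of s g] by (simp add: arcs_at_def)

section \<open>Ideals of routes and coherence\<close>

definition Fid :: "'e list \<Rightarrow> (real \<times> real) set set" where
  "Fid R = {p \<in> PG. lies_above R p}"

definition route_le :: "'e list \<Rightarrow> 'e list \<Rightarrow> bool" where
  "route_le P Q \<longleftrightarrow> (\<forall>x. xs \<le> x \<longrightarrow> x \<le> xt \<longrightarrow> Hgt P x \<le> Hgt Q x)"

lemma bounded_in_hat: "p \<in> PG \<Longrightarrow> p \<in> hat"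
  by (simp add: hat_eq)

text \<open>If \<open>P\<close> were above \<open>Q\<close> somewhere, a point between them off all
  edges would lie in a component inside \<open>gap Q P\<close>, a bounded region above
  \<open>Q\<close> but below \<open>P\<close>. The inclusion is reversed as lower routes have larger
  ideals.\<close>

lemma Fid_subset_iff:
  assumes P: "route G s t P" and Q: "route G s t Q"
  shows "Fid Q \<subseteq> Fid P \<longleftrightarrow> route_le P Q"
proof
  assume le: "route_le P Q"
  show "Fid Q \<subseteq> Fid P"
  proof
    fix p assume p: "p \<in> Fid Q"
    then have hat: "p \<in> hat" by (auto simp: Fid_def bounded_in_hat)
    obtain x y where xy: "(x, y) \<in> p" using hat_nonempty[OF hat] by fastforce
    then have "xs < x" "x < xt" using hat_above_or_below[OF P hat] by auto
    then have "Hgt P x \<le> Hgt Q x" using le by (auto simp: route_le_def)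
    then show "p \<in> Fid P"
      using p above_iff_point[OF P hat xy] above_iff_point[OF Q hat xy] by (auto simp: Fid_def)
  qed
next
  assume sub: "Fid Q \<subseteq> Fid P"
  show "route_le P Q"
  proof (rule ccontr)
    assume "\<not> route_le P Q"
    then obtain x where x: "xs \<le> x" "x \<le> xt" "Hgt Q x < Hgt P x" by (auto simp: route_le_def not_le)
    then have x': "xs < x" "x < xt"
      using Hgt_s[OF P] Hgt_s[OF Q] Hgt_t[OF P] Hgt_t[OF Q] by (auto simp: order_le_less)
    have "infinite ({Hgt Q x<..<Hgt P x} - range (\<lambda>e. h e x))"
      using x by (intro Diff_infinite_finite infinite_Ioo) auto
    then obtain y where y: "Hgt Q x < y" "y < Hgt P x" "y \<notin> range (\<lambda>e. h e x)"
      by (metis (no_types, lifting) DiffD1 DiffD2 finite.emptyI greaterThanLessThan_iff equals0I)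
    then have "(x, y) \<in> - D" by (auto simp: mem_drawing)
    then obtain c where c: "c \<in> components (- D)" "(x, y) \<in> c" using Union_components[of "- D"] by blast
    have "(x, y) \<in> gap Q P" using x' y by (auto simp: gap_def)
    then have "c \<subseteq> gap Q P"
      by (rule connected_gap[OF Q P in_components_connected[OF c(1)] in_components_subset[OF c(1)] c(2)])
    then have "c \<in> PG" using bounded_subset[OF bounded_gap[OF Q P]] c(1) by (simp add: bounded_regions_def)
    moreover have "c \<in> hat" using \<open>c \<in> PG\<close> by (rule bounded_in_hat)
    ultimately show False
      using sub above_iff_point[OF P _ c(2)] above_iff_point[OF Q _ c(2)] y by (auto simp: Fid_def)
  qed
qed

text \<open>By \<open>no_crossing\<close> any other common x-coordinate gives the same
  answer.\<close>

definition lower :: "'e \<Rightarrow> 'e \<Rightarrow> bool" where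
  "lower e d \<longleftrightarrow> (\<exists>x. X e < x \<and> x < Y e \<and> X d < x \<and> x < Y d \<and> h e x < h d x)"

lemma route_le_not_lower:
  assumes "route G s t P" "route G s t Q" "route_le P Q" "e \<in> set P" "d \<in> set Q"
  shows "\<not> lower d e"
proof
  assume "lower d e"
  then obtain x where x: "X e < x" "x < Y e" "X d < x" "x < Y d" "h d x < h e x" by (auto simp: lower_def)
  then have "Hgt P x \<le> Hgt Q x" using assms(3) edge_x_range[of e] by (auto simp: route_le_def)
  then show False using Hgt_on[OF assms(1,4), of x] Hgt_on[OF assms(2,5), of x] x by simp
qed

text \<open>Only pairs of distinct edges matter in \<open>less_In\<close> and
  \<open>less_Out\<close>, so reflexive pairs are left open.\<close>

definition planar_framing :: "('v \<Rightarrow> 'e rel) \<Rightarrow> ('v \<Rightarrow> 'e rel) \<Rightarrow> bool" where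
  "planar_framing fi fo \<longleftrightarrow>
    (\<forall>v e d. e \<noteq> d \<longrightarrow> ((e, d) \<in> fi v \<longleftrightarrow> head G e = v \<and> head G d = v \<and> lower e d)) \<and>
    (\<forall>v e d. e \<noteq> d \<longrightarrow> ((e, d) \<in> fo v \<longleftrightarrow> tail G e = v \<and> tail G d = v \<and> lower e d))"

lemma less_In_lower:
  assumes "planar_framing fi fo" "less_In G fi p q"
  obtains e d where "e \<in> set p" "d \<in> set q" "lower e d"
  using assms unfolding less_In_def planar_framing_def by fastforce

lemma less_Out_lower:
  assumes "planar_framing fi fo" "less_Out G fo p q"
  obtains e d where "e \<in> set p" "d \<in> set q" "lower e d"
  using assms unfolding less_Out_def planar_framing_def by fastforce

text \<open>Either form of a conflict contains a comparison that puts an edge of \<open>Q\<close>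
  below an edge of \<open>P\<close>, against \<open>route_le P Q\<close>.\<close>

lemma route_le_coherent:
  assumes fr: "planar_framing fi fo" and P: "route G s t P" and Q: "route G s t Q" and le: "route_le P Q"
  shows "coherent G s t fi fo P Q"
  unfolding coherent_def
proof (intro ballI notI)
  fix v assume "conflict_at G s t fi fo P Q v"
  then obtain Pv vP Qv vQ where PQ: "P = Pv @ vP" "Q = Qv @ vQ"
    "less_In G fi Pv Qv \<and> less_Out G fo vQ vP \<or> less_In G fi Qv Pv \<and> less_Out G fo vP vQ"
    by (auto simp: conflict_at_def)
  from PQ(3) consider "less_Out G fo vQ vP" | "less_In G fi Qv Pv" by blast
  then show False
  proof cases
    case 1
    then obtain e d where "e \<in> set vQ" "d \<in> set vP" "lower e d" using less_Out_lower[OF fr] by metis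
    then show False using route_le_not_lower[OF P Q le, of d e] PQ by simp
  next
    case 2
    then obtain e d where "e \<in> set Qv" "d \<in> set Pv" "lower e d" using less_In_lower[OF fr] by metis
    then show False using route_le_not_lower[OF P Q le, of d e] PQ by simp
  qed
qed

lemma conflict_sym: "conflict_at G s t fi fo P Q v \<longleftrightarrow> conflict_at G s t fi fo Q P v"
  unfolding conflict_at_def by blast

lemma coherent_sym: "coherent G s t fi fo P Q \<longleftrightarrow> coherent G s t fi fo Q P"
  unfolding coherent_def using conflict_sym by blast

text \<open>Two different edges leaving the same vertex have different heights over their common
  stretch, so the walks agree edge by edge.\<close>

lemma walks_equal_height:
  assumes P: "route G s t P" and Q: "route G s t Q"
  shows "awalk v M w \<Longrightarrow> awalk v N w \<Longrightarrow> set M \<subseteq> set P \<Longrightarrow> set N \<subseteq> set Q \<Longrightarrow>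
    (\<And>x. fst (pos v) \<le> x \<Longrightarrow> x \<le> fst (pos w) \<Longrightarrow> Hgt P x = Hgt Q x) \<Longrightarrow> M = N"
proof (induction M arbitrary: v N)
  case Nil
  then have "v = w" by (simp add: awalk_Nil_iff)
  then show ?case using awalk_xc_less[OF Nil(2)] by auto
next
  case (Cons e M)
  have e: "tail G e = v" "awalk (head G e) M w" using Cons.prems(1) by (auto simp: awalk_Cons_iff)
  have "N \<noteq> []" using Cons.prems(2) awalk_xc_less[OF Cons.prems(1)] by (auto simp: awalk_Nil_iff)
  then obtain d N' where N: "N = d # N'" by (cases N) auto
  have d: "tail G d = v" "awalk (head G d) N' w" using Cons.prems(2) N by (auto simp: awalk_Cons_iff)
  obtain x where x: "X e < x" "x < Y e" "x < Y d"
    using dense[of "X e" "min (Y e) (Y d)"] xc_less[of e] xc_less[of d] e d by auto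
  have "Hgt P x = h e x" "Hgt Q x = h d x"
    using Hgt_on[OF P, of e x] Hgt_on[OF Q, of d x] Cons.prems(3,4) N x e d by auto
  moreover have "Hgt P x = Hgt Q x"
    using Cons.prems(5)[of x] x e awalk_xc_le[OF e(2)] by auto
  ultimately have "e = d" using open_edges_disjoint[of e d x] x e d by auto
  moreover have "M = N'"
  proof (rule Cons.IH[OF e(2)])
    show "Hgt P x = Hgt Q x" if "Y e \<le> x" "x \<le> fst (pos w)" for x
      using Cons.prems(5)[of x] that xc_less[of e] e by auto
  qed (use Cons.prems N d \<open>e = d\<close> in auto)
  ultimately show ?case using N by simp
qed

lemma route_split_two:
  assumes P: "route G s t P" and e: "e \<in> set P" "d \<in> set P" "Y e \<le> X d"
  obtains p M q where "P = p @ e # M @ d # q" "awalk s p (tail G e)" "awalk (head G e) M (tail G d)"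
    "awalk (head G d) q t"
proof -
  obtain p p2 where p: "P = p @ e # p2" "awalk s p (tail G e)" "awalk (head G e) p2 t"
    using awalk_splitE[of s P t e] P e(1) by (metis route_def)
  have "d \<noteq> e" using e(3) xc_less[of e] by auto
  moreover have "d \<notin> set p"
    using awalk_xc_head[OF p(2), of d] e(3) xc_less[of e] xc_less[of d] by auto
  ultimately have "d \<in> set p2" using e(2) p(1) by auto
  then obtain M q where "p2 = M @ d # q" "awalk (head G e) M (tail G d)" "awalk (head G d) q t"
    using awalk_splitE[OF p(3)] by metis
  then show thesis using that p by blast
qed

text \<open>Where the difference of the heights changes sign, the routes coincide over an interval
  \<open>[a, b]\<close>, possibly a point. They join at \<open>a\<close> with \<open>P\<close>
  coming from below and separate at \<open>b\<close> with \<open>P\<close> leaving above; the walk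
  between is shared, and this is a conflict at its first vertex.\<close>

lemma crossing_conflict:
  assumes fr: "planar_framing fi fo" and P: "route G s t P" and Q: "route G s t Q"
    and x: "xs \<le> x1" "x1 \<le> x2" "x2 \<le> xt" "Hgt P x1 < Hgt Q x1" "Hgt Q x2 < Hgt P x2"
  shows "\<not> coherent G s t fi fo P Q"
proof -
  define f where "f x = Hgt Q x - Hgt P x" for x
  have cont: "continuous_on {x1..x2} f"
    unfolding f_def by (intro continuous_on_diff continuous_Hgt P Q)
  have signs: "0 < f x1" "f x2 < 0" using x by (auto simp: f_def)
  obtain a b where ab: "x1 < a" "a \<le> b" "b < x2" and zero: "\<And>y. a \<le> y \<Longrightarrow> y \<le> b \<Longrightarrow> f y = 0"
    and left: "\<And>\<delta>. 0 < \<delta> \<Longrightarrow> \<exists>y. a - \<delta> < y \<and> y < a \<and> x1 \<le> y \<and> 0 < f y"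
    and right: "\<And>\<delta>. 0 < \<delta> \<Longrightarrow> \<exists>y. b < y \<and> y < b + \<delta> \<and> y \<le> x2 \<and> f y < 0"
    by (rule sign_change_interval[OF cont x(2) signs], rule that)
  have ab': "xs < a" "a \<le> xt" "xs \<le> b" "b < xt" using ab x by auto
  \<comment> \<open>Edges running into \<open>a\<close> and out of \<open>b\<close>: these carry the
    unequal heights immediately outside the interval.\<close>
  obtain e where e: "e \<in> set P" "X e < a" "a \<le> Y e" using route_left[OF P ab'(1,2)] by blast
  obtain d where d: "d \<in> set Q" "X d < a" "a \<le> Y d" using route_left[OF Q ab'(1,2)] by blast
  obtain e' where e': "e' \<in> set P" "X e' \<le> b" "b < Y e'" using route_right[OF P ab'(3,4)] by blast
  obtain d' where d': "d' \<in> set Q" "X d' \<le> b" "b < Y d'" using route_right[OF Q ab'(3,4)] by blast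
  obtain y where y: "a - min (a - X e) (a - X d) < y" "y < a" "0 < f y"
    using left[of "min (a - X e) (a - X d)"] e d by auto
  then have ye: "X e < y" "X d < y" "y < Y e" "y < Y d" using e d by auto
  then have hy: "h e y < h d y" using y(3) Hgt_on[OF P e(1), of y] Hgt_on[OF Q d(1), of y] by (simp add: f_def)
  then have low: "lower e d" using ye by (auto simp: lower_def)
  have ed: "e \<noteq> d" using hy by auto
  have "h e a = h d a" using zero[of a] ab Hgt_on[OF P e(1), of a] Hgt_on[OF Q d(1), of a] e d by (simp add: f_def)
  then have v: "a = Y e" "a = Y d" "head G e = head G d"
    using edges_meet_at_vertex[OF ed, of a] e d by auto
  obtain z where z: "b < z" "z < b + min (Y e' - b) (Y d' - b)" "f z < 0"
    using right[of "min (Y e' - b) (Y d' - b)"] e' d' by auto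
  then have ze: "X e' < z" "X d' < z" "z < Y e'" "z < Y d'" using e' d' by auto
  then have hz: "h d' z < h e' z" using z(3) Hgt_on[OF P e'(1), of z] Hgt_on[OF Q d'(1), of z] by (simp add: f_def)
  then have low': "lower d' e'" using ze by (auto simp: lower_def)
  have ed': "e' \<noteq> d'" using hz by auto
  have "h e' b = h d' b" using zero[of b] ab Hgt_on[OF P e'(1), of b] Hgt_on[OF Q d'(1), of b] e' d' by (simp add: f_def)
  then have w: "b = X e'" "b = X d'" "tail G e' = tail G d'"
    using edges_meet_at_vertex[OF ed', of b] e' d' by auto
  obtain p M p3 where Psplit: "P = p @ e # M @ e' # p3" "awalk s p (tail G e)" "awalk (head G e) M (tail G e')"
    "awalk (head G e') p3 t"
    using route_split_two[OF P e(1) e'(1)] v w ab by metis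
  obtain q N q3 where Qsplit: "Q = q @ d # N @ d' # q3" "awalk s q (tail G d)" "awalk (head G d) N (tail G d')"
    "awalk (head G d') q3 t"
    using route_split_two[OF Q d(1) d'(1)] v w ab by metis
  have "M = N"
  proof (rule walks_equal_height[OF P Q Psplit(3)])
    show "awalk (head G e) N (tail G e')" using Qsplit(3) v w by simp
    show "Hgt P x = Hgt Q x" if "Y e \<le> x" "x \<le> X e'" for x
      using zero[of x] that v w by (simp add: f_def)
  qed (use Psplit Qsplit in auto)
  have "conflict_at G s t fi fo P Q (head G e)"
    unfolding conflict_at_def
  proof (intro exI conjI disjI1)
    show "P = (p @ [e]) @ (M @ e' # p3)" "Q = (q @ [d]) @ (M @ d' # q3)"
      using Psplit Qsplit \<open>M = N\<close> by auto
    show "awalk s (p @ [e]) (head G e)" using Psplit(2) by (rule awalk_appendI) (simp add: awalk_simps)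
    show "awalk s (q @ [d]) (head G e)" unfolding v using Qsplit(2) by (rule awalk_appendI) (simp add: awalk_simps)
    show "awalk (head G e) (M @ e' # p3) t"
      using Psplit(3) by (rule awalk_appendI) (simp add: awalk_simps Psplit(4))
    show "awalk (head G e) (M @ d' # q3) t"
      using Psplit(3) by (rule awalk_appendI) (simp add: awalk_simps Qsplit(4) w)
    have "(e, d) \<in> fi (head G e)" using fr ed low v by (simp add: planar_framing_def)
    then show "less_In G fi (p @ [e]) (q @ [d])" unfolding less_In_def using ed by blast
    have "(d', e') \<in> fo (tail G d')" using fr ed' low' w by (simp add: planar_framing_def)
    then show "less_Out G fo (M @ d' # q3) (M @ e' # p3)" unfolding less_Out_def using ed' by blast
  qed
  moreover have "head G e \<in> inner_verts G s t"
  proof -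
    have "head G e \<noteq> t" using awalk_xc_le[OF Psplit(3)] xc_less[of e'] edge_x_range[of e'] by auto
    then show ?thesis by (simp add: inner_verts_def)
  qed
  ultimately show ?thesis by (auto simp: coherent_def)
qed

lemma coherent_iff_route_le:
  assumes fr: "planar_framing fi fo" and P: "route G s t P" and Q: "route G s t Q"
  shows "coherent G s t fi fo P Q \<longleftrightarrow> route_le P Q \<or> route_le Q P"
proof
  assume "route_le P Q \<or> route_le Q P"
  then show "coherent G s t fi fo P Q"
    using route_le_coherent[OF fr P Q] route_le_coherent[OF fr Q P] coherent_sym by blast
next
  assume coh: "coherent G s t fi fo P Q"
  show "route_le P Q \<or> route_le Q P"
  proof (rule ccontr)
    assume "\<not> ?thesis"
    then obtain x y where x: "xs \<le> x" "x \<le> xt" "Hgt Q x < Hgt P x" and y: "xs \<le> y" "y \<le> xt" "Hgt P y < Hgt Q y"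
      by (auto simp: route_le_def not_le)
    show False
    proof (cases "x \<le> y")
      case True
      then show ?thesis using crossing_conflict[OF fr Q P, of x y] x y coh coherent_sym by blast
    next
      case False
      then show ?thesis using crossing_conflict[OF fr P Q, of y x] x y coh by simp
    qed
  qed
qed

section \<open>The order of the regions and its upper ideals\<close>

abbreviation ordG :: "((real \<times> real) set) rel" where "ordG \<equiv> region_order G pos h"

lemma hat_cases:
  assumes "p \<in> hat"
  obtains "p \<in> PG" | "p = outer (-1)" | "p = outer 1"
  using assms hat_eq by auto

lemma lower_not_top: "reg (-1) e \<noteq> outer 1" and upper_not_bot: "reg 1 e \<noteq> outer (-1)"
proof -
  obtain R where R: "route G s t R" "e \<in> set R" using route_through by blast
  show "reg (-1) e \<noteq> outer 1" using above_reg_on[OF R, of "-1"] above_outer[OF R(1)] by auto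
  show "reg 1 e \<noteq> outer (-1)" using above_reg_on[OF R, of 1] above_outer[OF R(1)] by auto
qed

lemma cover_in_order: "(p, q) \<in> region_cover G pos h \<Longrightarrow> (p, q) \<in> ordG"
  using r_into_rtrancl region_cover_iff[of p q] by (auto simp: region_order_def)

lemma order_in_regions: "(p, q) \<in> ordG \<Longrightarrow> p \<in> PG \<and> q \<in> PG"
  by (auto simp: region_order_def)

lemma order_refl_region: "p \<in> PG \<Longrightarrow> (p, p) \<in> ordG"
  by (auto simp: region_order_def)

lemma order_trans_region: "(p, q) \<in> ordG \<Longrightarrow> (q, r) \<in> ordG \<Longrightarrow> (p, r) \<in> ordG"
  by (auto simp: region_order_def)

lemma order_induct [consumes 1, case_names refl step]:
  assumes "(p, q) \<in> ordG" "Q p"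
    and "\<And>e. reg (-1) e \<in> PG \<Longrightarrow> reg 1 e \<in> PG \<Longrightarrow> (p, reg (-1) e) \<in> ordG \<Longrightarrow> Q (reg (-1) e) \<Longrightarrow> Q (reg 1 e)"
  shows "Q q"
proof -
  have "(p, q) \<in> (region_cover G pos h)\<^sup>*" and p: "p \<in> PG" using assms(1) by (auto simp: region_order_def)
  then show ?thesis
  proof (induction rule: rtrancl_induct)
    case (step y z)
    then obtain e where "reg (-1) e = y" "reg 1 e = z" "y \<in> PG" "z \<in> PG" by (auto simp: region_cover_iff)
    moreover have "(p, y) \<in> ordG" using step(1) p \<open>y \<in> PG\<close> by (simp add: region_order_def)
    ultimately show ?case using assms(3)[of e] step(3) p by simp
  qed (rule assms(2))
qed

lemma upper_ideal_cover_iff: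
  "upper_ideal PG ordG F \<longleftrightarrow> F \<subseteq> PG \<and> (\<forall>e. reg (-1) e \<in> F \<longrightarrow> reg 1 e \<in> PG \<longrightarrow> reg 1 e \<in> F)"
proof
  assume F: "upper_ideal PG ordG F"
  have "reg 1 e \<in> F" if "reg (-1) e \<in> F" "reg 1 e \<in> PG" for e
  proof -
    have "(reg (-1) e, reg 1 e) \<in> ordG"
      using F that by (intro cover_in_order) (auto simp: region_cover_iff upper_ideal_def)
    then show ?thesis using F that by (auto simp: upper_ideal_def)
  qed
  then show "F \<subseteq> PG \<and> (\<forall>e. reg (-1) e \<in> F \<longrightarrow> reg 1 e \<in> PG \<longrightarrow> reg 1 e \<in> F)"
    using F by (auto simp: upper_ideal_def)
next
  assume F: "F \<subseteq> PG \<and> (\<forall>e. reg (-1) e \<in> F \<longrightarrow> reg 1 e \<in> PG \<longrightarrow> reg 1 e \<in> F)"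
  have "q \<in> F" if "(p, q) \<in> ordG" "p \<in> F" for p q
    using that by (induction rule: order_induct) (use F in auto)
  then show "upper_ideal PG ordG F" using F by (auto simp: upper_ideal_def)
qed

text \<open>The indicator of an ideal extended to \<open>hat\<close>, true at the top and, for
  \<open>F \<subseteq> PG\<close>, false at the bottom. Edges on the outer boundary then need no
  separate cases.\<close>

definition mem_hat :: "(real \<times> real) set set \<Rightarrow> (real \<times> real) set \<Rightarrow> bool" where
  "mem_hat F p \<longleftrightarrow> p = outer 1 \<or> p \<in> F"

lemma mem_hat_mono:
  assumes "upper_ideal PG ordG F" "mem_hat F (reg (-1) e)"
  shows "mem_hat F (reg 1 e)"
proof -
  have "reg (-1) e \<in> F" using assms(2) lower_not_top by (auto simp: mem_hat_def)
  moreover have "reg 1 e \<in> PG \<or> reg 1 e = outer 1"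
    using reg_in_hat[of 1 e] upper_not_bot[of e] by (auto simp: hat_eq)
  ultimately show ?thesis using assms(1) by (auto simp: mem_hat_def upper_ideal_cover_iff)
qed

lemma mem_hat_bot: "F \<subseteq> PG \<Longrightarrow> \<not> mem_hat F (outer (-1))"
  using outer_distinct outer_unbounded_region[of "-1"] by (auto simp: mem_hat_def)

lemma mem_hat_Fid: "route G s t R \<Longrightarrow> p \<in> hat \<Longrightarrow> mem_hat (Fid R) p \<longleftrightarrow> lies_above R p"
  using above_outer[of R] outer_unbounded_region outer_distinct
  by (auto simp: mem_hat_def Fid_def elim!: hat_cases)

text \<open>A route consists of the edges through which its ideal is entered from below. It is
  therefore determined by the ideal.\<close>

lemma route_arc_iff:
  assumes "route G s t R"
  shows "e \<in> set R \<longleftrightarrow> mem_hat (Fid R) (reg 1 e) \<and> \<not> mem_hat (Fid R) (reg (-1) e)"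
  using above_upper_lower[OF assms, of e, where 'a = nat] reg_in_hat[of 1 e] reg_in_hat[of "-1" e]
  by (auto simp: mem_hat_Fid[OF assms] of_bool_def split: if_splits)

lemma Fid_upper_ideal:
  assumes "route G s t R"
  shows "upper_ideal PG ordG (Fid R)"
proof -
  have "reg 1 e \<in> Fid R" if "reg (-1) e \<in> Fid R" "reg 1 e \<in> PG" for e
    using above_upper_lower[OF assms, of e, where 'a = nat] that by (auto simp: Fid_def of_bool_def split: if_splits)
  then show ?thesis by (auto simp: upper_ideal_cover_iff Fid_def)
qed

lemma Fid_inj: "inj_on Fid {R. route G s t R}"
proof (rule inj_onI)
  fix P Q assume PQ: "P \<in> {R. route G s t R}" "Q \<in> {R. route G s t R}" "Fid P = Fid Q"
  then have "set P = set Q" using route_arc_iff[of P] route_arc_iff[of Q] by auto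
  then show "P = Q" using PQ awalk_set_inj[of s P t Q] by (auto simp: route_def)
qed

end


section \<open>Degree equality\<close>

locale planar_flow_graph_balanced = planar_flow_graph G s t pos h
  for G :: "('v, 'e::finite) pre_digraph" and s t :: 'v and pos :: "'v \<Rightarrow> real \<times> real"
    and h :: "'e \<Rightarrow> real \<Rightarrow> real" +
  assumes all_ones: "lin_flow (\<chi> e. 1)"
begin

lemma ex_decomposition:
  "\<exists>Rs. (\<forall>R\<in>set Rs. route G s t R) \<and> (\<forall>e. length (filter (\<lambda>R. e \<in> set R) Rs) = 1)"
proof -
  have "card (in_arcs G v) = card (out_arcs G v)" if "v \<in> inner_verts G s t" for v
    using all_ones that by (auto simp: lin_flow_def)
  then have "conserving (\<lambda>e. 1 :: nat)" by (simp add: conserving_def)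
  then obtain Rs where "\<forall>R\<in>set Rs. route G s t R" "\<forall>e. 1 = length (filter (\<lambda>R. e \<in> set R) Rs)"
    using conserving_route_sum[of "\<lambda>e. 1", OF _ refl] by blast
  then show ?thesis by (intro exI[of _ Rs]) simp
qed

text \<open>Some decomposition of \<open>G\<close> into routes, which may cross each other.\<close>

definition Rs :: "'e list list" where
  "Rs = (SOME Rs. (\<forall>R\<in>set Rs. route G s t R) \<and> (\<forall>e. length (filter (\<lambda>R. e \<in> set R) Rs) = 1))"

lemma Rs_route: "R \<in> set Rs \<Longrightarrow> route G s t R"
  and Rs_once: "length (filter (\<lambda>R. e \<in> set R) Rs) = 1"
  using someI_ex[OF ex_decomposition] by (auto simp: Rs_def)

definition k :: nat where "k = length Rs"

definition level :: "(real \<times> real) set \<Rightarrow> nat" where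
  "level p = length (filter (\<lambda>R. lies_above R p) Rs)"

lemma level_le: "level p \<le> k"
  by (simp add: level_def k_def)

lemma level_bot: "level (outer (-1)) = 0"
  using above_outer(2)[OF Rs_route] by (auto simp: level_def filter_empty_conv)

lemma level_top: "level (outer 1) = k"
proof -
  have "filter (\<lambda>R. lies_above R (outer 1)) Rs = Rs" using above_outer(1)[OF Rs_route] by (simp add: filter_id_conv)
  then show ?thesis by (simp add: level_def k_def)
qed

text \<open>This is \<open>above_upper_lower\<close> summed over the routes of \<open>Rs\<close>,
  exactly one of which uses \<open>e\<close>.\<close>

lemma level_step: "level (reg 1 e) = Suc (level (reg (-1) e))"
proof -
  have "length (filter (\<lambda>R. lies_above R (reg 1 e)) L) =
    length (filter (\<lambda>R. lies_above R (reg (-1) e)) L) + length (filter (\<lambda>R. e \<in> set R) L)"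
    if "set L \<subseteq> set Rs" for L
    using that
  proof (induction L)
    case (Cons R L)
    then show ?case using above_upper_lower[OF Rs_route[of R], of e, where 'a = nat]
      by (auto simp: of_bool_def split: if_splits)
  qed simp
  from this[of Rs] show ?thesis using Rs_once[of e] by (simp add: level_def)
qed

lemma level_region: "p \<in> PG \<Longrightarrow> 1 \<le> level p \<and> level p < k"
proof -
  assume p: "p \<in> PG"
  obtain e where "reg 1 e = p" using bounded_region_reg[OF p, of 1] by blast
  moreover obtain d where "reg (-1) d = p" using bounded_region_reg[OF p, of "-1"] by blast
  ultimately show ?thesis using level_step[of e] level_step[of d] level_le[of "reg 1 d"] by auto
qed

lemma k_pos: "0 < k"
  using level_step[of undefined] level_le[of "reg 1 undefined"] by simp

lemma region_iff_level: "p \<in> hat \<Longrightarrow> p \<in> PG \<longleftrightarrow> 1 \<le> level p \<and> level p < k"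
  using level_region level_bot level_top by (auto elim!: hat_cases)

lemma level_0_iff: "p \<in> hat \<Longrightarrow> level p = 0 \<longleftrightarrow> p = outer (-1)"
  using level_region level_bot level_top k_pos by (fastforce elim!: hat_cases)

lemma level_k_iff: "p \<in> hat \<Longrightarrow> level p = k \<longleftrightarrow> p = outer 1"
  using level_region level_bot level_top k_pos by (fastforce elim!: hat_cases)

lemma order_level: "(p, q) \<in> ordG \<Longrightarrow> p = q \<or> level p < level q"
  by (induction rule: order_induct) (auto simp: level_step)

text \<open>Every region has an edge below it that leads to a lower level, so following edges down
  to the bottom recovers the values from the jumps.\<close>

lemma potential_unique:
  fixes g g' :: "(real \<times> real) set \<Rightarrow> 'b::ab_group_add"
  assumes "g (outer (-1)) = g' (outer (-1))"
    and "\<And>e. g (reg 1 e) - g (reg (-1) e) = g' (reg 1 e) - g' (reg (-1) e)"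
    and "p \<in> PG"
  shows "g p = g' p"
  using assms(3)
proof (induction "level p" arbitrary: p rule: less_induct)
  case less
  obtain e where e: "reg 1 e = p" using bounded_region_reg[OF less.prems, of 1] by blast
  have "g (reg (-1) e) = g' (reg (-1) e)"
  proof (cases "reg (-1) e \<in> PG")
    case True
    then show ?thesis using less.hyps[of "reg (-1) e"] level_step[of e] e by simp
  next
    case False
    then have "reg (-1) e = outer (-1)" using reg_in_hat[of "-1" e] lower_not_top[of e] by (auto simp: hat_eq)
    then show ?thesis using assms(1) by simp
  qed
  then show ?case using assms(2)[of e] e by simp
qed

text \<open>The indicator of the ideal never falls across an edge, so its jumps are the indicator of
  a route. The position function of this route has the same jumps and the same value at the bottom,
  and so coincides with the indicator on the regions.\<close>

lemma upper_ideal_route: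
  assumes F: "upper_ideal PG ordG F"
  obtains R where "route G s t R" "Fid R = F"
proof -
  \<comment> \<open>Potentials need a group, while flows are decomposed in \<open>nat\<close>; the
    integers mediate between the two.\<close>
  define g :: "(real \<times> real) set \<Rightarrow> int" where "g p = of_bool (mem_hat F p)" for p
  define w :: "'e \<Rightarrow> nat" where "w e = of_bool (mem_hat F (reg 1 e) \<and> \<not> mem_hat F (reg (-1) e))" for e
  have FP: "F \<subseteq> PG" using F by (simp add: upper_ideal_def)
  have w: "int (w e) = g (reg 1 e) - g (reg (-1) e)" for e
    using mem_hat_mono[OF F, of e] by (auto simp: w_def g_def)
  have "int (sum w A) = (\<Sum>e\<in>A. g (reg 1 e) - g (reg (-1) e))" for A by (simp add: w)
  then have "int (sum w (in_arcs G v)) = int (sum w (out_arcs G v))" if "v \<in> inner_verts G s t" for v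
    using potential_conserved[OF that, of g] by simp
  then have "sum w (in_arcs G v) = sum w (out_arcs G v)" if "v \<in> inner_verts G s t" for v
    using that by (simp only: of_nat_eq_iff)
  then have "conserving w" by (simp add: conserving_def)
  moreover have "sum w (out_arcs G s) = 1"
  proof -
    have "int (sum w (out_arcs G s)) = g (outer 1) - g (outer (-1))"
      using potential_value[of g] by (simp add: w)
    also have "\<dots> = int 1" using mem_hat_bot[OF FP] by (simp add: g_def mem_hat_def)
    finally show ?thesis by (simp only: of_nat_eq_iff)
  qed
  ultimately obtain R where R: "route G s t R" "\<And>e. w e = of_bool (e \<in> set R)"
    using unit_flow_is_route by blast
  define g' :: "(real \<times> real) set \<Rightarrow> int" where "g' p = of_bool (lies_above R p)" for p
  have "g p = g' p" if "p \<in> PG" for p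
  proof (rule potential_unique[OF _ _ that])
    show "g (outer (-1)) = g' (outer (-1))"
      using above_outer(2)[OF R(1)] mem_hat_bot[OF FP] by (simp add: g_def g'_def)
    show "g (reg 1 e) - g (reg (-1) e) = g' (reg 1 e) - g' (reg (-1) e)" for e
      using above_upper_lower[OF R(1), of e, where 'a = int] w[of e] R(2)[of e] by (simp add: g'_def)
  qed
  then have "mem_hat F p \<longleftrightarrow> lies_above R p" if "p \<in> PG" for p
    using that unfolding g_def g'_def of_bool_eq_iff by blast
  then have "p \<in> F \<longleftrightarrow> lies_above R p" if "p \<in> PG" for p
    using that outer_unbounded_region[of 1] by (metis mem_hat_def)
  then have "Fid R = F" using FP by (auto simp: Fid_def)
  then show thesis using that R(1) by blast
qed

subsection \<open>The planar route decomposition\<close>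

lemma level_ideal: "upper_ideal PG ordG {p \<in> PG. j \<le> level p}"
  by (auto simp: upper_ideal_cover_iff level_step)

text \<open>\<open>Rj 1\<close> has all regions above it and \<open>Rj k\<close> has none. Indices
  outside this range only repeat these two, hence the restriction to \<open>{1..k}\<close> in
  \<open>Rj_arcs\<close> and \<open>\<R>\<close>.\<close>

definition Rj :: "nat \<Rightarrow> 'e list" where
  "Rj j = (SOME R. route G s t R \<and> Fid R = {p \<in> PG. j \<le> level p})"

lemma Rj_route: "route G s t (Rj j)" and Fid_Rj: "Fid (Rj j) = {p \<in> PG. j \<le> level p}"
proof -
  have "route G s t (Rj j) \<and> Fid (Rj j) = {p \<in> PG. j \<le> level p}"
    unfolding Rj_def by (rule someI_ex, rule upper_ideal_route[OF level_ideal[of j]]) blast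
  then show "route G s t (Rj j)" "Fid (Rj j) = {p \<in> PG. j \<le> level p}" by auto
qed

lemma mem_hat_Fid_Rj:
  assumes "1 \<le> j" "j \<le> k" "p \<in> hat"
  shows "mem_hat (Fid (Rj j)) p \<longleftrightarrow> j \<le> level p"
  using assms(3)
proof (cases rule: hat_cases)
  case 1
  then show ?thesis using outer_unbounded_region[of 1] by (auto simp: mem_hat_def Fid_Rj)
next
  case 2
  then show ?thesis using assms(1) level_bot mem_hat_bot[of "Fid (Rj j)"] by (auto simp: Fid_def)
next
  case 3
  then show ?thesis using assms(2) level_top by (auto simp: mem_hat_def)
qed

lemma Rj_arcs:
  assumes "1 \<le> j" "j \<le> k"
  shows "e \<in> set (Rj j) \<longleftrightarrow> level (reg 1 e) = j"
  using mem_hat_Fid_Rj[OF assms reg_in_hat[of 1 e]] mem_hat_Fid_Rj[OF assms reg_in_hat[of "-1" e]] level_step[of e]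
  by (auto simp: route_arc_iff[OF Rj_route])

lemma level_upper: "1 \<le> level (reg 1 e)" "level (reg 1 e) \<le> k"
  using level_step[of e] level_le[of "reg 1 e"] by auto

lemma Rj_nonempty:
  obtains e where "e \<in> set (Rj j)"
  using route_nonempty[OF Rj_route[of j]] by (cases "Rj j") auto

lemma Rj_inj: "1 \<le> i \<Longrightarrow> i \<le> k \<Longrightarrow> 1 \<le> j \<Longrightarrow> j \<le> k \<Longrightarrow> Rj i = Rj j \<Longrightarrow> i = j"
  using Rj_nonempty[of i] Rj_arcs by metis

definition \<R> :: "'e list set" where "\<R> = Rj ` {1..k}"

definition \<R>_ord :: "'e list rel" where
  "\<R>_ord = {(Rj i, Rj j) | i j. 1 \<le> i \<and> i \<le> j \<and> j \<le> k}"

lemma \<R>_route: "R \<in> \<R> \<Longrightarrow> route G s t R"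
  using Rj_route by (auto simp: \<R>_def)

lemma \<R>_decomposition: "route_decomposition G s t \<R>"
  unfolding route_decomposition_def partition_on_def disjoint_def
proof (intro conjI ballI impI)
  show "route G s t R" if "R \<in> \<R>" for R using that by (rule \<R>_route)
  show "\<Union> (set ` \<R>) = arcs G"
  proof -
    have "e \<in> \<Union> (set ` \<R>)" for e
      using Rj_arcs[of "level (reg 1 e)" e] level_upper[of e] by (auto simp: \<R>_def)
    then show ?thesis by (auto simp: arcs_UNIV)
  qed
  show "A \<inter> B = {}" if "A \<in> set ` \<R>" "B \<in> set ` \<R>" "A \<noteq> B" for A B
    using that Rj_arcs by (auto simp: \<R>_def)
  show "{} \<notin> set ` \<R>" using route_nonempty[OF \<R>_route] by auto
qed

lemma \<R>_linear_order: "linear_order_on \<R> \<R>_ord"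
proof -
  have "(Rj i, Rj j) \<in> \<R>_ord \<longleftrightarrow> i \<le> j" if "1 \<le> i" "i \<le> k" "1 \<le> j" "j \<le> k" for i j
  proof
    assume "(Rj i, Rj j) \<in> \<R>_ord"
    then obtain i' j' where *: "Rj i = Rj i'" "Rj j = Rj j'" "1 \<le> i'" "i' \<le> j'" "j' \<le> k"
      by (auto simp: \<R>_ord_def)
    then have "i = i'" "j = j'" using Rj_inj[of i i'] Rj_inj[of j j'] that by auto
    then show "i \<le> j" using * by simp
  qed (use that in \<open>auto simp: \<R>_ord_def\<close>)
  note iff = this
  have sub: "\<R>_ord \<subseteq> \<R> \<times> \<R>" by (auto simp: \<R>_ord_def \<R>_def)
  have "refl_on \<R> \<R>_ord" using sub by (auto simp: refl_on_def \<R>_def iff)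
  moreover have "trans \<R>_ord"
  proof (rule transI)
    fix x y z assume xy: "(x, y) \<in> \<R>_ord" and yz: "(y, z) \<in> \<R>_ord"
    then have "x \<in> \<R>" "y \<in> \<R>" "z \<in> \<R>" using sub by auto
    then show "(x, z) \<in> \<R>_ord" using xy yz by (auto simp: \<R>_def iff)
  qed
  moreover have "antisym \<R>_ord"
  proof (rule antisymI)
    fix x y assume xy: "(x, y) \<in> \<R>_ord" and yx: "(y, x) \<in> \<R>_ord"
    then have "x \<in> \<R>" "y \<in> \<R>" using sub by auto
    then show "x = y" using xy yx by (auto simp: \<R>_def iff)
  qed
  moreover have "total_on \<R> \<R>_ord" by (auto simp: total_on_def \<R>_def iff)
  ultimately show ?thesis
    using sub by (simp add: linear_order_on_def partial_order_on_def preorder_on_def)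
qed

lemma induced_order_level:
  "induced_order \<R> \<R>_ord A = {(e, d). e \<in> A \<and> d \<in> A \<and> level (reg 1 e) \<le> level (reg 1 d)}"
proof -
  have "(\<exists>R\<in>\<R>. \<exists>R'\<in>\<R>. e \<in> set R \<and> d \<in> set R' \<and> (R, R') \<in> \<R>_ord) \<longleftrightarrow> level (reg 1 e) \<le> level (reg 1 d)" for e d
  proof
    assume "\<exists>R\<in>\<R>. \<exists>R'\<in>\<R>. e \<in> set R \<and> d \<in> set R' \<and> (R, R') \<in> \<R>_ord"
    then obtain i j where "e \<in> set (Rj i)" "d \<in> set (Rj j)" "1 \<le> i" "i \<le> j" "j \<le> k"
      by (auto simp: \<R>_ord_def)
    then show "level (reg 1 e) \<le> level (reg 1 d)" using Rj_arcs[of i e] Rj_arcs[of j d] by auto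
  next
    assume le: "level (reg 1 e) \<le> level (reg 1 d)"
    let ?i = "level (reg 1 e)" and ?j = "level (reg 1 d)"
    have "e \<in> set (Rj ?i)" "d \<in> set (Rj ?j)" using Rj_arcs level_upper by blast+
    moreover have "Rj ?i \<in> \<R>" "Rj ?j \<in> \<R>" using level_upper by (auto simp: \<R>_def)
    moreover have "(Rj ?i, Rj ?j) \<in> \<R>_ord" using le level_upper by (auto simp: \<R>_ord_def)
    ultimately show "\<exists>R\<in>\<R>. \<exists>R'\<in>\<R>. e \<in> set R \<and> d \<in> set R' \<and> (R, R') \<in> \<R>_ord" by blast
  qed
  then show ?thesis by (simp add: induced_order_def)
qed

text \<open>The routes \<open>Rj j\<close> are nested, with larger indices higher up, so an edge
  below another can lie neither on a route of larger index nor on the same route.\<close>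

lemma lower_imp_level: "lower e d \<Longrightarrow> level (reg 1 e) < level (reg 1 d)"
proof (rule ccontr)
  assume low: "lower e d" and "\<not> level (reg 1 e) < level (reg 1 d)"
  then have le: "level (reg 1 d) \<le> level (reg 1 e)" by simp
  let ?P = "Rj (level (reg 1 d))" and ?Q = "Rj (level (reg 1 e))"
  have "Fid ?Q \<subseteq> Fid ?P" using le by (auto simp: Fid_Rj)
  then have "route_le ?P ?Q" using Fid_subset_iff Rj_route by blast
  moreover have "d \<in> set ?P" "e \<in> set ?Q" using Rj_arcs level_upper by blast+
  ultimately show False using route_le_not_lower[of ?P ?Q d e] Rj_route low by blast
qed

lemma level_less_iff_lower:
  assumes "X e < x" "x < Y e" "X d < x" "x < Y d" "e \<noteq> d"
  shows "level (reg 1 e) \<le> level (reg 1 d) \<longleftrightarrow> lower e d"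
proof -
  have "h e x \<noteq> h d x" using open_edges_disjoint assms by blast
  then have "lower e d \<or> lower d e" using assms by (force simp: lower_def)
  then show ?thesis using lower_imp_level[of e d] lower_imp_level[of d e] by auto
qed

abbreviation in_frame :: "'v \<Rightarrow> 'e rel" where
  "in_frame v \<equiv> induced_order \<R> \<R>_ord (in_arcs G v)"
abbreviation out_frame :: "'v \<Rightarrow> 'e rel" where
  "out_frame v \<equiv> induced_order \<R> \<R>_ord (out_arcs G v)"

text \<open>Two edges that both enter or both leave a vertex overlap over an interval, so they are
  comparable by height.\<close>

lemma planar_framing_induced: "planar_framing in_frame out_frame"
  unfolding planar_framing_def induced_order_level
proof (intro conjI allI impI)
  fix v e d assume ed: "(e :: 'e) \<noteq> d"
  show "(e, d) \<in> {(e, d). e \<in> in_arcs G v \<and> d \<in> in_arcs G v \<and> level (reg 1 e) \<le> level (reg 1 d)} \<longleftrightarrow>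
    head G e = v \<and> head G d = v \<and> lower e d"
  proof (cases "head G e = v \<and> head G d = v")
    case True
    then obtain x where "X e < x" "x < Y e" "X d < x" "x < Y d"
      using dense[of "max (X e) (X d)" "Y e"] xc_less[of e] xc_less[of d] by auto
    then show ?thesis using level_less_iff_lower[of e x d] ed True by simp
  qed auto
  show "(e, d) \<in> {(e, d). e \<in> out_arcs G v \<and> d \<in> out_arcs G v \<and> level (reg 1 e) \<le> level (reg 1 d)} \<longleftrightarrow>
    tail G e = v \<and> tail G d = v \<and> lower e d"
  proof (cases "tail G e = v \<and> tail G d = v")
    case True
    then obtain x where "X e < x" "x < Y e" "X d < x" "x < Y d"
      using dense[of "X e" "min (Y e) (Y d)"] xc_less[of e] xc_less[of d] by auto
    then show ?thesis using level_less_iff_lower[of e x d] ed True by simp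
  qed auto
qed

lemma clique_iff_chain:
  assumes "\<And>R. R \<in> C \<Longrightarrow> route G s t R"
  shows "clique G s t in_frame out_frame C
    \<longleftrightarrow> chain\<^sub>\<subseteq> (Fid ` C)"
  unfolding clique_def chain_subset_def
  using assms coherent_iff_route_le[OF planar_framing_induced] Fid_subset_iff by auto

subsection \<open>Ranks\<close>

lemma finite_Chains: "finite (Chains ordG)"
proof (rule finite_subset)
  show "Chains ordG \<subseteq> Pow PG" using order_in_regions by (auto simp: Chains_def)
qed (simp add: finite_bounded_regions)

lemma Chains_level_inj: "C \<in> Chains ordG \<Longrightarrow> inj_on level C"
  using order_level by (fastforce simp: Chains_def inj_on_def)

lemma Chains_in_regions: "C \<in> Chains ordG \<Longrightarrow> C \<subseteq> PG"
  using order_in_regions by (auto simp: Chains_def)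

text \<open>Descending along edges loses one level at a time until the bottom is reached; the
  regions passed form the chain.\<close>

lemma ex_chain_below:
  assumes "p \<in> PG"
  shows "\<exists>C\<in>Chains ordG. (\<forall>q\<in>C. (q, p) \<in> ordG) \<and> card C = level p"
  using assms
proof (induction "level p" arbitrary: p rule: less_induct)
  case less
  obtain e where e: "reg 1 e = p" using bounded_region_reg[OF less.prems, of 1] by blast
  show ?case
  proof (cases "reg (-1) e \<in> PG")
    case True
    then obtain C where C: "C \<in> Chains ordG" "\<forall>q\<in>C. (q, reg (-1) e) \<in> ordG" "card C = level (reg (-1) e)"
      using less.hyps[of "reg (-1) e"] level_step[of e] e by auto
    have "(reg (-1) e, p) \<in> ordG"
      using True less.prems e by (intro cover_in_order) (auto simp: region_cover_iff)
    then have below: "\<forall>q\<in>C. (q, p) \<in> ordG" using C(2) order_trans_region by blast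
    have "p \<notin> C" using C(2) order_level[of p "reg (-1) e"] level_step[of e] e by auto
    moreover have "finite C"
      using finite_subset[OF Chains_in_regions[OF C(1)] finite_bounded_regions] .
    ultimately have "card (insert p C) = level p" using C(3) level_step[of e] e by simp
    moreover have "insert p C \<in> Chains ordG"
      using C(1) below order_refl_region[OF less.prems] by (auto simp: Chains_def)
    ultimately show ?thesis using below order_refl_region[OF less.prems] by (intro bexI[of _ "insert p C"]) auto
  next
    case False
    then have "level (reg (-1) e) = 0"
      using reg_in_hat[of "-1" e] lower_not_top[of e] level_bot by (auto simp: hat_eq)
    then have "level p = 1" using level_step[of e] e by simp
    then show ?thesis
      using order_refl_region[OF less.prems] by (intro bexI[of _ "{p}"]) (auto simp: Chains_def)
  qed
qed

text \<open>Levels strictly increase along a chain, which bounds its size;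
  \<open>ex_chain_below\<close> attains the bound.\<close>

lemma elem_rank_level:
  assumes p: "p \<in> PG"
  shows "elem_rank ordG p = level p"
  unfolding elem_rank_def
proof (rule Max_eqI)
  show "finite (card ` {C \<in> Chains ordG. \<forall>q\<in>C. (q, p) \<in> ordG})" using finite_Chains by simp
  show "level p \<in> card ` {C \<in> Chains ordG. \<forall>q\<in>C. (q, p) \<in> ordG}" using ex_chain_below[OF p] by force
  fix n assume "n \<in> card ` {C \<in> Chains ordG. \<forall>q\<in>C. (q, p) \<in> ordG}"
  then obtain C where C: "C \<in> Chains ordG" "\<forall>q\<in>C. (q, p) \<in> ordG" "n = card C" by auto
  have "level ` C \<subseteq> {1..level p}"
    using C(2) order_level level_region order_in_regions by fastforce
  then have "card C \<le> card {1..level p}"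
    using card_inj_on_le[OF Chains_level_inj[OF C(1)]] by blast
  then show "n \<le> level p" using C(3) by simp
qed

text \<open>Otherwise the indicator of the top would not jump across any edge, although its jumps at
  the source add up to 1.\<close>

lemma ex_top_edge: "\<exists>e. reg 1 e = outer 1"
proof (rule ccontr)
  assume none: "\<nexists>e. reg 1 e = outer 1"
  define g :: "(real \<times> real) set \<Rightarrow> int" where "g p = of_bool (p = outer 1)" for p
  have "g (reg 1 e) - g (reg (-1) e) = 0" for e using none lower_not_top[of e] by (simp add: g_def)
  then have "g (outer 1) - g (outer (-1)) = 0" using potential_value[of g] by simp
  then show False using outer_distinct by (simp add: g_def)
qed

lemma poset_rank_eq: "poset_rank ordG = k - 1"
  unfolding poset_rank_def
proof (rule Max_eqI)
  show "finite (card ` Chains ordG)" using finite_Chains by simp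
  fix n assume "n \<in> card ` Chains ordG"
  then obtain C where C: "C \<in> Chains ordG" "n = card C" by auto
  have "level ` C \<subseteq> {1..k - 1}"
    using Chains_in_regions[OF C(1)] level_region by fastforce
  then have "card C \<le> card {1..k - 1}"
    using card_inj_on_le[OF Chains_level_inj[OF C(1)]] by blast
  then show "n \<le> k - 1" using C(2) by simp
next
  obtain e where e: "reg 1 e = outer 1" using ex_top_edge by blast
  then have lev: "level (reg (-1) e) = k - 1" using level_step[of e] level_top by simp
  show "k - 1 \<in> card ` Chains ordG"
  proof (cases "reg (-1) e \<in> PG")
    case True
    then show ?thesis using ex_chain_below[OF True] lev by force
  next
    case False
    \<comment> \<open>Here \<open>k = 1\<close>, and the empty chain attains the maximum.\<close>
    then have "reg (-1) e = outer (-1)" using reg_in_hat[of "-1" e] lower_not_top[of e] by (auto simp: hat_eq)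
    then have "k - 1 = card ({} :: (real \<times> real) set set)" using lev level_bot by simp
    then show ?thesis by (intro image_eqI) (auto simp: Chains_def)
  qed
qed

text \<open>The strict inequality in \<open>rank_const_ideal\<close> shifts the index: 0 to
  \<open>k - 1\<close> there correspond to the routes with indices 1 to \<open>k\<close>.\<close>

lemma rank_const_ideal_eq: "rank_const_ideal PG ordG j = Fid (Rj (Suc j))"
  using elem_rank_level by (auto simp: rank_const_ideal_def Fid_Rj)

lemma rank_const_ideals: "rank_const_ideal PG ordG ` {0..poset_rank ordG} = Fid ` \<R>"
proof -
  have Suc: "Suc ` {0..k - 1} = {1..k}" using k_pos by (simp add: image_Suc_atLeastAtMost)
  have "(\<lambda>j. Fid (Rj (Suc j))) ` {0..k - 1} = (\<lambda>j. Fid (Rj j)) ` Suc ` {0..k - 1}"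
    by (simp only: image_image)
  also have "\<dots> = Fid ` \<R>" by (simp only: Suc \<R>_def image_image)
  moreover have "rank_const_ideal PG ordG = (\<lambda>j. Fid (Rj (Suc j)))"
    by (rule ext) (rule rank_const_ideal_eq)
  ultimately show ?thesis by (simp only: poset_rank_eq)
qed

text \<open>Every edge raises the level by exactly one, so no region fits strictly between its two
  sides and the generating relation of the order consists of covers only.\<close>

lemma covered_by_iff:
  "covered_by ordG p q \<longleftrightarrow> p \<in> PG \<and> q \<in> PG \<and> (\<exists>e. reg (-1) e = p \<and> reg 1 e = q)"
proof
  assume cov: "covered_by ordG p q"
  then have pq: "(p, q) \<in> ordG" "p \<noteq> q" by (auto simp: covered_by_def)
  then have P: "p \<in> PG" "q \<in> PG" using order_in_regions by auto
  have "(p, q) \<in> (region_cover G pos h)\<^sup>*" using pq by (auto simp: region_order_def)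
  then have "\<exists>z. (p, z) \<in> region_cover G pos h \<and> (z, q) \<in> (region_cover G pos h)\<^sup>*"
  proof (cases rule: converse_rtranclE)
    case base
    then show ?thesis using pq(2) by simp
  next
    case (step z)
    then show ?thesis by blast
  qed
  then obtain z where z: "(p, z) \<in> region_cover G pos h" "(z, q) \<in> (region_cover G pos h)\<^sup>*"
    by blast
  then obtain e where e: "reg (-1) e = p" "reg 1 e = z" "z \<in> PG" by (auto simp: region_cover_iff)
  have "(z, q) \<in> ordG" using z(2) e(3) P by (simp add: region_order_def)
  then have "z = p \<or> z = q" using cov cover_in_order[OF z(1)] unfolding covered_by_def by blast
  moreover have "z \<noteq> p" using level_step[of e] e(1,2) by auto
  ultimately have "z = q" by blast
  then show "p \<in> PG \<and> q \<in> PG \<and> (\<exists>e. reg (-1) e = p \<and> reg 1 e = q)" using P e by blast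
next
  assume R: "p \<in> PG \<and> q \<in> PG \<and> (\<exists>e. reg (-1) e = p \<and> reg 1 e = q)"
  then have pq: "(p, q) \<in> ordG" by (intro cover_in_order) (auto simp: region_cover_iff)
  have lev: "level q = Suc (level p)" using R level_step by auto
  show "covered_by ordG p q"
    unfolding covered_by_def
  proof (intro conjI allI impI)
    show "p \<noteq> q" using lev by auto
    show "z = p \<or> z = q" if "(p, z) \<in> ordG \<and> (z, q) \<in> ordG" for z
    proof (rule ccontr)
      assume "\<not> (z = p \<or> z = q)"
      then have "level p < level z" "level z < level q" using order_level that by metis+
      then show False using lev by simp
    qed
  qed (rule pq)
qed

section \<open>Equatorial chains of ideals and cliques of routes\<close>

lemma ex_arc_of_level:
  assumes "1 \<le> j" "j \<le> k"
  obtains e where "level (reg 1 e) = j"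
  using Rj_nonempty[of j] Rj_arcs[OF assms] by blast

text \<open>This and the next lemma move from any region to the lowest or highest level, so that
  conditions on arbitrary regions can be read off at an edge next to the bottom or the top.\<close>

lemma descend:
  assumes "p \<in> PG"
  shows "\<exists>e. level (reg 1 e) = 1 \<and> reg 1 e \<in> PG \<and> (reg 1 e, p) \<in> ordG"
  using assms
proof (induction "level p" arbitrary: p rule: less_induct)
  case less
  obtain e where e: "reg 1 e = p" using bounded_region_reg[OF less.prems, of 1] by blast
  show ?case
  proof (cases "reg (-1) e \<in> PG")
    case True
    then obtain d where d: "level (reg 1 d) = 1" "reg 1 d \<in> PG" "(reg 1 d, reg (-1) e) \<in> ordG"
      using less.hyps[of "reg (-1) e"] level_step[of e] e by auto
    have "(reg (-1) e, p) \<in> ordG"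
      using True less.prems e by (intro cover_in_order) (auto simp: region_cover_iff)
    then show ?thesis using d order_trans_region by blast
  next
    case False
    then have "level (reg (-1) e) = 0"
      using reg_in_hat[of "-1" e] lower_not_top[of e] level_bot by (auto simp: hat_eq)
    then show ?thesis using level_step[of e] e order_refl_region[OF less.prems] less.prems by (intro exI[of _ e]) simp
  qed
qed

lemma ascend:
  assumes "p \<in> PG"
  shows "\<exists>e. level (reg 1 e) = k \<and> reg (-1) e \<in> PG \<and> (p, reg (-1) e) \<in> ordG"
  using assms
proof (induction "k - level p" arbitrary: p rule: less_induct)
  case less
  obtain e where e: "reg (-1) e = p" using bounded_region_reg[OF less.prems, of "-1"] by blast
  show ?case
  proof (cases "reg 1 e \<in> PG")
    case True
    then have "k - level (reg 1 e) < k - level p"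
      using level_step[of e] e level_region[OF True] by simp
    then obtain d where d: "level (reg 1 d) = k" "reg (-1) d \<in> PG" "(reg 1 e, reg (-1) d) \<in> ordG"
      using less.hyps[of "reg 1 e"] True by blast
    have "(p, reg 1 e) \<in> ordG"
      using True less.prems e by (intro cover_in_order) (auto simp: region_cover_iff)
    then show ?thesis using d order_trans_region by blast
  next
    case False
    then have "level (reg 1 e) = k"
      using reg_in_hat[of 1 e] upper_not_bot[of e] level_top by (auto simp: hat_eq)
    then show ?thesis using e order_refl_region[OF less.prems] less.prems by (intro exI[of _ e]) simp
  qed
qed

text \<open>The equatorial condition in uniform shape on \<open>hat\<close>. For nonempty
  \<open>C\<close>, level 1 expresses that the minimum is 0, level \<open>k\<close> that all ideals
  are nonempty, and the levels between are the equalities along covers. For routes it says that each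
  \<open>Rj j\<close> has an edge that all of them avoid.\<close>

definition flat_levels :: "(real \<times> real) set set set \<Rightarrow> bool" where
  "flat_levels C \<longleftrightarrow> (\<forall>j\<in>{1..k}. \<exists>e. level (reg 1 e) = j \<and>
    (\<forall>F\<in>C. mem_hat F (reg 1 e) \<longleftrightarrow> mem_hat F (reg (-1) e)))"

lemma finite_ideals:
  assumes "\<And>F. F \<in> C \<Longrightarrow> upper_ideal PG ordG F"
  shows "finite C"
proof (rule finite_subset)
  show "C \<subseteq> Pow PG" using assms by (auto simp: upper_ideal_def)
qed (simp add: finite_bounded_regions)

lemma equatorial_map_iff_flat:
  assumes C: "\<And>F. F \<in> C \<Longrightarrow> upper_ideal PG ordG F" and chain: "chain\<^sub>\<subseteq> C"
  shows "(\<forall>F\<in>C. F \<noteq> {}) \<and> equatorial_map PG ordG (\<lambda>p. \<Sum>F\<in>C. indicator F p) \<longleftrightarrow> flat_levels C"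
proof -
  have fin: "finite C" by (rule finite_ideals[OF C])
  define f :: "(real \<times> real) set \<Rightarrow> real" where "f p = (\<Sum>F\<in>C. indicator F p)" for p
  have nonneg: "0 \<le> f p" for p by (simp add: f_def sum_nonneg)
  have ind_mono: "indicator F p \<le> (indicator F q :: real)" if "F \<in> C" "(p, q) \<in> ordG" for F p q
    using C[OF that(1)] that(2) order_in_regions[OF that(2)] by (auto simp: upper_ideal_def indicator_def)
  have mono: "f p \<le> f q" if "(p, q) \<in> ordG" for p q
    unfolding f_def using ind_mono[OF _ that] by (intro sum_mono) auto
  have eq: "f p = f q \<longleftrightarrow> (\<forall>F\<in>C. p \<in> F \<longleftrightarrow> q \<in> F)" if "(p, q) \<in> ordG" for p q
  proof
    assume fpq: "f p = f q"
    show "\<forall>F\<in>C. p \<in> F \<longleftrightarrow> q \<in> F"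
    proof
      fix F assume F: "F \<in> C"
      \<comment> \<open>Every indicator grows along the order, so equal sums have equal
        summands.\<close>
      have "indicator F p = (indicator F q :: real)"
        by (rule sum_mono_inv[OF fpq[unfolded f_def] _ F fin]) (rule ind_mono[OF _ that])
      then show "p \<in> F \<longleftrightarrow> q \<in> F" by (auto simp: indicator_def split: if_splits)
    qed
  next
    assume "\<forall>F\<in>C. p \<in> F \<longleftrightarrow> q \<in> F"
    then show "f p = f q" unfolding f_def by (intro sum.cong) (auto simp: indicator_def)
  qed
  have zero: "f p = 0 \<longleftrightarrow> (\<forall>F\<in>C. p \<notin> F)" for p
    unfolding f_def using fin by (subst sum_nonneg_eq_0_iff) (auto simp: indicator_def)
  have mem: "mem_hat F p \<longleftrightarrow> p \<in> F" if "p \<in> PG" for F p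
    using that outer_unbounded_region[of 1] by (auto simp: mem_hat_def)
  define flat where "flat j \<longleftrightarrow> (\<exists>e. reg (-1) e \<in> PG \<and> reg 1 e \<in> PG \<and> level (reg 1 e) = j \<and>
    f (reg (-1) e) = f (reg 1 e))" for j
  have e_map: "equatorial_map PG ordG (\<lambda>p. \<Sum>F\<in>C. indicator F p) \<longleftrightarrow>
    (PG \<noteq> {} \<longrightarrow> Min (f ` PG) = 0) \<and>
    (\<forall>j\<in>{2..k - 1}. flat j)"
  proof -
    have "(\<exists>p\<in>PG. \<exists>q\<in>PG. covered_by ordG p q \<and> elem_rank ordG p = j - 1 \<and> elem_rank ordG q = j \<and> f p = f q)
      \<longleftrightarrow> flat j" for j
    proof
      assume "\<exists>p\<in>PG. \<exists>q\<in>PG. covered_by ordG p q \<and> elem_rank ordG p = j - 1 \<and> elem_rank ordG q = j \<and> f p = f q"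
      then obtain p q where "p \<in> PG" "q \<in> PG" "covered_by ordG p q" "elem_rank ordG q = j" "f p = f q" by blast
      moreover from this obtain e where "reg (-1) e = p" "reg 1 e = q" using covered_by_iff by blast
      ultimately show "flat j"
        using elem_rank_level[of q] unfolding flat_def by (intro exI[of _ e]) simp
    next
      assume "flat j"
      then obtain e where e: "reg (-1) e \<in> PG" "reg 1 e \<in> PG" "level (reg 1 e) = j" "f (reg (-1) e) = f (reg 1 e)"
        unfolding flat_def by blast
      then have "covered_by ordG (reg (-1) e) (reg 1 e)" by (auto simp: covered_by_iff)
      moreover have "elem_rank ordG (reg (-1) e) = j - 1" "elem_rank ordG (reg 1 e) = j"
        using e elem_rank_level level_step[of e] by auto
      ultimately show "\<exists>p\<in>PG. \<exists>q\<in>PG. covered_by ordG p q \<and> elem_rank ordG p = j - 1 \<and> elem_rank ordG q = j \<and> f p = f q"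
        using e by blast
    qed
    then show ?thesis
      unfolding equatorial_map_def poset_rank_eq f_def[symmetric] using nonneg mono by auto
  qed
  show ?thesis
    unfolding e_map
  proof
    assume *: "(\<forall>F\<in>C. F \<noteq> {}) \<and> (PG \<noteq> {} \<longrightarrow> Min (f ` PG) = 0) \<and>
      (\<forall>j\<in>{2..k - 1}. flat j)"
    show "flat_levels C"
      unfolding flat_levels_def
    proof
      fix j assume j: "j \<in> {1..k}"
      then have j': "1 \<le> j" "j \<le> k" by auto
      consider "C = {}" | "C \<noteq> {}" "j = 1" | "C \<noteq> {}" "2 \<le> j" "j \<le> k - 1" | "C \<noteq> {}" "j = k" using j' by linarith
      then show "\<exists>e. level (reg 1 e) = j \<and> (\<forall>F\<in>C. mem_hat F (reg 1 e) \<longleftrightarrow> mem_hat F (reg (-1) e))"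
      proof cases
        case 1
        then show ?thesis using ex_arc_of_level[OF j'] by blast
      next
        case 2
        then obtain F where "F \<in> C" by blast
        then have "PG \<noteq> {}" using * C[of F] by (auto simp: upper_ideal_def)
        \<comment> \<open>The minimum 0 is attained at a region in no ideal; going down from it to
          level 1 stays outside all ideals.\<close>
        then have "0 \<in> f ` PG" using * Min_in[of "f ` PG"] finite_bounded_regions by auto
        then obtain p where p: "p \<in> PG" "f p = 0" by auto
        obtain e where e: "level (reg 1 e) = 1" "reg 1 e \<in> PG" "(reg 1 e, p) \<in> ordG" using descend[OF p(1)] by blast
        have "f (reg 1 e) = 0" using mono[OF e(3)] nonneg[of "reg 1 e"] p(2) by simp
        then have "\<not> mem_hat F (reg 1 e)" if "F \<in> C" for F using zero mem[OF e(2)] that by blast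
        then have "\<forall>F\<in>C. mem_hat F (reg 1 e) \<longleftrightarrow> mem_hat F (reg (-1) e)" using mem_hat_mono[OF C] by blast
        then show ?thesis using e(1) 2 by blast
      next
        case 3
        then have "j \<in> {2..k - 1}" by simp
        then have "flat j" using * by blast
        then obtain e where e: "reg (-1) e \<in> PG" "reg 1 e \<in> PG" "level (reg 1 e) = j" "f (reg (-1) e) = f (reg 1 e)"
          unfolding flat_def by blast
        have "(reg (-1) e, reg 1 e) \<in> ordG" using e by (intro cover_in_order) (auto simp: region_cover_iff)
        then have "\<forall>F\<in>C. reg (-1) e \<in> F \<longleftrightarrow> reg 1 e \<in> F" using eq e(4) by blast
        then show ?thesis using e mem by blast
      next
        case 4
        \<comment> \<open>An element of the least ideal lies in all of them, and so does every
          region above it.\<close>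
        obtain F0 where F0: "F0 \<in> C" "\<And>F. F \<in> C \<Longrightarrow> F0 \<subseteq> F" using finite_chain_least[OF fin 4(1) chain] by blast
        then obtain p where p: "p \<in> F0" using * by blast
        then have "p \<in> PG" using C[OF F0(1)] by (auto simp: upper_ideal_def)
        then obtain e where e: "level (reg 1 e) = k" "reg (-1) e \<in> PG" "(p, reg (-1) e) \<in> ordG" using ascend by blast
        have "mem_hat F (reg (-1) e)" if F: "F \<in> C" for F
        proof -
          have "p \<in> F" using F0(2)[OF F] p by blast
          then show ?thesis using C[OF F] e(2,3) mem[OF e(2)] by (auto simp: upper_ideal_def)
        qed
        then have "\<forall>F\<in>C. mem_hat F (reg 1 e) \<longleftrightarrow> mem_hat F (reg (-1) e)" using mem_hat_mono[OF C] by blast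
        then show ?thesis using e(1) 4(2) by blast
      qed
    qed
  next
    assume flat: "flat_levels C"
    have flat': "\<exists>e. level (reg 1 e) = j \<and> (\<forall>F\<in>C. mem_hat F (reg 1 e) \<longleftrightarrow> mem_hat F (reg (-1) e))"
      if "1 \<le> j" "j \<le> k" for j using flat that by (auto simp: flat_levels_def)
    have "F \<noteq> {}" if F: "F \<in> C" for F
    proof -
      obtain e where e: "level (reg 1 e) = k" "\<forall>F\<in>C. mem_hat F (reg 1 e) \<longleftrightarrow> mem_hat F (reg (-1) e)"
        using flat'[of k] k_pos by auto
      \<comment> \<open>The top belongs to every extended ideal, so by flatness the lower side of
        this edge is a region in \<open>F\<close>.\<close>
      have "reg 1 e = outer 1" using e(1) level_k_iff[OF reg_in_hat[of 1 e]] by simp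
      then have "mem_hat F (reg (-1) e)" using e(2) F by (auto simp: mem_hat_def)
      then show ?thesis using lower_not_top[of e] by (auto simp: mem_hat_def)
    qed
    moreover have "Min (f ` PG) = 0" if ne: "PG \<noteq> {}"
    proof (rule Min_eqI)
      show "finite (f ` PG)" using finite_bounded_regions by simp
      show "0 \<le> y" if "y \<in> f ` PG" for y using that nonneg by auto
      obtain p where "p \<in> PG" using ne by blast
      then have "1 < k" using level_region by force
      obtain e where e: "level (reg 1 e) = 1" "\<forall>F\<in>C. mem_hat F (reg 1 e) \<longleftrightarrow> mem_hat F (reg (-1) e)"
        using flat'[of 1] k_pos by auto
      have P: "reg 1 e \<in> PG" using region_iff_level[OF reg_in_hat[of 1 e]] e(1) \<open>1 < k\<close> by simp
      have bot: "reg (-1) e = outer (-1)"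
        using e(1) level_step[of e] level_0_iff[OF reg_in_hat[of "-1" e]] by simp
      have "reg 1 e \<notin> F" if "F \<in> C" for F
        using e(2) that mem_hat_bot[of F] C[OF that] mem[OF P, of F] bot by (auto simp: upper_ideal_def)
      then have "f (reg 1 e) = 0" by (simp add: zero)
      then show "0 \<in> f ` PG" using P by force
    qed
    moreover have "flat j"
      if j: "j \<in> {2..k - 1}" for j
    proof -
      have j': "1 \<le> j" "j \<le> k" "j < k" using j by auto
      obtain e where e: "level (reg 1 e) = j" "\<forall>F\<in>C. mem_hat F (reg 1 e) \<longleftrightarrow> mem_hat F (reg (-1) e)"
        using flat'[OF j'(1,2)] by blast
      have P: "reg 1 e \<in> PG" "reg (-1) e \<in> PG"
        using region_iff_level[OF reg_in_hat[of 1 e]] region_iff_level[OF reg_in_hat[of "-1" e]] e(1) level_step[of e] j j'(3)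
        by auto
      have "(reg (-1) e, reg 1 e) \<in> ordG" using P by (intro cover_in_order) (auto simp: region_cover_iff)
      then have "f (reg (-1) e) = f (reg 1 e)" using eq e(2) mem[OF P(1)] mem[OF P(2)] by blast
      then show ?thesis unfolding flat_def using P e(1) by blast
    qed
    ultimately show "(\<forall>F\<in>C. F \<noteq> {}) \<and> (PG \<noteq> {} \<longrightarrow> Min (f ` PG) = 0) \<and>
      (\<forall>j\<in>{2..k - 1}. flat j)"
      by blast
  qed
qed

definition equatorial_cliques :: "'e list set set" where
  "equatorial_cliques = {C. (\<forall>R\<in>C. route G s t R) \<and> chain\<^sub>\<subseteq> (Fid ` C) \<and>
    (\<forall>R\<in>\<R>. \<exists>e\<in>set R. \<forall>Q\<in>C. e \<notin> set Q)}"

lemma arc_off_route_iff: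
  assumes "route G s t R"
  shows "e \<notin> set R \<longleftrightarrow> (mem_hat (Fid R) (reg 1 e) \<longleftrightarrow> mem_hat (Fid R) (reg (-1) e))"
  using route_arc_iff[OF assms] mem_hat_mono[OF Fid_upper_ideal[OF assms]] by blast

lemma flat_levels_routes:
  assumes "\<And>R. R \<in> C \<Longrightarrow> route G s t R"
  shows "flat_levels (Fid ` C) \<longleftrightarrow> (\<forall>R\<in>\<R>. \<exists>e\<in>set R. \<forall>Q\<in>C. e \<notin> set Q)"
proof -
  have "(\<exists>e. level (reg 1 e) = j \<and> (\<forall>F\<in>Fid ` C. mem_hat F (reg 1 e) \<longleftrightarrow> mem_hat F (reg (-1) e)))
    \<longleftrightarrow> (\<exists>e\<in>set (Rj j). \<forall>Q\<in>C. e \<notin> set Q)" if "j \<in> {1..k}" for j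
    using Rj_arcs[of j] that arc_off_route_iff[OF assms] by auto
  then show ?thesis by (simp add: flat_levels_def \<R>_def)
qed

lemma equatorial_complex_eq: "equatorial_complex PG ordG = (`) Fid ` equatorial_cliques"
proof (intro equalityI subsetI)
  fix C assume "C \<in> equatorial_complex PG ordG"
  then have C: "\<And>F. F \<in> C \<Longrightarrow> upper_ideal PG ordG F" "chain\<^sub>\<subseteq> C" "\<forall>F\<in>C. F \<noteq> {}"
    "equatorial_map PG ordG (\<lambda>p. \<Sum>F\<in>C. indicator F p)"
    by (auto simp: equatorial_complex_def)
  define C' where "C' = {R. route G s t R \<and> Fid R \<in> C}"
  have eq: "Fid ` C' = C"
  proof
    show "C \<subseteq> Fid ` C'"
    proof
      fix F assume F: "F \<in> C"
      obtain R where "route G s t R" "Fid R = F" using upper_ideal_route[OF C(1)[OF F]] by blast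
      then show "F \<in> Fid ` C'" using F by (auto simp: C'_def)
    qed
  qed (auto simp: C'_def)
  have "flat_levels C" using equatorial_map_iff_flat[OF C(1,2)] C(3,4) by blast
  then have "C' \<in> equatorial_cliques"
    using flat_levels_routes[of C'] C(2) eq by (auto simp: equatorial_cliques_def C'_def)
  then show "C \<in> (`) Fid ` equatorial_cliques" using eq by blast
next
  fix C assume "C \<in> (`) Fid ` equatorial_cliques"
  then obtain C' where C': "C = Fid ` C'" "C' \<in> equatorial_cliques" by blast
  then have r: "\<And>R. R \<in> C' \<Longrightarrow> route G s t R" and chain: "chain\<^sub>\<subseteq> C" by (auto simp: equatorial_cliques_def)
  have up: "\<And>F. F \<in> C \<Longrightarrow> upper_ideal PG ordG F" using C'(1) Fid_upper_ideal[OF r] by auto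
  have "flat_levels C" using flat_levels_routes[OF r] C' by (simp add: equatorial_cliques_def)
  then show "C \<in> equatorial_complex PG ordG"
    using equatorial_map_iff_flat[OF up chain] up chain by (auto simp: equatorial_complex_def)
qed

lemma equatorial_clique_nonempty:
  assumes "C \<in> equatorial_cliques" "R \<in> C"
  shows "Fid R \<noteq> {}"
proof -
  have "Fid ` C \<in> equatorial_complex PG ordG" using assms(1) equatorial_complex_eq by blast
  then show ?thesis using assms(2) by (auto simp: equatorial_complex_def)
qed

lemma equatorial_cliques_subset:
  assumes C: "C \<in> equatorial_cliques" and B: "B \<subseteq> C"
  shows "B \<in> equatorial_cliques"
proof -
  have "chain\<^sub>\<subseteq> (Fid ` B)"
    by (rule chain_subset_mono[OF _ image_mono[OF B]]) (use C in \<open>simp add: equatorial_cliques_def\<close>)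
  moreover have "\<exists>e\<in>set R. \<forall>Q\<in>B. e \<notin> set Q" if "R \<in> \<R>" for R
  proof -
    have "\<exists>e\<in>set R. \<forall>Q\<in>C. e \<notin> set Q" using C that by (simp add: equatorial_cliques_def)
    then show ?thesis using B by blast
  qed
  ultimately show ?thesis using C B by (auto simp: equatorial_cliques_def)
qed

section \<open>The map \<open>phi\<close> on convex hulls\<close>

abbreviation phi :: "((real \<times> real) set \<Rightarrow> real) \<Rightarrow> real ^ 'e" where
  "phi \<equiv> order_to_flow G s t pos h"

definition ext :: "((real \<times> real) set \<Rightarrow> real) \<Rightarrow> (real \<times> real) set \<Rightarrow> real" where
  "ext f p = (if p = outer (-1) then 0 else if p = outer 1 then 1 else f p)"

lemma phi_nth: "phi f $ e = ext f (reg 1 e) - ext f (reg (-1) e)"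
  by (simp add: order_to_flow_def extend_hat_def ext_def outer_below_eq outer_above_eq upper_region_eq lower_region_eq)

lemma phi_indicator:
  assumes "route G s t R"
  shows "phi (indicator (Fid R)) = route_vec R"
proof -
  have "ext (indicator (Fid R)) p = of_bool (lies_above R p)" if "p \<in> hat" for p
    using that above_outer[OF assms] outer_distinct outer_unbounded_region[of 1] outer_unbounded_region[of "-1"]
    by (cases rule: hat_cases) (auto simp: ext_def Fid_def indicator_def)
  then have "phi (indicator (Fid R)) $ e = route_vec R $ e" for e
    using above_upper_lower[OF assms, of e, where 'a = real] reg_in_hat[of 1 e] reg_in_hat[of "-1" e]
    by (simp add: phi_nth)
  then show ?thesis by (simp add: vec_eq_iff)
qed

text \<open>\<open>phi\<close> is affine but not linear, because the top always has the value 1;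
  subtracting \<open>phi 0\<close> removes this constant.\<close>

lemma phi_affine: "linear (\<lambda>f. phi f - phi 0)"
  by (rule linearI) (auto simp: vec_eq_iff phi_nth ext_def plus_fun_def zero_fun_def scaleR_fun_def algebra_simps)

lemma phi_convex_hull: "phi ` (convex hull S) = convex hull (phi ` S)"
proof -
  have eq: "phi = (\<lambda>x. phi 0 + x) \<circ> (\<lambda>f. phi f - phi 0)" by (auto simp: fun_eq_iff)
  have "phi ` (convex hull S) = (\<lambda>x. phi 0 + x) ` (\<lambda>f. phi f - phi 0) ` (convex hull S)"
    by (subst eq) (simp only: image_comp)
  also have "\<dots> = convex hull ((\<lambda>x. phi 0 + x) ` (\<lambda>f. phi f - phi 0) ` S)"
    by (simp only: convex_hull_linear_image[OF phi_affine] convex_hull_translation)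
  also have "(\<lambda>x. phi 0 + x) ` (\<lambda>f. phi f - phi 0) ` S = phi ` S"
    by (subst (3) eq) (simp only: image_comp)
  finally show ?thesis .
qed

text \<open>\<open>phi\<close> ignores the values off \<open>PG\<close>, so injectivity can only be
  expected once these are fixed.\<close>

definition supported :: "((real \<times> real) set \<Rightarrow> real) set" where
  "supported = {f. \<forall>p. p \<notin> PG \<longrightarrow> f p = 0}"

text \<open>Equal images mean equal jumps across all edges, so \<open>potential_unique\<close>
  applies.\<close>

lemma phi_inj: "inj_on phi supported"
proof (rule inj_onI, rule ext)
  fix f g p assume fg: "f \<in> supported" "g \<in> supported" "phi f = phi g"
  show "f p = g p"
  proof (cases "p \<in> PG")
    case True
    have "ext f p = ext g p"
    proof (rule potential_unique[OF _ _ True])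
      show "ext f (outer (-1)) = ext g (outer (-1))" by (simp add: ext_def)
      show "ext f (reg 1 e) - ext f (reg (-1) e) = ext g (reg 1 e) - ext g (reg (-1) e)" for e
        using arg_cong[OF fg(3), of "\<lambda>x. x $ e"] by (simp add: phi_nth)
    qed
    then show ?thesis using True outer_unbounded_region[of 1] outer_unbounded_region[of "-1"]
      by (auto simp: ext_def split: if_splits)
  qed (use fg in \<open>auto simp: supported_def\<close>)
qed

lemma convex_supported: "convex supported"
  by (auto simp: convex_def supported_def plus_fun_def scaleR_fun_def)

lemma Fid_indicator_supported: "indicator (Fid R) \<in> supported"
  by (auto simp: supported_def Fid_def indicator_def)

section \<open>The simplices of both triangulations in terms of routes\<close>

lemma equatorial_triangulation_eq:
  "equatorial_triangulation PG ordG =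
    {convex hull ((\<lambda>R. indicator (Fid R)) ` (A \<union> C)) | A C. A \<subseteq> \<R> \<and> C \<in> equatorial_cliques}"
proof (intro equalityI subsetI)
  fix S assume "S \<in> equatorial_triangulation PG ordG"
  then obtain A C where S: "S = convex hull ((\<lambda>F. indicator F) ` (A \<union> C))" "A \<subseteq> Fid ` \<R>"
    "C \<in> (`) Fid ` equatorial_cliques"
    by (auto simp: equatorial_triangulation_def rank_const_ideals equatorial_complex_eq)
  obtain A' where A': "A' \<subseteq> \<R>" "A = Fid ` A'" using S(2) by (meson subset_imageE)
  obtain C' where C': "C' \<in> equatorial_cliques" "C = Fid ` C'" using S(3) by blast
  have "S = convex hull ((\<lambda>R. indicator (Fid R)) ` (A' \<union> C'))"
    unfolding S(1) A'(2) C'(2) image_Un[symmetric] image_image ..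
  then show "S \<in> {convex hull ((\<lambda>R. indicator (Fid R)) ` (A \<union> C)) | A C. A \<subseteq> \<R> \<and> C \<in> equatorial_cliques}"
    using A' C' by blast
next
  fix S :: "((real \<times> real) set \<Rightarrow> real) set"
  assume "S \<in> {convex hull ((\<lambda>R. indicator (Fid R)) ` (A \<union> C)) | A C. A \<subseteq> \<R> \<and> C \<in> equatorial_cliques}"
  then obtain A C where S: "S = convex hull ((\<lambda>R. indicator (Fid R)) ` (A \<union> C))" "A \<subseteq> \<R>" "C \<in> equatorial_cliques"
    by blast
  have "S = convex hull ((\<lambda>F. indicator F) ` (Fid ` A \<union> Fid ` C))"
    unfolding S(1) image_Un[symmetric] image_image ..
  then show "S \<in> equatorial_triangulation PG ordG"
    unfolding equatorial_triangulation_def rank_const_ideals equatorial_complex_eq using S(2,3) by blast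
qed

text \<open>A nonempty simplex in \<Gamma> lies, for each route of \<open>\<R>\<close>, on a facet
  that misses this route, so \<open>face_avoids_arc\<close> yields an edge that the clique avoids.
  Conversely the avoided edges define facets whose intersection contains the clique.\<close>

lemma T_eq_eq: "T_eq G s t \<R> \<R>_ord = {convex hull (route_vec ` C) | C. C \<in> equatorial_cliques}"
proof (intro equalityI subsetI)
  fix S assume "S \<in> T_eq G s t \<R> \<R>_ord"
  then obtain C K where C: "S = convex hull (route_vec ` C)"
      "clique G s t in_frame out_frame C"
    and K: "K \<in> equatorial_boundary G s t \<R>" "S \<subseteq> K"
    by (auto simp: T_eq_def decomposition_triangulation_def dkk_triangulation_def)
  have r: "\<And>R. R \<in> C \<Longrightarrow> route G s t R" using C(2) by (auto simp: clique_def)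
  have mem: "route_vec Q \<in> K" if "Q \<in> C" for Q
    using K(2) hull_subset[of "route_vec ` C" convex] that unfolding C(1) by blast
  have "\<exists>e\<in>set R. \<forall>Q\<in>C. e \<notin> set Q" if R: "R \<in> \<R>" for R
  proof (cases "K = {}")
    case True
    then have "C = {}" using mem by blast
    then show ?thesis using route_nonempty[OF \<R>_route[OF R]] by (cases R) auto
  next
    case False
    then obtain F where F: "\<forall>R\<in>\<R>. F R facet_of F1 \<and> route_vec R \<notin> F R" "K face_of (\<Inter>R\<in>\<R>. F R)"
      using K(1) by (auto simp: equatorial_boundary_def)
    have "K \<subseteq> F R" using face_of_imp_subset[OF F(2)] R by blast
    then show ?thesis
      using F(1) R mem by (intro face_avoids_arc[of "F R"] \<R>_route) (auto simp: facet_of_imp_face_of)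
  qed
  then have "C \<in> equatorial_cliques"
    using r clique_iff_chain[of C] C(2) by (auto simp: equatorial_cliques_def)
  then show "S \<in> {convex hull (route_vec ` C) | C. C \<in> equatorial_cliques}" using C(1) by blast
next
  fix S assume "S \<in> {convex hull (route_vec ` C) | C. C \<in> equatorial_cliques}"
  then obtain C where S: "S = convex hull (route_vec ` C)" and C: "C \<in> equatorial_cliques" by blast
  have r: "\<And>R. R \<in> C \<Longrightarrow> route G s t R" using C by (auto simp: equatorial_cliques_def)
  then have clique: "clique G s t in_frame out_frame C"
    using clique_iff_chain[of C] C by (auto simp: equatorial_cliques_def)
  have "\<exists>K\<in>equatorial_boundary G s t \<R>. S \<subseteq> K"
  proof (cases "C = {}")
    case True
    \<comment> \<open>The empty clique does not provide a route that avoids the chosen edges; here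
      the empty face of \<Gamma> serves instead.\<close>
    then show ?thesis by (intro bexI[of _ "{}"]) (simp_all add: S equatorial_boundary_def)
  next
    case False
    have "\<forall>R\<in>\<R>. \<exists>e. e \<in> set R \<and> (\<forall>Q\<in>C. e \<notin> set Q)" using C by (auto simp: equatorial_cliques_def)
    then obtain a where a: "\<And>R. R \<in> \<R> \<Longrightarrow> a R \<in> set R \<and> (\<forall>Q\<in>C. a R \<notin> set Q)" by metis
    define F where "F R = {x \<in> F1. x $ a R = 0}" for R
    have conv: "convex (F R)" for R unfolding F_def by (rule face_of_imp_convex[OF zero_arc_face])
    have "\<forall>R\<in>\<R>. F R facet_of F1 \<and> route_vec R \<notin> F R"
    proof
      fix R assume R: "R \<in> \<R>"
      obtain Q where "Q \<in> C" using False by blast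
      then have "F R facet_of F1" unfolding F_def using a[OF R] r by (intro zero_arc_facet) auto
      then show "F R facet_of F1 \<and> route_vec R \<notin> F R" using a[OF R] by (simp add: F_def)
    qed
    moreover have "(\<Inter>R\<in>\<R>. F R) face_of (\<Inter>R\<in>\<R>. F R)" by (intro face_of_refl convex_INT conv)
    ultimately have "(\<Inter>R\<in>\<R>. F R) \<in> equatorial_boundary G s t \<R>" by (auto simp: equatorial_boundary_def)
    moreover have "S \<subseteq> (\<Inter>R\<in>\<R>. F R)"
      unfolding S
    proof (intro hull_minimal convex_INT conv, clarify)
      fix Q R assume "Q \<in> C" "R \<in> \<R>"
      then show "route_vec Q \<in> F R" using a r route_vec_in_F1 by (auto simp: F_def)
    qed
    ultimately show ?thesis by blast
  qed
  then show "S \<in> T_eq G s t \<R> \<R>_ord"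
    using S clique by (auto simp: T_eq_def decomposition_triangulation_def dkk_triangulation_def)
qed

text \<open>An edge of a route in \<open>\<R>\<close> that \<open>C\<close> avoids lies on no other
  member of the union, so the coefficient of this route vanishes. What remains is a relation among
  routes with nested, nonempty and distinct ideals, whose indicators are independent.\<close>

lemma equatorial_join_independent:
  assumes C: "C \<in> equatorial_cliques"
  shows "independent (route_vec ` (C \<union> \<R>))"
proof -
  have r: "\<And>R. R \<in> C \<Longrightarrow> route G s t R" using C by (auto simp: equatorial_cliques_def)
  have routes: "C \<union> \<R> \<subseteq> {R. route G s t R}" using r \<R>_route by auto
  then have fin: "finite (C \<union> \<R>)" using finite_routes finite_subset by blast
  then have finC: "finite C" by simp
  have inj: "inj_on route_vec (C \<union> \<R>)" by (rule inj_on_subset[OF route_vec_inj routes])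
  show ?thesis
  proof (rule independent_if_scalars_zero)
    show "finite (route_vec ` (C \<union> \<R>))" using fin by simp
    fix u :: "real ^ 'e \<Rightarrow> real" and x :: "real ^ 'e"
    assume "(\<Sum>x\<in>route_vec ` (C \<union> \<R>). u x *\<^sub>R x) = 0" and x: "x \<in> route_vec ` (C \<union> \<R>)"
    define c where "c R = u (route_vec R)" for R
    have sum0: "(\<Sum>R\<in>C \<union> \<R>. c R *\<^sub>R route_vec R) = 0"
      using \<open>(\<Sum>x\<in>route_vec ` (C \<union> \<R>). u x *\<^sub>R x) = 0\<close> by (simp add: sum.reindex[OF inj] c_def)
    have comp: "(\<Sum>R\<in>C \<union> \<R>. c R * of_bool (e \<in> set R)) = 0" for e
      using arg_cong[OF sum0, of "\<lambda>x. x $ e"] by simp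
    have c\<R>: "c R = 0" if R: "R \<in> \<R>" for R
    proof -
      have "\<exists>e\<in>set R. \<forall>Q\<in>C. e \<notin> set Q" using C R by (simp add: equatorial_cliques_def)
      then obtain e where e: "e \<in> set R" "\<forall>Q\<in>C. e \<notin> set Q" by blast
      have uniq: "Q = R" if Q: "Q \<in> C \<union> \<R>" "e \<in> set Q" for Q
      proof -
        have "Q \<in> \<R>" using Q e(2) by auto
        then obtain i where i: "Q = Rj i" "i \<in> {1..k}" by (auto simp: \<R>_def)
        obtain j where "R = Rj j" "j \<in> {1..k}" using R by (auto simp: \<R>_def)
        with i show ?thesis using Q(2) e(1) Rj_arcs[of i e] Rj_arcs[of j e] by simp
      qed
      have "(\<Sum>Q\<in>C \<union> \<R>. c Q * of_bool (e \<in> set Q)) = (\<Sum>Q\<in>C \<union> \<R>. if Q = R then c Q else 0)"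
      proof (rule sum.cong[OF refl])
        fix Q assume Q: "Q \<in> C \<union> \<R>"
        show "c Q * of_bool (e \<in> set Q) = (if Q = R then c Q else 0)"
        proof (cases "Q = R")
          case False
          then have "e \<notin> set Q" using uniq[OF Q] by blast
          then show ?thesis using False by simp
        qed (simp add: e(1))
      qed
      also have "\<dots> = c R" using fin R by simp
      finally show ?thesis using comp[of e] by simp
    qed
    have compC: "(\<Sum>R\<in>C. c R * of_bool (e \<in> set R)) = 0" for e
    proof -
      have "(\<Sum>R\<in>C. c R * of_bool (e \<in> set R)) = (\<Sum>R\<in>C \<union> \<R>. c R * of_bool (e \<in> set R))"
        by (rule sum.mono_neutral_left) (use fin c\<R> in auto)
      then show ?thesis using comp by simp
    qed
    \<comment> \<open>The relation among the routes says that this combination of position functions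
      has no jumps; being 0 at the bottom, it vanishes on all regions.\<close>
    define g :: "(real \<times> real) set \<Rightarrow> real" where "g p = (\<Sum>R\<in>C. c R * of_bool (lies_above R p))" for p
    have g0: "g p = 0" if "p \<in> PG" for p
    proof (rule potential_unique[OF _ _ that, of g "\<lambda>_. 0"])
      show "g (outer (-1)) = 0" using above_outer(2)[OF r] by (simp add: g_def)
      show "g (reg 1 e) - g (reg (-1) e) = 0 - 0" for e
      proof -
        have "g (reg 1 e) = (\<Sum>R\<in>C. c R * of_bool (lies_above R (reg (-1) e)) + c R * of_bool (e \<in> set R))"
          unfolding g_def
          by (intro sum.cong refl) (simp add: above_upper_lower[OF r, where 'a = real] algebra_simps)
        then show ?thesis using compC[of e] by (simp add: sum.distrib g_def)
      qed
    qed
    have cC: "c R = 0" if "R \<in> C" for R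
    proof (rule ccontr)
      assume "c R \<noteq> 0"
      define Z where "Z = {R \<in> C. c R \<noteq> 0}"
      have Z: "finite (Fid ` Z)" "Fid ` Z \<noteq> {}" using finC \<open>c R \<noteq> 0\<close> that by (auto simp: Z_def)
      have chain: "chain\<^sub>\<subseteq> (Fid ` C)" using C by (simp add: equatorial_cliques_def)
      then have chainZ: "chain\<^sub>\<subseteq> (Fid ` Z)" by (rule chain_subset_mono) (auto simp: Z_def)
      obtain M where "M \<in> Fid ` Z" "\<And>b. b \<in> Fid ` Z \<Longrightarrow> b \<subseteq> M" using finite_chain_greatest[OF Z chainZ] by blast
      then obtain Q where Q: "Q \<in> Z" "\<And>Q'. Q' \<in> Z \<Longrightarrow> Fid Q' \<subseteq> Fid Q" by blast
      \<comment> \<open>A region of the largest ideal with nonzero coefficient that lies in no other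
        such ideal: evaluating \<open>g\<close> there isolates one coefficient.\<close>
      have "\<exists>p\<in>Fid Q. \<forall>Q'\<in>Z - {Q}. p \<notin> Fid Q'"
      proof (cases "Z - {Q} = {}")
        case True
        have "Fid Q \<noteq> {}" using equatorial_clique_nonempty[OF C] Q(1) by (auto simp: Z_def)
        then show ?thesis using True by blast
      next
        case False
        have Z': "finite (Fid ` (Z - {Q}))" "Fid ` (Z - {Q}) \<noteq> {}" "chain\<^sub>\<subseteq> (Fid ` (Z - {Q}))"
          using False finC chain_subset_mono[OF chainZ, of "Fid ` (Z - {Q})"] by (auto simp: Z_def)
        obtain M' where M': "M' \<in> Fid ` (Z - {Q})" "\<And>b. b \<in> Fid ` (Z - {Q}) \<Longrightarrow> b \<subseteq> M'"
          using finite_chain_greatest[OF Z'] by blast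
        then obtain Q' where Q': "Q' \<in> Z" "Q' \<noteq> Q" "M' = Fid Q'" by blast
        have "Fid Q' \<noteq> Fid Q" using inj_onD[OF Fid_inj, of Q' Q] Q' Q(1) r by (auto simp: Z_def)
        then obtain p where "p \<in> Fid Q" "p \<notin> Fid Q'" using Q(2)[OF Q'(1)] by blast
        then show ?thesis using M'(2) Q'(3) by blast
      qed
      then obtain p where p: "p \<in> Fid Q" "\<And>Q'. Q' \<in> Z \<Longrightarrow> Q' \<noteq> Q \<Longrightarrow> p \<notin> Fid Q'" by blast
      have pP: "p \<in> PG" using p(1) by (simp add: Fid_def)
      have "g p = (\<Sum>R\<in>C. if R = Q then c R else 0)"
        unfolding g_def
      proof (intro sum.cong refl)
        fix R assume R: "R \<in> C"
        show "c R * of_bool (lies_above R p) = (if R = Q then c R else 0)"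
          using p pP R by (cases "c R = 0") (auto simp: Fid_def Z_def)
      qed
      also have "\<dots> = c Q" using finC Q(1) by (simp add: Z_def)
      finally show False using g0[OF pP] Q(1) by (simp add: Z_def)
    qed
    obtain R where R: "R \<in> C \<union> \<R>" "x = route_vec R" using x by blast
    then show "u x = 0" using c\<R> cC by (auto simp: c_def)
  qed
qed

lemma equatorial_flow_triangulation_eq:
  "equatorial_flow_triangulation G s t \<R> \<R>_ord =
    {convex hull (route_vec ` (A \<union> C)) | A C. A \<subseteq> \<R> \<and> C \<in> equatorial_cliques}"
proof -
  have faces: "S face_of (convex hull (convex hull (route_vec ` C) \<union> route_simplex \<R>)) \<longleftrightarrow>
    (\<exists>B\<subseteq>C \<union> \<R>. S = convex hull (route_vec ` B))" if C: "C \<in> equatorial_cliques" for S C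
  proof -
    have "convex hull (convex hull (route_vec ` C) \<union> route_simplex \<R>) = convex hull (route_vec ` (C \<union> \<R>))"
      unfolding route_simplex_def hull_Un_left[symmetric] hull_Un_right[symmetric] image_Un ..
    moreover have "\<not> affine_dependent (route_vec ` (C \<union> \<R>))"
      using affine_dependent_imp_dependent equatorial_join_independent[OF C] by blast
    ultimately have "S face_of (convex hull (convex hull (route_vec ` C) \<union> route_simplex \<R>)) \<longleftrightarrow>
      (\<exists>c\<subseteq>route_vec ` (C \<union> \<R>). S = convex hull c)"
      using face_of_convex_hull_affine_independent by metis
    also have "\<dots> \<longleftrightarrow> (\<exists>B\<subseteq>C \<union> \<R>. S = convex hull (route_vec ` B))"
      by (metis image_mono subset_imageE)
    finally show ?thesis .
  qed
  show ?thesis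
  proof (intro equalityI subsetI)
    fix S assume "S \<in> equatorial_flow_triangulation G s t \<R> \<R>_ord"
    then obtain C where C: "C \<in> equatorial_cliques"
      "S face_of (convex hull (convex hull (route_vec ` C) \<union> route_simplex \<R>))"
      by (auto simp: equatorial_flow_triangulation_def T_eq_eq)
    then obtain B where B: "B \<subseteq> C \<union> \<R>" "S = convex hull (route_vec ` B)" using faces by blast
    \<comment> \<open>The vertices of a face split into routes of the decomposition and a subset of
      the clique, which is again an equatorial clique.\<close>
    have "(B \<inter> \<R>) \<union> (B \<inter> C) = B" using B(1) by blast
    then have "S = convex hull (route_vec ` ((B \<inter> \<R>) \<union> (B \<inter> C)))" using B(2) by simp
    moreover have "B \<inter> C \<in> equatorial_cliques" by (rule equatorial_cliques_subset[OF C(1)]) simp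
    ultimately show "S \<in> {convex hull (route_vec ` (A \<union> C)) | A C. A \<subseteq> \<R> \<and> C \<in> equatorial_cliques}"
      by (intro CollectI exI[of _ "B \<inter> \<R>"] exI[of _ "B \<inter> C"]) simp
  next
    fix S assume "S \<in> {convex hull (route_vec ` (A \<union> C)) | A C. A \<subseteq> \<R> \<and> C \<in> equatorial_cliques}"
    then obtain A C where AC: "S = convex hull (route_vec ` (A \<union> C))" "A \<subseteq> \<R>" "C \<in> equatorial_cliques" by blast
    then have "S face_of (convex hull (convex hull (route_vec ` C) \<union> route_simplex \<R>))" using faces by blast
    then show "S \<in> equatorial_flow_triangulation G s t \<R> \<R>_ord"
      using AC(3) by (auto simp: equatorial_flow_triangulation_def T_eq_eq)
  qed
qed

text \<open>All simplices consist of supported functions, on which \<open>phi\<close> is injective,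
  so distinct simplices have distinct images. Surjectivity is a comparison of vertex sets, since
  \<open>phi\<close> commutes with convex hulls.\<close>

lemma phi_bij:
  "bij_betw (\<lambda>S. phi ` S) (equatorial_triangulation PG ordG) (equatorial_flow_triangulation G s t \<R> \<R>_ord)"
  unfolding bij_betw_def
proof
  have sub: "S \<subseteq> supported" if S_in: "S \<in> equatorial_triangulation PG ordG" for S
  proof -
    obtain A C where S: "S = convex hull ((\<lambda>R. indicator (Fid R)) ` (A \<union> C))"
      using S_in unfolding equatorial_triangulation_eq by blast
    show ?thesis
      unfolding S by (rule hull_minimal) (use Fid_indicator_supported convex_supported in auto)
  qed
  show "inj_on (\<lambda>S. phi ` S) (equatorial_triangulation PG ordG)"
    by (rule inj_onI) (metis inj_on_image_eq_iff[OF phi_inj] sub)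
  have image: "phi ` (convex hull ((\<lambda>R. indicator (Fid R)) ` (A \<union> C))) = convex hull (route_vec ` (A \<union> C))"
    if "A \<subseteq> \<R>" "C \<in> equatorial_cliques" for A C
  proof -
    have "phi (indicator (Fid R)) = route_vec R" if "R \<in> A \<union> C" for R
      using that \<open>A \<subseteq> \<R>\<close> \<open>C \<in> equatorial_cliques\<close> \<R>_route
      by (intro phi_indicator) (auto simp: equatorial_cliques_def)
    then have "phi ` (\<lambda>R. indicator (Fid R)) ` (A \<union> C) = route_vec ` (A \<union> C)"
      unfolding image_image by (rule image_cong[OF refl])
    then show ?thesis by (simp add: phi_convex_hull)
  qed
  show "(\<lambda>S. phi ` S) ` equatorial_triangulation PG ordG = equatorial_flow_triangulation G s t \<R> \<R>_ord"
    unfolding equatorial_triangulation_eq equatorial_flow_triangulation_eq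
  proof (intro equalityI subsetI)
    fix T assume "T \<in> (\<lambda>S. phi ` S) ` {convex hull ((\<lambda>R. indicator (Fid R)) ` (A \<union> C)) | A C. A \<subseteq> \<R> \<and> C \<in> equatorial_cliques}"
    then obtain A C where "T = phi ` (convex hull ((\<lambda>R. indicator (Fid R)) ` (A \<union> C)))" "A \<subseteq> \<R>" "C \<in> equatorial_cliques"
      by blast
    then show "T \<in> {convex hull (route_vec ` (A \<union> C)) | A C. A \<subseteq> \<R> \<and> C \<in> equatorial_cliques}"
      using image by blast
  next
    fix T assume "T \<in> {convex hull (route_vec ` (A \<union> C)) | A C. A \<subseteq> \<R> \<and> C \<in> equatorial_cliques}"
    then obtain A C where AC: "T = convex hull (route_vec ` (A \<union> C))" "A \<subseteq> \<R>" "C \<in> equatorial_cliques" by blast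
    then have "T = phi ` (convex hull ((\<lambda>R. indicator (Fid R)) ` (A \<union> C)))" using image by simp
    then show "T \<in> (\<lambda>S. phi ` S) ` {convex hull ((\<lambda>R. indicator (Fid R)) ` (A \<union> C)) | A C. A \<subseteq> \<R> \<and> C \<in> equatorial_cliques}"
      using AC(2,3) by blast
  qed
qed

end


section \<open>The correspondence of triangulations\<close>

theorem theorem6p27:
  fixes G :: "('v, 'e::finite) pre_digraph"
    and s t :: 'v
    and pos :: "'v \<Rightarrow> real \<times> real"
    and h :: "'e \<Rightarrow> real \<Rightarrow> real"
  assumes "fin_digraph G" and "arcs G = UNIV"
    and "acyclic (arcs_ends G)"
    and "{v \<in> verts G. in_arcs G v = {}} = {s}"
    and "{v \<in> verts G. out_arcs G v = {}} = {t}"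
    and "\<forall>e \<in> arcs G. \<not> idle G s t e"
    and "strongly_planar_realization G pos h"
    and "gorenstein (flow_polytope G s t)"
  shows "\<exists>\<R> ord. route_decomposition G s t \<R> \<and> linear_order_on \<R> ord \<and>
    bij_betw (\<lambda>S. order_to_flow G s t pos h ` S)
      (equatorial_triangulation (bounded_regions G pos h) (region_order G pos h))
      (equatorial_flow_triangulation G s t \<R> ord)"
proof -
  interpret fin_digraph G by (rule assms(1))
  interpret planar_flow_graph G s t pos h
  proof
    show "fst (pos (tail G e)) < fst (pos (head G e))" for e
      using assms(2,7) by (simp add: strongly_planar_realization_def tail_x_def head_x_def)
  qed (use assms in auto)
  interpret planar_flow_graph_balanced G s t pos h
    by unfold_locales (rule gorenstein_imp_all_ones[OF assms(8)])
  show ?thesis using \<R>_decomposition \<R>_linear_order phi_bij by blast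
qed

end
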